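(* Let $\alpha>0$, let $A,B,B_1$ be real random variables and let $\Psi:\mathbb{R}\to\mathbb{R}$ be a random Lipschitz mapping (all defined on a common probability space), with $\mathbb{E}\log^+L(\Psi)<\infty$, $\mathbb{E}\log^+|\Psi(0)|<\infty$ and $\lim_{n\to\infty}\frac1n\log L(\Psi_{n,1})<0$ a.s. Suppose that $$Ax+B_1\le\Psi(x)\le Ax+B\quad\text{a.s.},\qquad x\in\mathbb{R},$$ that $A\ge0$ a.s. and the conditional law of $\log A$ given $A>0$ is non-arithmetic, and that $\mathbb{E}A^{\alpha}=1$ and $\rho:=\mathbb{E}[A^{\alpha}\log A]<\infty$. Let $X$ be the random variable with the stationary law, $X\stackrel{d}{=}\Psi(X)$ with $X$ and $\Psi$ independent. (Right tail) Suppose that for each $Y\in\{B,B_1\}$: the function $x\mapsto x^{\alpha}\mathbb{P}(Y>x)$ is slowly varying, $\mathbb{E}Y_+^{\alpha}=\infty$, $\mathbb{E}Y_-^{\alpha-\varepsilon}<\infty$ for all $\varepsilon\in(0,\alpha)$, and $\mathbb{E}[A^{\eta}Y_+^{\alpha-\eta}]<\infty$ for some $\eta\in(0,\alpha)\cap(0,1]$ (possibly depending on $Y$). Put $L_r(x)=x^{\alpha}\mathbb{P}(B>x)$, $L_{1,r}(x)=x^{\alpha}\mathbb{P}(B_1>x)$, $\widetilde L_r(x)=\int_0^x\frac{L_r(t)}{t}dt$, $\widetilde L_{1,r}(x)=\int_0^x\frac{L_{1,r}(t)}{t}dt$. Then for every $\varepsilon>0$ and all sufficiently large $x$, $$\frac{1-\varepsilon}{\rho}\,\widetilde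 L_{1,r}(x)\le x^{\alpha}\,\mathbb{P}(X>x)\le\frac{1+\varepsilon}{\rho}\,\widetilde L_r(x),$$ and if $\widetilde L_r(x)\sim\widetilde L_{1,r}(x)$ then $x^{\alpha}\,\mathbb{P}(X>x)\sim\frac1\rho\widetilde L_r(x)$. (Left tail) Suppose that for each $Y\in\{B,B_1\}$: the function $x\mapsto x^{\alpha}\mathbb{P}(Y<-x)$ is slowly varying, $\mathbb{E}Y_-^{\alpha}=\infty$, $\mathbb{E}Y_+^{\alpha-\varepsilon}<\infty$ for all $\varepsilon\in(0,\alpha)$, and $\mathbb{E}[A^{\eta}Y_-^{\alpha-\eta}]<\infty$ for some $\eta\in(0,\alpha)\cap(0,1]$ (possibly depending on $Y$). Put $L_l(x)=x^{\alpha}\mathbb{P}(B<-x)$, $L_{1,l}(x)=x^{\alpha}\mathbb{P}(B_1<-x)$, $\widetilde L_l(x)=\int_0^x\frac{L_l(t)}{t}dt$, $\widetilde L_{1,l}(x)=\int_0^x\frac{L_{1,l}(t)}{t}dt$. Then for every $\varepsilon>0$ and all sufficiently large $x$, $$\frac{1-\varepsilon}{\rho}\,\widetilde L_{l}(x)\le x^{\alpha}\,\mathbb{P}(X<-x)\le\frac{1+\varepsilon}{\rho}\,\widetilde L_{1,l}(x),$$ and if $\widetilde L_l(x)\sim\widetilde L_{1,l}(x)$ then $x^{\alpha}\,\mathbb{P}(X<-x)\sim\frac1\rho\widetilde L_{l}(x)$.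
   Context: $a_+=\max\{a,0\}$ and $a_-=\max\{-a,0\}$. $f(x)\sim g(x)$ means $\lim_{x\to\infty}f(x)/g(x)=1$. A measurable $L:(0,\infty)\to(0,\infty)$ is slowly varying if $L(\lambda x)/L(x)\to1$ as $x\to\infty$ for every $\lambda>0$. A law on $\mathbb{R}$ is arithmetic if it is supported in $d\mathbb{Z}$ for some $d>0$, and non-arithmetic otherwise. The convention $0^\alpha\log0=0$ is used. $(\Psi_n)_{n\ge1}$ are i.i.d. copies of $\Psi$, $\Psi_{n,1}=\Psi_n\circ\dots\circ\Psi_1$, and $L(\Psi)$, $L(\Psi_{n,1})$ denote Lipschitz constants. Under the stated integrability and contractivity conditions on $\Psi$, the recursion $X_n=\Psi_n(X_{n-1})$ (with $X_0$ independent of $(\Psi_n)$) converges in law to a random variable $X$ whose law does not depend on $X_0$ and which satisfies $X\stackrel{d}{=}\Psi(X)$ with $X$ and $\Psi$ independent; this is the $X$ in the claim. *)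

theory Defs
  imports "HOL-Probability.Probability" "HOL-Library.Landau_Symbols"
begin

definition slowly_varying :: "(real \<Rightarrow> real) \<Rightarrow> bool" where
  "slowly_varying L \<longleftrightarrow>
     L \<in> borel_measurable (restrict_space borel {0<..}) \<and>
     (\<forall>x>0. L x > 0) \<and>
     (\<forall>c>0. ((\<lambda>x. L (c * x) / L x) \<longlongrightarrow> 1) at_top)"

definition arithmetic_law :: "real measure \<Rightarrow> bool" where
  "arithmetic_law \<mu> \<longleftrightarrow> (\<exists>d>0. AE x in \<mu>. \<exists>k::int. x = d * of_int k)"

text \<open>Random elements of \<open>real \<Rightarrow> real\<close> take values in the product sigma-algebra. As all
  sample paths are continuous, the law on it (i.e. the finite-dimensional distributions)
  determines the law of the random map.\<close>

definition path_algebra :: "(real \<Rightarrow> real) measure" where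
  "path_algebra = (\<Pi>\<^sub>M x\<in>UNIV. borel)"

definition random_lipschitz :: "'a measure \<Rightarrow> ('a \<Rightarrow> real \<Rightarrow> real) \<Rightarrow> bool" where
  "random_lipschitz M \<Psi> \<longleftrightarrow>
     \<Psi> \<in> measurable M path_algebra \<and>
     (\<forall>\<omega>\<in>space M. \<exists>C. C-lipschitz_on UNIV (\<Psi> \<omega>))"

text \<open>Only meaningful for Lipschitz \<open>f\<close>; otherwise the supremum is over an unbounded set.\<close>

definition lip_const :: "(real \<Rightarrow> real) \<Rightarrow> real" where
  "lip_const f = Sup {\<bar>f x - f y\<bar> / \<bar>x - y\<bar> | x y. x \<noteq> y}"

definition log_plus :: "real \<Rightarrow> real" where
  "log_plus x = ln (max 1 x)"

text \<open>Since \<open>ln 0 = 0\<close> in HOL, the logarithm of a Lipschitz constant that may vanish is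
  taken in the extended reals, with \<open>log 0 = -\<infinity>\<close>.\<close>

definition elog :: "real \<Rightarrow> ereal" where
  "elog x = (if x \<le> 0 then - \<infinity> else ereal (ln x))"

primrec fwd_comp :: "(nat \<Rightarrow> real \<Rightarrow> real) \<Rightarrow> nat \<Rightarrow> real \<Rightarrow> real" where
  "fwd_comp f 0 = id"
| "fwd_comp f (Suc n) = f (Suc n) \<circ> fwd_comp f n"

text \<open>The copies are indexed by \<open>n \<ge> 1\<close>; the value at \<open>0\<close> is irrelevant.\<close>

definition iid_copies :: "'a measure \<Rightarrow> ('a \<Rightarrow> real \<Rightarrow> real) \<Rightarrow> (nat \<Rightarrow> 'a \<Rightarrow> real \<Rightarrow> real) \<Rightarrow> bool" where
  "iid_copies M \<Psi> \<Psi>s \<longleftrightarrow>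
     (\<forall>n\<ge>1. random_lipschitz M (\<Psi>s n) \<and> distr M path_algebra (\<Psi>s n) = distr M path_algebra \<Psi>) \<and>
     prob_space.indep_vars M (\<lambda>_. path_algebra) \<Psi>s {1..}"

text \<open>\<open>indep_var\<close> requires both variables to have the same codomain type, hence
  independence is expressed through the generated sigma-algebras.\<close>

definition stationary :: "'a measure \<Rightarrow> ('a \<Rightarrow> real \<Rightarrow> real) \<Rightarrow> ('a \<Rightarrow> real) \<Rightarrow> bool" where
  "stationary M \<Psi> X \<longleftrightarrow>
     X \<in> borel_measurable M \<and>
     prob_space.indep_set M
       (sets (vimage_algebra (space M) \<Psi> path_algebra)) (sets (vimage_algebra (space M) X borel)) \<and>
     distr M borel (\<lambda>\<omega>. \<Psi> \<omega> (X \<omega>)) = distr M borel X"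

definition right_tail :: "'a measure \<Rightarrow> real \<Rightarrow> ('a \<Rightarrow> real) \<Rightarrow> real \<Rightarrow> real" where
  "right_tail M \<alpha> Y x = x powr \<alpha> * \<P>(\<omega> in M. Y \<omega> > x)"

definition left_tail :: "'a measure \<Rightarrow> real \<Rightarrow> ('a \<Rightarrow> real) \<Rightarrow> real \<Rightarrow> real" where
  "left_tail M \<alpha> Y x = x powr \<alpha> * \<P>(\<omega> in M. Y \<omega> < - x)"

definition log_integral :: "(real \<Rightarrow> real) \<Rightarrow> real \<Rightarrow> real" where
  "log_integral L x = (LBINT t:{0<..x}. L t / t)"

definition right_tail_conditions :: "'a measure \<Rightarrow> real \<Rightarrow> ('a \<Rightarrow> real) \<Rightarrow> ('a \<Rightarrow> real) \<Rightarrow> bool" where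
  "right_tail_conditions M \<alpha> A Y \<longleftrightarrow>
     slowly_varying (right_tail M \<alpha> Y) \<and>
     (\<integral>\<^sup>+\<omega>. ennreal (max (Y \<omega>) 0 powr \<alpha>) \<partial>M) = \<infinity> \<and>
     (\<forall>\<epsilon>\<in>{0<..<\<alpha>}. integrable M (\<lambda>\<omega>. max (- Y \<omega>) 0 powr (\<alpha> - \<epsilon>))) \<and>
     (\<exists>\<eta>\<in>{0<..<\<alpha>} \<inter> {0<..1}. integrable M (\<lambda>\<omega>. A \<omega> powr \<eta> * max (Y \<omega>) 0 powr (\<alpha> - \<eta>)))"

definition left_tail_conditions :: "'a measure \<Rightarrow> real \<Rightarrow> ('a \<Rightarrow> real) \<Rightarrow> ('a \<Rightarrow> real) \<Rightarrow> bool" where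
  "left_tail_conditions M \<alpha> A Y \<longleftrightarrow>
     slowly_varying (left_tail M \<alpha> Y) \<and>
     (\<integral>\<^sup>+\<omega>. ennreal (max (- Y \<omega>) 0 powr \<alpha>) \<partial>M) = \<infinity> \<and>
     (\<forall>\<epsilon>\<in>{0<..<\<alpha>}. integrable M (\<lambda>\<omega>. max (Y \<omega>) 0 powr (\<alpha> - \<epsilon>))) \<and>
     (\<exists>\<eta>\<in>{0<..<\<alpha>} \<inter> {0<..1}. integrable M (\<lambda>\<omega>. A \<omega> powr \<eta> * max (- Y \<omega>) 0 powr (\<alpha> - \<eta>)))"

end

theory Submission
  imports Defs "HOL-Real_Asymp.Real_Asymp"
begin

text \<open>For functions \<open>H\<close> on \<open>(0, \<infinity>)\<close> put \<open>T H x = E [A\<^sup>\<alpha> H (x / A)]\<close>. Constants are \<open>T\<close>-invariant,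
  while \<open>T\<close> multiplies \<open>x\<^sup>\<gamma>\<close> by \<open>E A\<^sup>\<alpha>\<^sup>-\<^sup>\<gamma> < 1\<close> for \<open>0 < \<gamma> < \<alpha>\<close>. Hence \<open>min x c\<^sup>\<gamma>\<close> is a bounded
  supersolution of the equation \<open>P - T P = x\<^sup>\<gamma> 1\<^sub>x\<^sub>\<le>\<^sub>c\<close> up to a factor, and averaging over \<open>c\<close> yields
  supersolutions for all error terms. This replaces the renewal theorem.

  Let \<open>H x = x\<^sup>\<alpha> E \<Phi>(X / x)\<close> with a piecewise linear \<open>\<Phi>\<close> close to the indicator of \<open>(1, \<infinity>)\<close>. As \<open>\<Phi>\<close> is
  Lipschitz, \<open>X \<le> A X + B\<close> turns into \<open>H \<le> T H + L + R\<close>, where \<open>R\<close> has a bounded supersolution. With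
  \<open>w\<close> the logarithmic integral of \<open>L\<close>, dominated convergence gives \<open>w - T w \<sim> \<rho> L\<close> up to jumps with \<open>A\<close> large,
  so \<open>(1 + \<epsilon>) w / \<rho>\<close> plus a bounded function is a supersolution for \<open>L + R\<close>. The difference between \<open>H\<close> and
  this supersolution is \<open>O (x\<^sup>\<beta>)\<close>, and iterating \<open>T\<close> makes it vanish.

  The lower bound is the same comparison with a subsolution. Its error terms involve the tail of the solution
  itself, and they are small compared to the logarithmic integral belonging to \<open>B1\<close> only after \<open>X\<close> has been
  replaced by the stochastically smaller iterates of the affine recursion driven by \<open>(A, B1)\<close>.\<close>

section \<open>Elementary inequalities\<close>

text \<open>\<open>T\<close> is the transition operator of a multiplicative random walk under the
  measure with density \<open>A powr \<alpha>\<close>. Its logarithmic drift \<rho> is positive, so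
  the potential of \<open>L\<close> should be close to \<open>w / \<rho>\<close>. Comparison needs a
  class of functions on which the initial error dies out. The constants are invariant, but they are
  not O(x^\<beta>) near 0, and on functions of order x^\<beta> with 0 < \<beta> < \<alpha> the
  iterates of \<open>T\<close> decay like \<theta>^n. Membership of \<open>H\<close> in this class
  is a moment of order \<alpha> - \<beta> of the stationary law, which must first be derived from
  the recursion. The slope 1/(l-1) of the smoothed indicator bounds the effect of a perturbation by
  a power of its size; the price is a factor l^\<alpha>, removed by l -> 1. For two large positive
  summands the costs have the form E[U^s x^(\<alpha>-s) 1{x \<le> 2V}], and their potential is
  bounded by a multiple of E[U^s V^(\<alpha>-s)]; this is where the mixed moments enter. The loss
  from very negative values of Y is not of this form; its potential is only shown to be at most
  \<delta> w + C for every \<delta> > 0, which still suffices because w is unbounded.\<close>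

lemma powr_le_affine:
  fixes y \<theta> :: real
  assumes "y \<ge> 0" "0 < \<theta>" "\<theta> < 1"
  shows "y powr \<theta> \<le> 1 - \<theta> + \<theta> * y" and "y \<noteq> 1 \<Longrightarrow> y powr \<theta> < 1 - \<theta> + \<theta> * y"
proof -
  have strict: "y powr \<theta> < 1 - \<theta> + \<theta> * y" if "y \<noteq> 1"
  proof (cases "y = 0")
    case False
    with assms have y: "y > 0" by simp
    define f where "f t = 1 - \<theta> + \<theta> * t - t powr \<theta>" for t
    have d: "(f has_real_derivative \<theta> * (1 - t powr (\<theta> - 1))) (at t)" if "t > 0" for t
      unfolding f_def using that by (auto intro!: derivative_eq_intros simp: algebra_simps powr_diff)
    have f1: "f 1 = 0" by (simp add: f_def)
    have "f y > 0"
    proof (cases "y < 1")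
      case True
      have "f y > f 1"
      proof (rule DERIV_neg_imp_decreasing_open[OF True])
        fix t assume t: "y < t" "t < 1"
        have "t powr (\<theta> - 1) > 1"
          using t y assms powr_less_mono2_neg[of "\<theta> - 1" t 1] by simp
        then have "\<theta> * (1 - t powr (\<theta> - 1)) < 0" using assms by (simp add: mult_pos_neg)
        then show "\<exists>z. DERIV f t :> z \<and> z < 0" using d[of t] t y by force
      next
        show "continuous_on {y..1} f"
          using y d by (intro DERIV_continuous_on[where D = "\<lambda>t. \<theta> * (1 - t powr (\<theta> - 1))"])
             (auto intro: has_field_derivative_at_within)
      qed
      then show ?thesis by (simp add: f1)
    next
      case False
      with that have y1: "1 < y" by simp
      have "f 1 < f y"
      proof (rule DERIV_pos_imp_increasing_open[OF y1])
        fix t assume t: "1 < t" "t < y"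
        have "t powr (\<theta> - 1) < 1"
          using t y assms powr_less_mono2_neg[of "\<theta> - 1" 1 t] by simp
        then have "\<theta> * (1 - t powr (\<theta> - 1)) > 0" using assms by simp
        then show "\<exists>z. DERIV f t :> z \<and> z > 0" using d[of t] t y by force
      next
        show "continuous_on {1..y} f"
          using y d by (intro DERIV_continuous_on[where D = "\<lambda>t. \<theta> * (1 - t powr (\<theta> - 1))"])
             (auto intro: has_field_derivative_at_within)
      qed
      then show ?thesis by (simp add: f1)
    qed
    then show ?thesis by (simp add: f_def)
  qed (use assms in auto)
  then show "y \<noteq> 1 \<Longrightarrow> y powr \<theta> < 1 - \<theta> + \<theta> * y" .
  show "y powr \<theta> \<le> 1 - \<theta> + \<theta> * y" using strict by (cases "y = 1") auto
qed

text \<open>With \<open>y = A powr \<alpha>\<close>, a variable of mean 1, this is the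
  non-negativity of a relative entropy; the equality case makes the drift \<rho> strictly positive.
  The proof is \<open>ln t \<le> t - 1\<close> at \<open>t = 1 / y\<close>.\<close>

lemma xlnx_ge:
  fixes y :: real assumes "y \<ge> 0"
  shows "y * ln y - y + 1 \<ge> 0" "y * ln y - y + 1 = 0 \<Longrightarrow> y = 1"
proof -
  have *: "y * ln y - y + 1 > 0" if "y \<noteq> 1"
  proof (cases "y = 0")
    case False
    then have y: "y > 0" using assms by simp
    have "ln (1 / y) \<le> 1 / y - 1" using y by (intro ln_le_minus_one) auto
    moreover have "ln (1 / y) \<noteq> 1 / y - 1" using y that ln_eq_minus_one[of "1 / y"] by auto
    ultimately have "ln (1 / y) < 1 / y - 1" by simp
    then have "y * ln (1 / y) < y * (1 / y - 1)" using y by simp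
    then show ?thesis using y by (simp add: ln_div algebra_simps)
  qed simp
  then show "y * ln y - y + 1 = 0 \<Longrightarrow> y = 1" by force
  show "y * ln y - y + 1 \<ge> 0" using * by (cases "y = 1") (auto simp: less_imp_le)
qed

lemma powr_subadd:
  fixes a b s :: real assumes "a \<ge> 0" "b \<ge> 0" "0 < s" "s \<le> 1"
  shows "(a + b) powr s \<le> a powr s + b powr s"
proof (cases "a + b = 0")
  case False
  then have ab: "a + b > 0" using assms by simp
  have "t / (a + b) \<le> (t / (a + b)) powr s" if "0 \<le> t" "t \<le> a + b" for t
  proof -
    have "(t / (a + b)) powr 1 \<le> (t / (a + b)) powr s"
      using that ab assms by (intro powr_mono') auto
    then show ?thesis using that ab by simp
  qed
  from add_mono[OF this[of a] this[of b]] have "1 \<le> (a / (a + b)) powr s + (b / (a + b)) powr s"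
    using assms ab by (simp add: add_divide_distrib[symmetric])
  also have "\<dots> = (a powr s + b powr s) / (a + b) powr s"
    using assms ab by (simp add: powr_divide add_divide_distrib)
  finally show ?thesis using ab by (simp add: field_simps)
qed (use assms in auto)

text \<open>Replaces subadditivity when the exponent exceeds 1. The first factor has to stay close
  to 1, because in the moment estimate it multiplies a contraction factor below 1; all excess is
  pushed into \<open>C\<close>. If \<open>b \<le> \<kappa> * a\<close>, then \<open>b\<close> is
  absorbed into \<open>a\<close>, otherwise \<open>a\<close> into \<open>b\<close>.\<close>

lemma powr_add_le:
  fixes s \<delta> :: real assumes "s > 0" "\<delta> > 0"
  shows "\<exists>C\<ge>0. \<forall>a\<ge>0. \<forall>b\<ge>0. (a + b) powr s \<le> (1 + \<delta>) * a powr s + C * b powr s"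
proof -
  define \<kappa> where "\<kappa> = (1 + \<delta>) powr (1 / s) - 1"
  have k: "\<kappa> > 0" "(1 + \<kappa>) powr s = 1 + \<delta>" using assms by (auto simp: \<kappa>_def powr_powr)
  have "(a + b) powr s \<le> (1 + \<delta>) * a powr s + (1 + 1 / \<kappa>) powr s * b powr s" if "a \<ge> 0" "b \<ge> 0" for a b
  proof (cases "b \<le> \<kappa> * a")
    case True
    have "(a + b) powr s \<le> ((1 + \<kappa>) * a) powr s"
      using True that assms by (intro powr_mono2) (auto simp: algebra_simps)
    also have "\<dots> = (1 + \<delta>) * a powr s" using k that by (simp add: powr_mult)
    finally show ?thesis by (simp add: add_increasing2)
  next
    case False
    then have "a \<le> b / \<kappa>" using k by (simp add: field_simps)
    then have "(a + b) powr s \<le> ((1 + 1 / \<kappa>) * b) powr s"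
      using that assms by (intro powr_mono2) (auto simp: algebra_simps)
    also have "\<dots> = (1 + 1 / \<kappa>) powr s * b powr s" using k that by (simp add: powr_mult)
    finally show ?thesis using assms by (simp add: add_increasing)
  qed
  then show ?thesis by (intro exI[of _ "(1 + 1 / \<kappa>) powr s"]) auto
qed

lemma min1_le_powr:
  fixes u s :: real assumes "u \<ge> 0" "0 < s" "s \<le> 1" shows "min 1 u \<le> u powr s"
proof (cases "u \<ge> 1")
  case True
  then show ?thesis using assms by (auto intro: ge_one_powr_ge_zero)
next
  case False
  then have "u powr 1 \<le> u powr s" using assms by (intro powr_mono') auto
  then show ?thesis using assms False by (auto simp: min_def)
qed

text \<open>About \<open>ln c\<close> terms are cut off at 1, and the remaining ones are dominated
  by a geometric series of sum at most 2; rounding the number of cut off terms up to an integer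
  costs the third unit.\<close>

lemma suminf_min_exp_le:
  fixes c :: real
  assumes c: "c \<ge> 0"
  shows "(\<Sum>j. ennreal (min 1 (c * exp (- real j)))) \<le> ennreal (3 + ln (max 1 c))"
proof -
  define m where "m = nat \<lceil>ln (max 1 c)\<rceil>"
  have m: "ln (max 1 c) \<le> real m" "real m \<le> ln (max 1 c) + 1" by (auto simp: m_def)
  have cm: "c \<le> exp (real m)"
  proof -
    have "c \<le> max 1 c" by simp
    also have "\<dots> = exp (ln (max 1 c))" by simp
    also have "\<dots> \<le> exp (real m)" by (subst exp_le_cancel_iff) (rule m(1))
    finally show ?thesis .
  qed
  have geo: "(\<lambda>j. exp (- 1 :: real) ^ j) sums (1 / (1 - exp (- 1)))" by (rule geometric_sums) simp
  have e1: "exp (- 1 :: real) \<le> 1 / 2" using exp_ge_add_one_self[of "1::real"] by (simp add: exp_minus field_simps)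
  have "(\<Sum>j. ennreal (min 1 (c * exp (- real j)))) \<le> (\<Sum>j. ennreal (if j < m then 1 else 0) + ennreal (if j < m then 0 else exp (- 1) ^ (j - m)))"
  proof (intro suminf_le)
    fix j
    show "ennreal (min 1 (c * exp (- real j))) \<le> ennreal (if j < m then 1 else 0) + ennreal (if j < m then 0 else exp (- 1) ^ (j - m))"
    proof (cases "j < m")
      case True
      then show ?thesis by (simp add: ennreal_le_1)
    next
      case False
      have "c * exp (- real j) \<le> exp (real m) * exp (- real j)" using cm by (intro mult_right_mono) auto
      also have "\<dots> = exp (- 1) ^ (j - m)" using False by (simp add: exp_add[symmetric] exp_of_nat_mult[symmetric] of_nat_diff)
      finally show ?thesis using False by (auto intro!: ennreal_leI)
    qed
  qed auto
  also have "\<dots> = (\<Sum>j. ennreal (if j < m then 1 else 0)) + (\<Sum>j. ennreal (if j < m then 0 else exp (- 1) ^ (j - m)))"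
    by (rule suminf_add[symmetric]) auto
  also have "(\<Sum>j. ennreal (if j < m then 1 else 0)) = ennreal (real m)"
  proof -
    have "(\<Sum>j. ennreal (if j < m then 1 else 0)) = (\<Sum>j<m. ennreal (if j < m then 1 else 0))"
      by (rule suminf_finite) auto
    then show ?thesis by (simp add: ennreal_of_nat_eq_real_of_nat)
  qed
  also have "(\<Sum>j. ennreal (if j < m then 0 else exp (- 1) ^ (j - m))) = ennreal (1 / (1 - exp (- 1)))"
  proof -
    have "(\<lambda>j. if j + m < m then 0 else exp (- 1 :: real) ^ (j + m - m)) sums (1 / (1 - exp (- 1)))"
      using geo by simp
    then have "(\<lambda>j. if j < m then 0 else exp (- 1 :: real) ^ (j - m)) sums (1 / (1 - exp (- 1)) + (\<Sum>j<m. if j < m then 0 else exp (- 1) ^ (j - m)))"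
      by (subst (asm) sums_iff_shift)
    then have "(\<lambda>j. if j < m then 0 else exp (- 1 :: real) ^ (j - m)) sums (1 / (1 - exp (- 1)))" by simp
    then show ?thesis by (subst suminf_ennreal_eq) auto
  qed
  also have "ennreal (real m) + ennreal (1 / (1 - exp (- 1))) \<le> ennreal (3 + ln (max 1 c))"
  proof -
    have "1 / (1 - exp (- 1 :: real)) \<le> 2" using e1 by (simp add: field_simps)
    then have "real m + 1 / (1 - exp (- 1)) \<le> 3 + ln (max 1 c)" using m by simp
    moreover have "0 \<le> 1 / (1 - exp (- 1 :: real))" using e1 by simp
    ultimately show ?thesis by (simp add: ennreal_plus[symmetric] ennreal_leI del: ennreal_plus)
  qed
  finally show ?thesis .
qed

section \<open>Moments through truncation, products and layers\<close>

lemma truncated_moment_sup: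
  assumes [measurable_cong]: "sets N = sets borel" and s: "s > 0"
    and b: "\<And>x. x > 0 \<Longrightarrow> (\<integral>\<^sup>+z. ennreal (min \<bar>z\<bar> x powr s) \<partial>N) \<le> K"
  shows "(\<integral>\<^sup>+z. ennreal (\<bar>z\<bar> powr s) \<partial>N) \<le> K"
proof -
  have "(\<integral>\<^sup>+z. ennreal (\<bar>z\<bar> powr s) \<partial>N) = (\<integral>\<^sup>+z. (SUP n. ennreal (min \<bar>z\<bar> (real (Suc n)) powr s)) \<partial>N)"
  proof (rule nn_integral_cong)
    fix z
    obtain n where n: "\<bar>z\<bar> \<le> real n" using real_arch_simple by blast
    show "ennreal (\<bar>z\<bar> powr s) = (SUP n. ennreal (min \<bar>z\<bar> (real (Suc n)) powr s))"
    proof (rule antisym)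
      show "ennreal (\<bar>z\<bar> powr s) \<le> (SUP n. ennreal (min \<bar>z\<bar> (real (Suc n)) powr s))"
        using n by (intro SUP_upper2[of n]) (auto simp: min_def)
      show "(SUP n. ennreal (min \<bar>z\<bar> (real (Suc n)) powr s)) \<le> ennreal (\<bar>z\<bar> powr s)"
        using s by (intro SUP_least ennreal_leI powr_mono2) auto
    qed
  qed
  also have "\<dots> = (SUP n. \<integral>\<^sup>+z. ennreal (min \<bar>z\<bar> (real (Suc n)) powr s) \<partial>N)"
    using s by (intro nn_integral_monotone_convergence_SUP)
      (auto simp: incseq_def le_fun_def intro!: ennreal_leI powr_mono2)
  also have "\<dots> \<le> K" by (intro SUP_least b) simp
  finally show ?thesis .
qed

lemma (in prob_space) nn_integral_pair_mult:
  assumes N: "prob_space N" and [measurable]: "f \<in> borel_measurable N" "g \<in> borel_measurable M"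
  shows "(\<integral>\<^sup>+p. f (fst p) * g (snd p) \<partial>(N \<Otimes>\<^sub>M M)) = (\<integral>\<^sup>+z. f z \<partial>N) * (\<integral>\<^sup>+\<omega>. (g \<omega> :: ennreal) \<partial>M)"
proof -
  have "(\<integral>\<^sup>+p. f (fst p) * g (snd p) \<partial>(N \<Otimes>\<^sub>M M)) = (\<integral>\<^sup>+z. \<integral>\<^sup>+\<omega>. f z * g \<omega> \<partial>M \<partial>N)"
    by (subst nn_integral_fst[symmetric]) auto
  then show ?thesis by (simp add: nn_integral_cmult nn_integral_multc)
qed

lemma (in prob_space) layer_cake:
  assumes [measurable]: "Z \<in> borel_measurable M" and Z0: "\<And>\<omega>. Z \<omega> \<ge> 0" and s: "s > 0"
  shows "(\<integral>\<^sup>+\<omega>. ennreal (Z \<omega> powr s) \<partial>M)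
    = (\<integral>\<^sup>+t. ennreal (s * t powr (s - 1) * prob {\<omega> \<in> space M. Z \<omega> > t}) * indicator {0<..} t \<partial>lborel)"
proof -
  interpret pair_sigma_finite M lborel ..
  have 1: "ennreal (Z \<omega> powr s) = (\<integral>\<^sup>+t. ennreal (s * t powr (s - 1)) * indicator {0<..} t * indicator {t<..} (Z \<omega>) \<partial>lborel)" for \<omega>
  proof -
    have "((\<lambda>t. t powr (s - 1)) has_integral (Z \<omega> powr s / s)) {0..Z \<omega>}"
      using has_integral_powr_from_0[of "s - 1" "Z \<omega>"] s Z0[of \<omega>] by simp
    from has_integral_mult_right[OF this, of s]
    have "((\<lambda>t. s * t powr (s - 1)) has_integral (Z \<omega> powr s)) {0..Z \<omega>}" using s by simp
    then have "(\<integral>\<^sup>+t. ennreal (indicator {0..Z \<omega>} t * (s * t powr (s - 1))) \<partial>lborel) = ennreal (Z \<omega> powr s)"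
      using s by (intro nn_integral_has_integral_lebesgue) auto
    moreover have "(\<integral>\<^sup>+t. ennreal (indicator {0..Z \<omega>} t * (s * t powr (s - 1))) \<partial>lborel)
      = (\<integral>\<^sup>+t. ennreal (s * t powr (s - 1)) * indicator {0<..} t * indicator {t<..} (Z \<omega>) \<partial>lborel)"
    proof (intro nn_integral_cong_AE, use AE_lborel_singleton[of "Z \<omega>"] in eventually_elim)
      fix t assume "t \<noteq> Z \<omega>"
      then show "ennreal (indicator {0..Z \<omega>} t * (s * t powr (s - 1)))
         = ennreal (s * t powr (s - 1)) * indicator {0<..} t * indicator {t<..} (Z \<omega>)"
        by (cases "t = 0") (auto simp: indicator_def)
    qed
    ultimately show ?thesis by simp
  qed
  have [measurable]: "Measurable.pred (M \<Otimes>\<^sub>M lborel) (\<lambda>p. Z (fst p) \<in> {snd p<..})"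
    unfolding greaterThan_iff by measurable
  have "(\<integral>\<^sup>+\<omega>. ennreal (Z \<omega> powr s) \<partial>M)
    = (\<integral>\<^sup>+t. \<integral>\<^sup>+\<omega>. ennreal (s * t powr (s - 1)) * indicator {0<..} t * indicator {t<..} (Z \<omega>) \<partial>M \<partial>lborel)"
    unfolding 1 by (rule Fubini'[symmetric]) measurable
  also have "\<dots> = (\<integral>\<^sup>+t. ennreal (s * t powr (s - 1) * prob {\<omega> \<in> space M. Z \<omega> > t}) * indicator {0<..} t \<partial>lborel)"
  proof (intro nn_integral_cong)
    fix t :: real
    have "(\<integral>\<^sup>+\<omega>. indicator {t<..} (Z \<omega>) \<partial>M) = (\<integral>\<^sup>+\<omega>. indicator {\<omega> \<in> space M. Z \<omega> > t} \<omega> \<partial>M)"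
      by (intro nn_integral_cong) (auto simp: indicator_def)
    also have "\<dots> = emeasure M {\<omega> \<in> space M. Z \<omega> > t}" by simp
    finally have "(\<integral>\<^sup>+\<omega>. indicator {t<..} (Z \<omega>) \<partial>M) = ennreal (prob {\<omega> \<in> space M. Z \<omega> > t})"
      by (simp add: emeasure_eq_measure)
    then show "(\<integral>\<^sup>+\<omega>. ennreal (s * t powr (s - 1)) * indicator {0<..} t * indicator {t<..} (Z \<omega>) \<partial>M)
     = ennreal (s * t powr (s - 1) * prob {\<omega> \<in> space M. Z \<omega> > t}) * indicator {0<..} t"
      using s by (subst nn_integral_cmult) (auto simp: ennreal_mult ac_simps)
  qed
  finally show ?thesis .
qed

section \<open>The tilted multiplier and its supersolutions\<close>

text \<open>Non-negativity of \<open>A\<close> is demanded everywhere and not only almost surely,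
  which spares exceptional sets in all pointwise estimates; the theorem applies the locale to the
  positive part of its multiplier.\<close>

locale tilted_multiplier = prob_space M for M :: "'a measure" +
  fixes A :: "'a \<Rightarrow> real" and \<alpha> :: real
  assumes alpha_pos: "\<alpha> > 0"
    and A_meas [measurable]: "A \<in> borel_measurable M"
    and A_nonneg: "\<And>\<omega>. A \<omega> \<ge> 0"
    and A_int: "integrable M (\<lambda>\<omega>. A \<omega> powr \<alpha>)"
    and A_one: "(\<integral>\<omega>. A \<omega> powr \<alpha> \<partial>M) = 1"
    and A_ln_int: "integrable M (\<lambda>\<omega>. A \<omega> powr \<alpha> * ln (A \<omega>))"
    and A_nontriv: "\<not> (AE \<omega> in M. A \<omega> = 1)"
begin

definition \<phi> :: "real \<Rightarrow> real" where "\<phi> s = (\<integral>\<omega>. A \<omega> powr s \<partial>M)"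

text \<open>If \<open>H x\<close> is x^\<alpha> times the tail of a law at \<open>x\<close>, then
  \<open>T H x\<close> is x^\<alpha> times the tail of the product of \<open>A\<close> with an
  independent variable of that law, for \<open>x > 0\<close>. Where \<open>A\<close> vanishes, the
  weight \<open>0 powr \<alpha> = 0\<close> removes the meaningless value
  \<open>H (x / 0)\<close>.\<close>

definition T :: "(real \<Rightarrow> ennreal) \<Rightarrow> real \<Rightarrow> ennreal" where
  "T H x = (\<integral>\<^sup>+\<omega>. ennreal (A \<omega> powr \<alpha>) * H (x / A \<omega>) \<partial>M)"

definition \<rho> :: real where "\<rho> = (\<integral>\<omega>. A \<omega> powr \<alpha> * ln (A \<omega>) \<partial>M)"

lemma A_powr_eq_1: "A \<omega> powr \<alpha> = 1 \<Longrightarrow> A \<omega> = 1"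
proof -
  assume *: "A \<omega> powr \<alpha> = 1"
  then have "A \<omega> > 0" using A_nonneg[of \<omega>] by (cases "A \<omega> = 0") auto
  moreover from this * have "\<alpha> * ln (A \<omega>) = 0" by (metis ln_one ln_powr)
  ultimately show "A \<omega> = 1" using alpha_pos by simp
qed

lemma A_powr_le: "0 < s \<Longrightarrow> s < \<alpha> \<Longrightarrow> A \<omega> powr s \<le> 1 - s / \<alpha> + s / \<alpha> * A \<omega> powr \<alpha>"
  using powr_le_affine(1)[of "A \<omega> powr \<alpha>" "s / \<alpha>"] alpha_pos A_nonneg[of \<omega>] by (simp add: powr_powr)

lemma A_powr_int: "0 < s \<Longrightarrow> s \<le> \<alpha> \<Longrightarrow> integrable M (\<lambda>\<omega>. A \<omega> powr s)"
proof (cases "s = \<alpha>")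
  case False
  assume "0 < s" "s \<le> \<alpha>"
  with False have s: "0 < s" "s < \<alpha>" by auto
  show ?thesis
    by (rule Bochner_Integration.integrable_bound[of _ "\<lambda>\<omega>. 1 - s / \<alpha> + s / \<alpha> * A \<omega> powr \<alpha>"])
       (use A_int A_powr_le[OF s] s in \<open>auto intro!: AE_I2 order.trans[OF _ abs_ge_self]\<close>)
qed (use A_int in simp)

text \<open>The gap \<open>d\<close> in the weighted arithmetic-geometric mean inequality for
  \<open>A powr \<alpha>\<close> and 1 has mean \<open>1 - \<phi> s\<close>. A vanishing mean would
  force equality almost surely, hence \<open>A = 1\<close> almost surely.\<close>

lemma phi_less_1:
  assumes "0 < s" "s < \<alpha>" shows "\<phi> s < 1"
proof -
  define d where "d \<omega> = 1 - s / \<alpha> + s / \<alpha> * A \<omega> powr \<alpha> - A \<omega> powr s" for \<omega>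
  have d0: "d \<omega> \<ge> 0" for \<omega> using A_powr_le[OF assms, of \<omega>] by (simp add: d_def)
  have int: "integrable M d" unfolding d_def using A_int A_powr_int[of s] assms by auto
  have "(\<integral>\<omega>. d \<omega> \<partial>M) = 1 - s / \<alpha> + s / \<alpha> - \<phi> s"
    unfolding d_def \<phi>_def using A_int A_powr_int[of s] assms A_one by (simp add: prob_space)
  moreover have "(\<integral>\<omega>. d \<omega> \<partial>M) \<noteq> 0"
  proof
    assume "(\<integral>\<omega>. d \<omega> \<partial>M) = 0"
    then have "AE \<omega> in M. d \<omega> = 0" using integral_nonneg_eq_0_iff_AE[OF int] d0 by auto
    then have "AE \<omega> in M. A \<omega> = 1"
    proof eventually_elim
      case (elim \<omega>)
      have "A \<omega> powr \<alpha> = 1"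
        using powr_le_affine(2)[of "A \<omega> powr \<alpha>" "s / \<alpha>"] assms alpha_pos elim by (auto simp: d_def powr_powr)
      then show ?case by (rule A_powr_eq_1)
    qed
    then show False using A_nontriv by simp
  qed
  moreover have "(\<integral>\<omega>. d \<omega> \<partial>M) \<ge> 0" using d0 by simp
  ultimately show ?thesis by simp
qed

lemma phi_nonneg: "\<phi> s \<ge> 0" by (simp add: \<phi>_def)

lemma nn_A_powr: "0 < s \<Longrightarrow> s \<le> \<alpha> \<Longrightarrow> (\<integral>\<^sup>+\<omega>. ennreal (A \<omega> powr s) \<partial>M) = ennreal (\<phi> s)"
  unfolding \<phi>_def by (rule nn_integral_eq_integral[OF A_powr_int]) auto

lemma phi_alpha: "\<phi> \<alpha> = 1" by (simp add: \<phi>_def A_one)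

lemma nn_A_alpha: "(\<integral>\<^sup>+\<omega>. ennreal (A \<omega> powr \<alpha>) \<partial>M) = 1"
  using nn_A_powr[of \<alpha>] alpha_pos by (simp add: phi_alpha)

text \<open>As \<open>A powr \<alpha>\<close> has mean 1, the relative entropy integrand
  \<open>d\<close> has mean \<open>\<alpha> * \<rho>\<close>; it can vanish almost surely only if
  \<open>A = 1\<close> almost surely.\<close>

lemma rho_pos: "\<rho> > 0"
proof -
  define d where "d \<omega> = \<alpha> * (A \<omega> powr \<alpha> * ln (A \<omega>)) - A \<omega> powr \<alpha> + 1" for \<omega>
  have d_eq: "d \<omega> = A \<omega> powr \<alpha> * ln (A \<omega> powr \<alpha>) - A \<omega> powr \<alpha> + 1" for \<omega>
    using A_nonneg[of \<omega>] by (simp add: d_def ln_powr)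
  have d0: "d \<omega> \<ge> 0" for \<omega> unfolding d_eq by (rule xlnx_ge) simp
  have int: "integrable M d" unfolding d_def using A_int A_ln_int by auto
  have "(\<integral>\<omega>. d \<omega> \<partial>M) = \<alpha> * \<rho>"
    unfolding d_def \<rho>_def using A_int A_ln_int A_one by (simp add: prob_space)
  moreover have "(\<integral>\<omega>. d \<omega> \<partial>M) \<noteq> 0"
  proof
    assume "(\<integral>\<omega>. d \<omega> \<partial>M) = 0"
    then have "AE \<omega> in M. d \<omega> = 0" using integral_nonneg_eq_0_iff_AE[OF int] d0 by auto
    then have "AE \<omega> in M. A \<omega> = 1"
    proof eventually_elim
      case (elim \<omega>)
      have "A \<omega> powr \<alpha> = 1"
        using xlnx_ge(2)[of "A \<omega> powr \<alpha>"] elim by (auto simp: d_eq)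
      then show ?case by (rule A_powr_eq_1)
    qed
    then show False using A_nontriv by simp
  qed
  moreover have "(\<integral>\<omega>. d \<omega> \<partial>M) \<ge> 0" using d0 by simp
  ultimately have "\<alpha> * \<rho> > 0" by linarith
  then show ?thesis using alpha_pos by (simp add: zero_less_mult_iff)
qed

lemma T_mono:
  assumes "\<And>y. y > 0 \<Longrightarrow> H y \<le> H' y" "x > 0" shows "T H x \<le> T H' x"
  unfolding T_def
proof (rule nn_integral_mono)
  fix \<omega>
  show "ennreal (A \<omega> powr \<alpha>) * H (x / A \<omega>) \<le> ennreal (A \<omega> powr \<alpha>) * H' (x / A \<omega>)"
    using assms A_nonneg[of \<omega>] by (cases "A \<omega> = 0") (auto intro!: mult_left_mono)
qed

lemma T_add:
  assumes [measurable]: "H \<in> borel_measurable borel" "H' \<in> borel_measurable borel"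
  shows "T (\<lambda>x. H x + H' x) x = T H x + T H' x"
  unfolding T_def by (subst nn_integral_add[symmetric]) (auto simp: distrib_left)

lemma T_cmult:
  assumes [measurable]: "H \<in> borel_measurable borel"
  shows "T (\<lambda>x. c * H x) x = c * T H x"
  unfolding T_def by (subst nn_integral_cmult[symmetric]) (auto simp: ac_simps)

lemma T_const: "T (\<lambda>x. c) x = c"
  unfolding T_def by (subst nn_integral_multc) (auto simp: nn_A_alpha)

lemma T_powr:
  assumes "0 < \<gamma>" "\<gamma> < \<alpha>" "x > 0"
  shows "T (\<lambda>x. ennreal (x powr \<gamma>)) x = ennreal (\<phi> (\<alpha> - \<gamma>) * x powr \<gamma>)"
proof -
  have "T (\<lambda>x. ennreal (x powr \<gamma>)) x = (\<integral>\<^sup>+\<omega>. ennreal (A \<omega> powr (\<alpha> - \<gamma>)) * ennreal (x powr \<gamma>) \<partial>M)"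
    unfolding T_def
  proof (intro nn_integral_cong)
    fix \<omega>
    show "ennreal (A \<omega> powr \<alpha>) * ennreal ((x / A \<omega>) powr \<gamma>) = ennreal (A \<omega> powr (\<alpha> - \<gamma>)) * ennreal (x powr \<gamma>)"
      using assms A_nonneg[of \<omega>] by (cases "A \<omega> = 0") (auto simp: ennreal_mult[symmetric] powr_divide powr_diff)
  qed
  also have "\<dots> = ennreal (\<phi> (\<alpha> - \<gamma>)) * ennreal (x powr \<gamma>)"
    using assms by (subst nn_integral_multc) (auto simp: nn_A_powr)
  finally show ?thesis by (simp add: ennreal_mult phi_nonneg)
qed

lemma T_nn_integral:
  assumes "sigma_finite_measure S" and H [measurable]: "case_prod H \<in> borel_measurable (S \<Otimes>\<^sub>M borel)"
  shows "T (\<lambda>x. \<integral>\<^sup>+i. H i x \<partial>S) x = (\<integral>\<^sup>+i. T (H i) x \<partial>S)"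
proof -
  interpret S: sigma_finite_measure S by fact
  interpret pair_sigma_finite S M ..
  have [measurable]: "(\<lambda>x. H i x) \<in> borel_measurable borel" if "i \<in> space S" for i
    using that by measurable
  have "T (\<lambda>x. \<integral>\<^sup>+i. H i x \<partial>S) x = (\<integral>\<^sup>+\<omega>. \<integral>\<^sup>+i. ennreal (A \<omega> powr \<alpha>) * H i (x / A \<omega>) \<partial>S \<partial>M)"
    unfolding T_def by (intro nn_integral_cong nn_integral_cmult[symmetric]) measurable
  also have "\<dots> = (\<integral>\<^sup>+i. \<integral>\<^sup>+\<omega>. ennreal (A \<omega> powr \<alpha>) * H i (x / A \<omega>) \<partial>M \<partial>S)"
    by (rule Fubini') measurable
  finally show ?thesis by (simp add: T_def)
qed

text \<open>\<open>pot P s\<close> says that \<open>P\<close> dominates the potential of the source \<open>s\<close>, i.e. the sum of all \<open>T\<^sup>n s\<close>.\<close>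

definition pot :: "(real \<Rightarrow> ennreal) \<Rightarrow> (real \<Rightarrow> ennreal) \<Rightarrow> bool" where
  "pot P s \<longleftrightarrow> P \<in> borel_measurable borel \<and> (\<forall>x>0. T P x + s x \<le> P x)"

lemma pot_add: "pot P s \<Longrightarrow> pot P' s' \<Longrightarrow> pot (\<lambda>x. P x + P' x) (\<lambda>x. s x + s' x)"
  unfolding pot_def
proof safe
  fix x :: real
  assume x: "x > 0" and m: "P \<in> borel_measurable borel" "P' \<in> borel_measurable borel"
    and le: "\<forall>x>0. T P x + s x \<le> P x" "\<forall>x>0. T P' x + s' x \<le> P' x"
  have "T (\<lambda>x. P x + P' x) x + (s x + s' x) = (T P x + s x) + (T P' x + s' x)"
    using m by (simp add: T_add ac_simps)
  also have "\<dots> \<le> P x + P' x" using le x by (intro add_mono) auto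
  finally show "T (\<lambda>x. P x + P' x) x + (s x + s' x) \<le> P x + P' x" .
qed auto

lemma pot_cmult: "pot P s \<Longrightarrow> pot (\<lambda>x. c * P x) (\<lambda>x. c * s x)"
  unfolding pot_def by (auto simp: T_cmult distrib_left[symmetric] intro: mult_left_mono)

lemma pot_le: "pot P s \<Longrightarrow> (\<And>x. x > 0 \<Longrightarrow> s' x \<le> s x) \<Longrightarrow> pot P s'"
  unfolding pot_def by (meson add_left_mono order.trans)

lemma pot_scale:
  assumes "pot P s" "c > 0" shows "pot (\<lambda>x. P (c * x)) (\<lambda>x. s (c * x))"
proof -
  have [measurable]: "P \<in> borel_measurable borel" using assms by (simp add: pot_def)
  have "T (\<lambda>x. P (c * x)) x = T P (c * x)" for x by (simp add: T_def)
  with assms show ?thesis by (auto simp: pot_def)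
qed

lemma pot_nn_integral:
  assumes "sigma_finite_measure S" and [measurable]: "case_prod P \<in> borel_measurable (S \<Otimes>\<^sub>M borel)"
   "case_prod s \<in> borel_measurable (S \<Otimes>\<^sub>M borel)"
   and "\<And>i. i \<in> space S \<Longrightarrow> pot (P i) (s i)"
 shows "pot (\<lambda>x. \<integral>\<^sup>+i. P i x \<partial>S) (\<lambda>x. \<integral>\<^sup>+i. s i x \<partial>S)"
  unfolding pot_def
proof safe
  interpret S: sigma_finite_measure S by fact
  interpret pair_sigma_finite S M ..
  show "(\<lambda>x. \<integral>\<^sup>+i. P i x \<partial>S) \<in> borel_measurable borel" by measurable
  fix x :: real assume x: "x > 0"
  have [measurable]: "(\<lambda>i. T (P i) x) \<in> borel_measurable S" unfolding T_def by measurable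
  have "T (\<lambda>x. \<integral>\<^sup>+i. P i x \<partial>S) x + (\<integral>\<^sup>+i. s i x \<partial>S) = (\<integral>\<^sup>+i. T (P i) x + s i x \<partial>S)"
    by (simp add: T_nn_integral[OF assms(1)] nn_integral_add)
  also have "\<dots> \<le> (\<integral>\<^sup>+i. P i x \<partial>S)"
    using assms(4) x by (intro nn_integral_mono) (auto simp: pot_def)
  finally show "T (\<lambda>x. \<integral>\<^sup>+i. P i x \<partial>S) x + (\<integral>\<^sup>+i. s i x \<partial>S) \<le> (\<integral>\<^sup>+i. P i x \<partial>S)" .
qed

text \<open>The minimum lies below the power, which \<open>T\<close> contracts, and below the
  constant c^\<gamma>, which \<open>T\<close> preserves. The first comparison is used for
  \<open>x \<le> c\<close>, where it leaves a gain of
  \<open>1 - \<phi> (\<alpha> - \<gamma>)\<close> times the power, and the second one beyond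
  \<open>c\<close>.\<close>

lemma pot_min_powr:
  assumes g: "0 < \<gamma>" "\<gamma> < \<alpha>" and "c \<ge> 0"
  shows "pot (\<lambda>x. ennreal (min x c powr \<gamma>)) (\<lambda>x. ennreal ((1 - \<phi> (\<alpha> - \<gamma>)) * x powr \<gamma>) * indicator {..c} x)"
  unfolding pot_def
proof safe
  show "(\<lambda>x. ennreal (min x c powr \<gamma>)) \<in> borel_measurable borel" by measurable
  fix x :: real assume x: "x > 0"
  have f: "\<phi> (\<alpha> - \<gamma>) < 1" using phi_less_1[of "\<alpha> - \<gamma>"] g by simp
  show "T (\<lambda>x. ennreal (min x c powr \<gamma>)) x + ennreal ((1 - \<phi> (\<alpha> - \<gamma>)) * x powr \<gamma>) * indicator {..c} x
       \<le> ennreal (min x c powr \<gamma>)"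
  proof (cases "x \<le> c")
    case True
    have "T (\<lambda>x. ennreal (min x c powr \<gamma>)) x \<le> T (\<lambda>x. ennreal (x powr \<gamma>)) x"
      using x g assms(3) by (intro T_mono) (auto intro!: ennreal_leI powr_mono2)
    also have "\<dots> = ennreal (\<phi> (\<alpha> - \<gamma>) * x powr \<gamma>)" using g x by (rule T_powr)
    finally have "T (\<lambda>x. ennreal (min x c powr \<gamma>)) x + ennreal ((1 - \<phi> (\<alpha> - \<gamma>)) * x powr \<gamma>)
       \<le> ennreal (\<phi> (\<alpha> - \<gamma>) * x powr \<gamma>) + ennreal ((1 - \<phi> (\<alpha> - \<gamma>)) * x powr \<gamma>)" by (rule add_right_mono)
    also have "\<dots> = ennreal (x powr \<gamma>)"
      using f phi_nonneg by (subst ennreal_plus[symmetric]) (auto simp: algebra_simps mult_left_le)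
    finally show ?thesis using True by simp
  next
    case False
    have "T (\<lambda>x. ennreal (min x c powr \<gamma>)) x \<le> T (\<lambda>x. ennreal (c powr \<gamma>)) x"
      using x g assms(3) by (intro T_mono) (auto intro!: ennreal_leI powr_mono2)
    then show ?thesis using False by (simp add: T_const)
  qed
qed

text \<open>Superposition of the previous supersolutions over random cut-offs \<open>c i\<close>.
  The result stays bounded by the integral of \<open>k i * c i powr \<gamma>\<close>, so that
  bounding a potential amounts to checking one moment.\<close>

lemma pot_mix:
  assumes "sigma_finite_measure S" and [measurable]: "k \<in> borel_measurable S" "c \<in> borel_measurable S"
   and g: "0 < \<gamma>" "\<gamma> < \<alpha>" and "\<And>i. i \<in> space S \<Longrightarrow> c i \<ge> 0"
 shows "pot (\<lambda>x. \<integral>\<^sup>+i. k i * ennreal (min x (c i) powr \<gamma>) \<partial>S)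
    (\<lambda>x. ennreal ((1 - \<phi> (\<alpha> - \<gamma>))) * (\<integral>\<^sup>+i. k i * (ennreal (x powr \<gamma>) * indicator {x..} (c i)) \<partial>S))"
proof -
  have f: "\<phi> (\<alpha> - \<gamma>) < 1" using phi_less_1[of "\<alpha> - \<gamma>"] g by simp
  have [measurable]: "Measurable.pred (S \<Otimes>\<^sub>M borel) (\<lambda>p. c (fst p) \<in> {snd p..})"
    unfolding atLeast_iff by measurable
  have "pot (\<lambda>x. \<integral>\<^sup>+i. k i * ennreal (min x (c i) powr \<gamma>) \<partial>S)
    (\<lambda>x. (\<integral>\<^sup>+i. k i * (ennreal ((1 - \<phi> (\<alpha> - \<gamma>)) * x powr \<gamma>) * indicator {x..} (c i)) \<partial>S))"
  proof (rule pot_nn_integral[OF assms(1)])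
    fix i assume "i \<in> space S"
    then have "c i \<ge> 0" using assms by auto
    from pot_cmult[OF pot_min_powr[OF g this], of "k i"]
    show "pot (\<lambda>x. k i * ennreal (min x (c i) powr \<gamma>)) (\<lambda>x. k i * (ennreal ((1 - \<phi> (\<alpha> - \<gamma>)) * x powr \<gamma>) * indicator {x..} (c i)))"
      by (simp add: indicator_def)
  qed measurable
  then show ?thesis
  proof (rule pot_le)
    fix x :: real
    have "ennreal (1 - \<phi> (\<alpha> - \<gamma>)) * (\<integral>\<^sup>+ i. k i * (ennreal (x powr \<gamma>) * indicator {x..} (c i)) \<partial>S)
      = (\<integral>\<^sup>+ i. ennreal (1 - \<phi> (\<alpha> - \<gamma>)) * (k i * (ennreal (x powr \<gamma>) * indicator {x..} (c i))) \<partial>S)"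
      by (rule nn_integral_cmult[symmetric]) measurable
    also have "\<dots> = (\<integral>\<^sup>+i. k i * (ennreal ((1 - \<phi> (\<alpha> - \<gamma>)) * x powr \<gamma>) * indicator {x..} (c i)) \<partial>S)"
      using f by (intro nn_integral_cong) (auto simp: ennreal_mult ac_simps)
    finally show "ennreal (1 - \<phi> (\<alpha> - \<gamma>)) * (\<integral>\<^sup>+ i. k i * (ennreal (x powr \<gamma>) * indicator {x..} (c i)) \<partial>S)
     \<le> (\<integral>\<^sup>+i. k i * (ennreal ((1 - \<phi> (\<alpha> - \<gamma>)) * x powr \<gamma>) * indicator {x..} (c i)) \<partial>S)" by simp
  qed
qed

end

section \<open>Slowly varying tails\<close>

locale slowly_varying_tail = prob_space M for M :: "'a measure" +
  fixes Y :: "'a \<Rightarrow> real" and \<alpha> :: real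
  assumes alpha_pos: "\<alpha> > 0"
    and Y_meas [measurable]: "Y \<in> borel_measurable M"
    and sv: "slowly_varying (right_tail M \<alpha> Y)"
    and moment_inf: "(\<integral>\<^sup>+\<omega>. ennreal (max (Y \<omega>) 0 powr \<alpha>) \<partial>M) = \<infinity>"
begin

abbreviation "L \<equiv> right_tail M \<alpha> Y"
abbreviation "w \<equiv> log_integral L"
definition G :: "real \<Rightarrow> real" where "G t = prob {\<omega> \<in> space M. Y \<omega> > t}"

lemma L_eq: "L x = x powr \<alpha> * G x" by (simp add: right_tail_def G_def)
lemma L_pos: "x > 0 \<Longrightarrow> L x > 0" using sv by (simp add: slowly_varying_def)
lemma L_lim: "c > 0 \<Longrightarrow> ((\<lambda>x. L (c * x) / L x) \<longlongrightarrow> 1) at_top" using sv by (simp add: slowly_varying_def)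
lemma G_nonneg: "G x \<ge> 0" by (simp add: G_def)
lemma G_le_1: "G x \<le> 1" by (simp add: G_def)
lemma G_antimono: "x \<le> y \<Longrightarrow> G y \<le> G x"
  unfolding G_def by (intro finite_measure_mono) auto
lemma G_meas [measurable]: "G \<in> borel_measurable borel"
proof -
  have "(\<lambda>x. - G x) \<in> borel_measurable borel" by (intro borel_measurable_mono monoI) (simp add: G_antimono)
  then show ?thesis by simp
qed
lemma L_meas [measurable]: "L \<in> borel_measurable borel"
  unfolding L_eq[abs_def] by measurable

text \<open>Layer cake for \<open>Y\<close> truncated at \<open>x\<close>: for
  \<open>0 < t < x\<close> the truncated variable exceeds \<open>t\<close> exactly if
  \<open>Y\<close> does. Reading \<open>\<alpha> * w x\<close> as a truncated moment of order
  \<alpha> gives finiteness, monotonicity and the size of increments without any analysis of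
  \<open>L\<close>.\<close>

lemma nn_w_aux: "(\<integral>\<^sup>+t. ennreal (indicator {0<..x} t *\<^sub>R (L t / t)) \<partial>lborel)
  = (\<integral>\<^sup>+\<omega>. ennreal (max 0 (min (Y \<omega>) x) powr \<alpha>) \<partial>M) / ennreal \<alpha>"
proof -
  have "(\<integral>\<^sup>+\<omega>. ennreal (max 0 (min (Y \<omega>) x) powr \<alpha>) \<partial>M)
    = (\<integral>\<^sup>+t. ennreal (\<alpha> * t powr (\<alpha> - 1) * prob {\<omega> \<in> space M. max 0 (min (Y \<omega>) x) > t}) * indicator {0<..} t \<partial>lborel)"
    using alpha_pos by (intro layer_cake) auto
  also have "\<dots> = (\<integral>\<^sup>+t. ennreal \<alpha> * ennreal (indicator {0<..x} t *\<^sub>R (L t / t)) \<partial>lborel)"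
  proof (intro nn_integral_cong_AE, use AE_lborel_singleton[of x] in eventually_elim)
    fix t :: real assume "t \<noteq> x"
    moreover have "prob {\<omega> \<in> space M. max 0 (min (Y \<omega>) x) > t} = (if t < x then G t else 0)" if "t > 0"
    proof -
      have "{\<omega> \<in> space M. max 0 (min (Y \<omega>) x) > t} = (if t < x then {\<omega> \<in> space M. Y \<omega> > t} else {})"
        using that by auto
      then show ?thesis by (simp add: G_def)
    qed
    ultimately show "ennreal (\<alpha> * t powr (\<alpha> - 1) * prob {\<omega> \<in> space M. max 0 (min (Y \<omega>) x) > t}) * indicator {0<..} t
      = ennreal \<alpha> * ennreal (indicator {0<..x} t *\<^sub>R (L t / t))"
      using alpha_pos G_nonneg[of t] by (auto simp: indicator_def ennreal_mult[symmetric] L_eq powr_diff)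
  qed
  also have "\<dots> = ennreal \<alpha> * (\<integral>\<^sup>+t. ennreal (indicator {0<..x} t *\<^sub>R (L t / t)) \<partial>lborel)"
    by (rule nn_integral_cmult) measurable
  finally have "(\<integral>\<^sup>+\<omega>. ennreal (max 0 (min (Y \<omega>) x) powr \<alpha>) \<partial>M) = (\<integral>\<^sup>+t. ennreal (indicator {0<..x} t *\<^sub>R (L t / t)) \<partial>lborel) * ennreal \<alpha>"
    by (simp only: mult.commute)
  then show ?thesis using alpha_pos by (simp only: ennreal_mult_divide_eq) (simp add: ennreal_mult_divide_eq)
qed

lemma min_powr_int [simp]: "integrable M (\<lambda>\<omega>. max 0 (min (Y \<omega>) x) powr \<alpha>)"
  by (rule integrable_const_bound[of _ "\<bar>x\<bar> powr \<alpha>"]) (use alpha_pos in \<open>auto intro!: powr_mono2\<close>)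

lemma w_eq: "w x = (\<integral>\<omega>. max 0 (min (Y \<omega>) x) powr \<alpha> \<partial>M) / \<alpha>"
proof -
  have "w x = enn2real (\<integral>\<^sup>+t. ennreal (indicator {0<..x} t *\<^sub>R (L t / t)) \<partial>lborel)"
    unfolding log_integral_def set_lebesgue_integral_def
    by (rule integral_eq_nn_integral) (auto simp: indicator_def L_eq G_nonneg)
  also have "\<dots> = enn2real (ennreal (\<integral>\<omega>. max 0 (min (Y \<omega>) x) powr \<alpha> \<partial>M) / ennreal \<alpha>)"
    unfolding nn_w_aux by (subst nn_integral_eq_integral) auto
  finally show ?thesis using alpha_pos by (simp add: divide_ennreal)
qed

text \<open>The truncated powers at levels \<open>x\<close> and \<open>y\<close> differ by the full
  amount \<open>y powr \<alpha> - x powr \<alpha>\<close> where \<open>Y > y\<close>, by at most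
  this amount where \<open>Y > x\<close>, and not at all elsewhere.\<close>

lemma w_diff_bounds:
  assumes "0 < x" "x \<le> y"
  shows "(y powr \<alpha> - x powr \<alpha>) * G y / \<alpha> \<le> w y - w x" "w y - w x \<le> (y powr \<alpha> - x powr \<alpha>) * G x / \<alpha>"
proof -
  have eq: "w y - w x = (\<integral>\<omega>. max 0 (min (Y \<omega>) y) powr \<alpha> - max 0 (min (Y \<omega>) x) powr \<alpha> \<partial>M) / \<alpha>"
    by (simp add: w_eq diff_divide_distrib)
  have [simp]: "integrable M (indicat_real {\<omega> \<in> space M. t < Y \<omega>})" for t
    by (rule integrable_real_indicator) (auto simp: emeasure_eq_measure)
  have le: "x powr \<alpha> \<le> y powr \<alpha>" using assms alpha_pos by (intro powr_mono2) auto
  have "(\<integral>\<omega>. (y powr \<alpha> - x powr \<alpha>) * indicator {\<omega> \<in> space M. Y \<omega> > y} \<omega> \<partial>M)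
     \<le> (\<integral>\<omega>. max 0 (min (Y \<omega>) y) powr \<alpha> - max 0 (min (Y \<omega>) x) powr \<alpha> \<partial>M)"
  proof (rule integral_mono)
    fix \<omega>
    show "(y powr \<alpha> - x powr \<alpha>) * indicator {\<omega> \<in> space M. Y \<omega> > y} \<omega>
      \<le> max 0 (min (Y \<omega>) y) powr \<alpha> - max 0 (min (Y \<omega>) x) powr \<alpha>"
      using assms alpha_pos by (auto simp: indicator_def intro!: powr_mono2)
  qed auto
  then show "(y powr \<alpha> - x powr \<alpha>) * G y / \<alpha> \<le> w y - w x"
    using alpha_pos by (simp add: eq G_def divide_right_mono)
  have "(\<integral>\<omega>. max 0 (min (Y \<omega>) y) powr \<alpha> - max 0 (min (Y \<omega>) x) powr \<alpha> \<partial>M)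
     \<le> (\<integral>\<omega>. (y powr \<alpha> - x powr \<alpha>) * indicator {\<omega> \<in> space M. Y \<omega> > x} \<omega> \<partial>M)"
  proof (rule integral_mono)
    fix \<omega> assume "\<omega> \<in> space M"
    moreover have "min (Y \<omega>) y powr \<alpha> \<le> y powr \<alpha>" if "Y \<omega> > x"
      using that assms alpha_pos by (intro powr_mono2) auto
    ultimately show "max 0 (min (Y \<omega>) y) powr \<alpha> - max 0 (min (Y \<omega>) x) powr \<alpha>
      \<le> (y powr \<alpha> - x powr \<alpha>) * indicator {\<omega> \<in> space M. Y \<omega> > x} \<omega>"
      using assms by (auto simp: indicator_def min_def max_def)
  qed auto
  then show "w y - w x \<le> (y powr \<alpha> - x powr \<alpha>) * G x / \<alpha>"
    using alpha_pos by (simp add: eq G_def divide_right_mono)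
qed

lemma w_mono: "x \<le> y \<Longrightarrow> w x \<le> w y"
  unfolding w_eq using alpha_pos by (intro divide_right_mono integral_mono) (auto intro!: powr_mono2)

lemma w_meas [measurable]: "w \<in> borel_measurable borel"
  by (intro borel_measurable_mono monoI w_mono)

lemma w_nonneg: "w x \<ge> 0"
  unfolding w_eq using alpha_pos by auto

lemma w_pos: "x > 0 \<Longrightarrow> w x > 0"
proof -
  assume x: "x > 0"
  have "0 < (x powr \<alpha> - (x/2) powr \<alpha>) * G x / \<alpha>"
    using L_pos[OF x] alpha_pos x
    by (auto simp: L_eq zero_less_mult_iff intro!: divide_pos_pos mult_pos_pos powr_less_mono2)
  also have "\<dots> \<le> w x - w (x/2)" using x by (intro w_diff_bounds) auto
  finally show ?thesis using w_nonneg[of "x/2"] by simp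
qed

lemma w_le_powr: "x > 0 \<Longrightarrow> w x \<le> x powr \<alpha> / \<alpha>"
proof -
  assume x: "x > 0"
  have "(\<integral>\<omega>. max 0 (min (Y \<omega>) x) powr \<alpha> \<partial>M) \<le> (\<integral>\<omega>. x powr \<alpha> \<partial>M)"
    by (rule integral_mono) (use alpha_pos x in \<open>auto intro!: powr_mono2\<close>)
  then show ?thesis using alpha_pos by (simp add: w_eq prob_space divide_right_mono)
qed

lemma w_unbounded: "\<exists>n::nat. w (real n) > K"
proof (rule ccontr)
  assume "\<not> ?thesis"
  then have le: "w (real n) \<le> K" for n by (simp add: not_less)
  have "(\<integral>\<^sup>+\<omega>. ennreal (max (Y \<omega>) 0 powr \<alpha>) \<partial>M) = (\<integral>\<^sup>+\<omega>. (SUP n. ennreal (max 0 (min (Y \<omega>) (real n)) powr \<alpha>)) \<partial>M)"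
  proof (rule nn_integral_cong)
    fix \<omega>
    obtain n where n: "Y \<omega> \<le> real n" using real_arch_simple by blast
    show "ennreal (max (Y \<omega>) 0 powr \<alpha>) = (SUP n. ennreal (max 0 (min (Y \<omega>) (real n)) powr \<alpha>))"
    proof (rule antisym)
      show "ennreal (max (Y \<omega>) 0 powr \<alpha>) \<le> (SUP n. ennreal (max 0 (min (Y \<omega>) (real n)) powr \<alpha>))"
        using n by (intro SUP_upper2[of n]) (auto simp: min_def max_def)
      show "(SUP n. ennreal (max 0 (min (Y \<omega>) (real n)) powr \<alpha>)) \<le> ennreal (max (Y \<omega>) 0 powr \<alpha>)"
        using alpha_pos by (intro SUP_least ennreal_leI powr_mono2) auto
    qed
  qed
  also have "\<dots> = (SUP n. \<integral>\<^sup>+\<omega>. ennreal (max 0 (min (Y \<omega>) (real n)) powr \<alpha>) \<partial>M)"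
    using alpha_pos by (intro nn_integral_monotone_convergence_SUP)
      (auto simp: incseq_def le_fun_def intro!: ennreal_leI powr_mono2)
  also have "\<dots> \<le> ennreal (\<alpha> * K)"
  proof (rule SUP_least)
    fix n :: nat
    have "(\<integral>\<^sup>+\<omega>. ennreal (max 0 (min (Y \<omega>) (real n)) powr \<alpha>) \<partial>M) = ennreal (\<alpha> * w (real n))"
      using alpha_pos by (subst nn_integral_eq_integral) (auto simp: w_eq)
    also have "\<dots> \<le> ennreal (\<alpha> * K)" using le[of n] alpha_pos by (intro ennreal_leI mult_left_mono) auto
    finally show "(\<integral>\<^sup>+\<omega>. ennreal (max 0 (min (Y \<omega>) (real n)) powr \<alpha>) \<partial>M) \<le> ennreal (\<alpha> * K)" .
  qed
  finally show False using moment_inf by (simp add: top_unique)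
qed

lemma w_at_top: "filterlim w at_top at_top"
  unfolding filterlim_at_top
proof
  fix K
  obtain n where "w (real n) > K" using w_unbounded by blast
  then have "K \<le> w x" if "x \<ge> real n" for x using w_mono[OF that] by simp
  then show "\<forall>\<^sub>F x in at_top. K \<le> w x" using eventually_at_top_linorder by blast
qed

section \<open>Slow variation of the logarithmic integral and Potter bounds\<close>

lemma L_growth: "0 < x \<Longrightarrow> x \<le> t \<Longrightarrow> w t - w x \<le> L x * ((t / x) powr \<alpha> - 1) / \<alpha>"
proof -
  assume x: "0 < x" "x \<le> t"
  then have "L x * ((t / x) powr \<alpha> - 1) = (t powr \<alpha> - x powr \<alpha>) * G x"
    by (simp add: L_eq powr_divide field_simps)
  then show ?thesis using w_diff_bounds(2)[OF x] by simp
qed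

lemma w_step:
  assumes "x > 0" "b > 1"
  shows "L (b * x) * (1 - b powr (- \<alpha>)) / \<alpha> \<le> w (b * x) - w x" "w (b * x) - w x \<le> L x * (b powr \<alpha> - 1) / \<alpha>"
proof -
  have "x * 1 \<le> x * b" by (rule mult_left_mono) (use assms in auto)
  then have le: "x \<le> b * x" by (simp add: mult.commute)
  show "L (b * x) * (1 - b powr (- \<alpha>)) / \<alpha> \<le> w (b * x) - w x"
  proof -
    have "L (b * x) * (1 - b powr (- \<alpha>)) = ((b * x) powr \<alpha> - x powr \<alpha>) * G (b * x)"
      using assms by (simp add: L_eq powr_mult powr_minus field_simps)
    then show ?thesis using w_diff_bounds(1)[OF assms(1) le] by simp
  qed
  show "w (b * x) - w x \<le> L x * (b powr \<alpha> - 1) / \<alpha>"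
    using L_growth[OF assms(1) le] assms by simp
qed

text \<open>The interval from \<open>x\<close> to \<open>a * x\<close> is cut into \<open>m\<close>
  geometric steps of ratio \<open>b = a powr (1 / m)\<close>. On each of them the monotone tail
  gives two-sided bounds by \<open>L\<close> at an end point, and slow variation is needed only at
  these finitely many points, so no uniform convergence theorem enters.\<close>

lemma w_incr_bounds:
  assumes "a > 1" "m > 0" "\<epsilon> > 0"
  shows "\<forall>\<^sub>F x in at_top. real m * (1 - a powr (- \<alpha> / real m)) / \<alpha> - \<epsilon> \<le> (w (a * x) - w x) / L x"
    and "\<forall>\<^sub>F x in at_top. (w (a * x) - w x) / L x \<le> real m * (a powr (\<alpha> / real m) - 1) / \<alpha> + \<epsilon>"
proof -
  define b where "b = a powr (1 / real m)"
  have b: "b > 1" using assms by (simp add: b_def)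
  have bm: "b ^ m = a" using assms by (simp add: b_def powr_realpow[symmetric] powr_powr)
  have b1: "b powr (- \<alpha>) = a powr (- \<alpha> / real m)" "b powr \<alpha> = a powr (\<alpha> / real m)"
    by (simp_all add: b_def powr_powr)
  have tel: "w (a * x) - w x = (\<Sum>i<m. w (b * (b ^ i * x)) - w (b ^ i * x))" for x
    using sum_lessThan_telescope[of "\<lambda>i. w (b ^ i * x)" m] bm by (simp add: mult.assoc)
  have lim: "((\<lambda>x. \<Sum>i<m. L (b ^ (i + k) * x) / L x * c) \<longlongrightarrow> (\<Sum>i<m. 1 * c)) at_top" for k c
    using b by (intro tendsto_sum tendsto_mult tendsto_const L_lim) auto
  define c1 where "c1 = (1 - b powr (- \<alpha>)) / \<alpha>"
  have "\<forall>\<^sub>F x in at_top. (\<Sum>i<m. L (b ^ (i + 1) * x) / L x * c1) > real m * c1 - \<epsilon>"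
    using order_tendstoD(1)[OF lim[of 1 c1], of "real m * c1 - \<epsilon>"] assms by simp
  then show "\<forall>\<^sub>F x in at_top. real m * (1 - a powr (- \<alpha> / real m)) / \<alpha> - \<epsilon> \<le> (w (a * x) - w x) / L x"
    using eventually_gt_at_top[of 0]
  proof eventually_elim
    case (elim x)
    have "(\<Sum>i<m. L (b ^ (i + 1) * x) / L x * c1) \<le> (\<Sum>i<m. (w (b * (b ^ i * x)) - w (b ^ i * x)) / L x)"
    proof (rule sum_mono)
      fix i
      have "L (b * (b ^ i * x)) * c1 \<le> w (b * (b ^ i * x)) - w (b ^ i * x)"
        using w_step(1)[of "b ^ i * x" b] elim b by (simp add: c1_def)
      from divide_right_mono[OF this, of "L x"] L_pos[of x] elim
      show "L (b ^ (i + 1) * x) / L x * c1 \<le> (w (b * (b ^ i * x)) - w (b ^ i * x)) / L x"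
        by (simp add: mult.assoc)
    qed
    then show ?case using elim unfolding tel by (simp add: c1_def b1 sum_divide_distrib)
  qed
  define c2 where "c2 = (b powr \<alpha> - 1) / \<alpha>"
  have "\<forall>\<^sub>F x in at_top. (\<Sum>i<m. L (b ^ (i + 0) * x) / L x * c2) < real m * c2 + \<epsilon>"
    using order_tendstoD(2)[OF lim[of 0 c2], of "real m * c2 + \<epsilon>"] assms by simp
  then show "\<forall>\<^sub>F x in at_top. (w (a * x) - w x) / L x \<le> real m * (a powr (\<alpha> / real m) - 1) / \<alpha> + \<epsilon>"
    using eventually_gt_at_top[of 0]
  proof eventually_elim
    case (elim x)
    have "(\<Sum>i<m. (w (b * (b ^ i * x)) - w (b ^ i * x)) / L x) \<le> (\<Sum>i<m. L (b ^ (i + 0) * x) / L x * c2)"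
    proof (rule sum_mono)
      fix i
      have "w (b * (b ^ i * x)) - w (b ^ i * x) \<le> L (b ^ i * x) * c2"
        using w_step(2)[of "b ^ i * x" b] elim b by (simp add: c2_def)
      from divide_right_mono[OF this, of "L x"] L_pos[of x] elim
      show "(w (b * (b ^ i * x)) - w (b ^ i * x)) / L x \<le> L (b ^ (i + 0) * x) / L x * c2"
        by simp
    qed
    then show ?case using elim unfolding tel by (simp add: c2_def b1 sum_divide_distrib)
  qed
qed

text \<open>Refining the geometric partition, both bounds of \<open>w_incr_bounds\<close> tend to
  \<open>ln a\<close> as \<open>m\<close> grows.\<close>

lemma w_incr_lim_gt1:
  assumes "a > 1"
  shows "((\<lambda>x. (w (a * x) - w x) / L x) \<longlongrightarrow> ln a) at_top"
proof (rule order_tendstoI)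
  have l1: "(\<lambda>m. real m * (1 - a powr (- \<alpha> / real m)) / \<alpha>) \<longlonglongrightarrow> ln a"
    using assms alpha_pos by real_asymp
  fix y assume y: "y < ln a"
  define z where "z = (y + ln a) / 2"
  have z: "y < z" "z < ln a" using y by (auto simp: z_def)
  have "\<forall>\<^sub>F m in sequentially. m > 0 \<and> real m * (1 - a powr (- \<alpha> / real m)) / \<alpha> > z"
    using order_tendstoD(1)[OF l1 z(2)] by (intro eventually_conj eventually_gt_at_top)
  then obtain m where m: "m > 0" "real m * (1 - a powr (- \<alpha> / real m)) / \<alpha> > z"
    using eventually_happens'[OF sequentially_bot] by blast
  show "\<forall>\<^sub>F x in at_top. y < (w (a * x) - w x) / L x"
    using w_incr_bounds(1)[OF assms m(1), of "z - y"] z m(2) by (auto elim!: eventually_mono)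
next
  have l2: "(\<lambda>m. real m * (a powr (\<alpha> / real m) - 1) / \<alpha>) \<longlonglongrightarrow> ln a"
    using assms alpha_pos by real_asymp
  fix y assume y: "y > ln a"
  define z where "z = (y + ln a) / 2"
  have z: "y > z" "z > ln a" using y by (auto simp: z_def)
  have "\<forall>\<^sub>F m in sequentially. m > 0 \<and> real m * (a powr (\<alpha> / real m) - 1) / \<alpha> < z"
    using order_tendstoD(2)[OF l2 z(2)] by (intro eventually_conj eventually_gt_at_top)
  then obtain m where m: "m > 0" "real m * (a powr (\<alpha> / real m) - 1) / \<alpha> < z"
    using eventually_happens'[OF sequentially_bot] by blast
  show "\<forall>\<^sub>F x in at_top. y > (w (a * x) - w x) / L x"
    using w_incr_bounds(2)[OF assms m(1), of "y - z"] z m(2) by (auto elim!: eventually_mono)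
qed

text \<open>This says that \<open>w\<close> belongs to the de Haan class with auxiliary function
  \<open>L\<close>. Ratios \<open>a > 1\<close> are reduced to upward increments started at
  \<open>x / a\<close>, with slow variation exchanging \<open>L (x / a)\<close> for
  \<open>L x\<close>.\<close>

lemma w_decr_lim:
  assumes "a > 0"
  shows "((\<lambda>x. (w x - w (x / a)) / L x) \<longlongrightarrow> ln a) at_top"
proof -
  consider "a = 1" | "a < 1" | "a > 1" by linarith
  then show ?thesis
  proof cases
    case 2
    then have "((\<lambda>x. - ((w ((1 / a) * x) - w x) / L x)) \<longlongrightarrow> - ln (1 / a)) at_top"
      using assms by (intro tendsto_minus w_incr_lim_gt1) auto
    then show ?thesis using assms by (simp add: ln_div minus_divide_left)
  next
    case 3
    have lim: "filterlim (\<lambda>x. x / a) at_top at_top" using assms by real_asymp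
    have "((\<lambda>x. (w (a * (x / a)) - w (x / a)) / L (x / a) * (L ((1 / a) * x) / L x)) \<longlongrightarrow> ln a * 1) at_top"
      using filterlim_compose[OF w_incr_lim_gt1[OF 3] lim] assms by (intro tendsto_mult L_lim) auto
    then show ?thesis
      unfolding mult_1_right
    proof (rule Lim_transform_eventually)
      show "\<forall>\<^sub>F x in at_top. (w (a * (x / a)) - w (x / a)) / L (x / a) * (L ((1 / a) * x) / L x) = (w x - w (x / a)) / L x"
        using eventually_gt_at_top[of 0]
      proof eventually_elim
        case (elim x)
        then have "L (x / a) > 0" using assms by (intro L_pos) auto
        then show ?case using assms by simp
      qed
    qed
  qed simp
qed

text \<open>The window from \<open>x / a\<close> to \<open>x\<close> alone contributes about
  \<open>L x * ln a\<close> to \<open>w x\<close>, and \<open>ln a\<close> can be made arbitrarily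
  large.\<close>

lemma L_div_w: "((\<lambda>x. L x / w x) \<longlongrightarrow> 0) at_top"
proof (rule order_tendstoI)
  fix y :: real assume y: "y < 0"
  show "\<forall>\<^sub>F x in at_top. y < L x / w x"
    using eventually_gt_at_top[of 0]
  proof eventually_elim
    case (elim x)
    then have "L x / w x > 0" by (simp add: L_pos w_pos)
    with y show ?case by linarith
  qed
next
  fix y :: real assume y: "y > 0"
  \<comment> \<open>Then \<open>ln a = 2 / y\<close> lies strictly above the required
    \<open>1 / y\<close>, which leaves room for passing from the limit to large finite
    \<open>x\<close>.\<close>
  define a where "a = exp (2 / y)"
  have "\<forall>\<^sub>F x in at_top. (w x - w (x / a)) / L x > 1 / y"
    using y by (intro order_tendstoD(1)[OF w_decr_lim]) (auto simp: a_def field_simps)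
  then show "\<forall>\<^sub>F x in at_top. y > L x / w x" using eventually_gt_at_top[of 0]
  proof eventually_elim
    case (elim x)
    then have "L x < y * (w x - w (x / a))" using y L_pos[of x] by (simp add: field_simps)
    also have "\<dots> \<le> y * w x" using y w_nonneg by simp
    finally show ?case using w_pos[of x] elim by (simp add: field_simps)
  qed
qed

lemma w_slow:
  assumes "a > 0" shows "((\<lambda>x. w (a * x) / w x) \<longlongrightarrow> 1) at_top"
proof -
  have "((\<lambda>x. 1 - (w x - w (x / (1 / a))) / L x * (L x / w x)) \<longlongrightarrow> 1 - ln (1 / a) * 0) at_top"
    using assms by (intro tendsto_intros w_decr_lim L_div_w) auto
  then have "((\<lambda>x. 1 - (w x - w (a * x)) / L x * (L x / w x)) \<longlongrightarrow> 1) at_top"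
    by (simp add: mult.commute)
  then show ?thesis
  proof (rule Lim_transform_eventually)
    show "\<forall>\<^sub>F x in at_top. 1 - (w x - w (a * x)) / L x * (L x / w x) = w (a * x) / w x"
      using eventually_gt_at_top[of 0]
    proof eventually_elim
      case (elim x)
      then show ?case using L_pos[of x] w_pos[of x] by (simp add: field_simps)
    qed
  qed
qed

text \<open>Slow variation gives growth by at most \<open>exp \<beta>\<close> per factor
  \<open>exp 1\<close> beyond some \<open>x1\<close>; iterating and rounding \<open>ln v\<close> up
  to an integer gives the power of \<open>v\<close>. Between 1 and \<open>x1\<close> the function
  \<open>w\<close> is comparable to a positive constant.\<close>

lemma w_potter:
  assumes \<beta>: "\<beta> > 0"
  shows "\<exists>C>0. \<forall>x\<ge>1. \<forall>v\<ge>1. w (v * x) \<le> C * v powr \<beta> * w x"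
proof -
  have "\<forall>\<^sub>F x in at_top. w (exp 1 * x) / w x < exp \<beta>"
    using order_tendstoD(2)[OF w_slow[of "exp 1"]] \<beta> by simp
  then obtain x0 where x0: "\<And>x. x \<ge> x0 \<Longrightarrow> w (exp 1 * x) / w x < exp \<beta>"
    by (auto simp: eventually_at_top_linorder)
  define x1 where "x1 = max 1 x0"
  have x1: "x1 \<ge> 1" "x1 > 0" by (auto simp: x1_def)
  have step: "w (exp 1 * x) \<le> exp \<beta> * w x" if "x \<ge> x1" for x
    using x0[of x] that w_pos[of x] by (auto simp: x1_def field_simps)
  have it: "w (exp 1 ^ n * x) \<le> exp \<beta> ^ n * w x" if "x \<ge> x1" for x n
  proof (induction n)
    case (Suc n)
    have "1 * x \<le> exp 1 ^ n * x" using that x1 by (intro mult_right_mono one_le_power) auto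
    then have "w (exp 1 * (exp 1 ^ n * x)) \<le> exp \<beta> * w (exp 1 ^ n * x)" using that by (intro step) auto
    also have "\<dots> \<le> exp \<beta> * (exp \<beta> ^ n * w x)" by (intro mult_left_mono Suc) auto
    finally show ?case by (simp add: mult_ac)
  qed simp
  have big: "w (v * x) \<le> exp \<beta> * v powr \<beta> * w x" if "x \<ge> x1" "v \<ge> 1" for x v
  proof -
    define n where "n = nat \<lceil>ln v\<rceil>"
    have n: "ln v \<le> real n" "real n \<le> ln v + 1" using that by (auto simp: n_def)
    have "v = exp (ln v)" using that by simp
    also have "\<dots> \<le> exp (real n)" using n by simp
    finally have "v \<le> exp 1 ^ n" by (simp add: exp_of_nat_mult[symmetric])
    then have "w (v * x) \<le> w (exp 1 ^ n * x)" using that x1 by (intro w_mono mult_right_mono) auto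
    also have "\<dots> \<le> exp \<beta> ^ n * w x" using that by (intro it)
    also have "exp \<beta> ^ n = exp (real n * \<beta>)" by (simp add: exp_of_nat_mult)
    also have "\<dots> * w x \<le> exp ((ln v + 1) * \<beta>) * w x"
      using n \<beta> w_nonneg by (intro mult_right_mono) auto
    also have "exp ((ln v + 1) * \<beta>) = exp \<beta> * v powr \<beta>"
      using that by (simp add: powr_def exp_add[symmetric] algebra_simps)
    finally show ?thesis .
  qed
  \<comment> \<open>The factor \<open>exp \<beta>\<close> is the cost of rounding;
    \<open>w x1 / w 1\<close> is the largest ratio lost when a starting point between 1 and
    \<open>x1\<close> is moved to \<open>x1\<close>.\<close>
  define C where "C = exp \<beta> * (w x1 / w 1)"
  have w1: "w 1 > 0" "w x1 \<ge> w 1" using x1 by (auto intro: w_pos w_mono)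
  have "exp \<beta> * 1 \<le> C" unfolding C_def using w1 by (intro mult_left_mono) auto
  then have C: "exp \<beta> \<le> C" "C > 0" by (auto intro: order.strict_trans2[OF exp_gt_zero])
  have "w (v * x) \<le> C * v powr \<beta> * w x" if "x \<ge> 1" "v \<ge> 1" for x v
  proof (cases "x \<ge> x1")
    case True
    have "exp \<beta> * v powr \<beta> * w x \<le> C * v powr \<beta> * w x"
      using C w_nonneg by (intro mult_right_mono) auto
    with big[OF True that(2)] show ?thesis by simp
  next
    case False
    have "w (v * x) \<le> w (v * x1)" using False that by (intro w_mono mult_left_mono) auto
    also have "\<dots> \<le> exp \<beta> * v powr \<beta> * w x1" using that by (intro big) auto
    also have "w x1 \<le> (w x1 / w 1) * w x"
      using w1 w_mono[of 1 x] that by (simp add: field_simps mult_left_mono)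
    finally have "w (v * x) \<le> exp \<beta> * v powr \<beta> * ((w x1 / w 1) * w x)" by (simp add: mult_left_mono)
    then show ?thesis by (simp add: C_def mult_ac)
  qed
  with C show ?thesis by blast
qed

lemma w_le_powr_beta:
  assumes "0 < \<beta>" "\<beta> \<le> \<alpha>" shows "\<exists>C>0. \<forall>x>0. w x \<le> C * x powr \<beta>"
proof -
  obtain C where C: "C > 0" "\<And>x v. x \<ge> 1 \<Longrightarrow> v \<ge> 1 \<Longrightarrow> w (v * x) \<le> C * v powr \<beta> * w x"
    using w_potter[OF assms(1)] by blast
  have "w x \<le> (C * w 1 + 1 / \<alpha>) * x powr \<beta>" if "x > 0" for x
  proof (cases "x \<ge> 1")
    case True
    then show ?thesis using C(2)[of 1 x] alpha_pos by (simp add: algebra_simps add_increasing)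
  next
    case False
    have "w x \<le> x powr \<alpha> / \<alpha>" using w_le_powr that .
    also have "\<dots> \<le> x powr \<beta> / \<alpha>" using False that assms alpha_pos
      by (intro divide_right_mono powr_mono') auto
    finally show ?thesis using C w_nonneg[of 1] that by (simp add: algebra_simps add_increasing2)
  qed
  moreover have "C * w 1 + 1 / \<alpha> > 0" using C alpha_pos w_nonneg[of 1] by (simp add: add_nonneg_pos)
  ultimately show ?thesis by blast
qed

text \<open>Since the tail decreases, \<open>w\<close> grows from \<open>x / 2\<close> to
  \<open>x\<close> by at least a fixed multiple of \<open>L x\<close>, so the bound on
  \<open>w\<close> passes to \<open>L\<close>.\<close>

lemma L_le_powr_beta:
  assumes "0 < \<beta>" "\<beta> \<le> \<alpha>" shows "\<exists>C>0. \<forall>x>0. L x \<le> C * x powr \<beta>"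
proof -
  obtain C where C: "C > 0" "\<And>x. x > 0 \<Longrightarrow> w x \<le> C * x powr \<beta>"
    using w_le_powr_beta[OF assms] by blast
  define d where "d = (1 - 2 powr (- \<alpha>)) / \<alpha>"
  have d: "d > 0" using alpha_pos powr_less_mono[of "- \<alpha>" 0 2] by (simp add: d_def)
  have "L x \<le> C / d * x powr \<beta>" if "x > 0" for x
  proof -
    have "L x * d \<le> w x" using w_step(1)[of "x / 2" 2] that w_nonneg[of "x / 2"] by (simp add: d_def)
    also have "\<dots> \<le> C * x powr \<beta>" using C that by blast
    finally show ?thesis using d by (simp add: field_simps)
  qed
  with C d show ?thesis by (intro exI[of _ "C / d"]) auto
qed

lemma Y_pos_moment:
  assumes "0 < s" "s < \<alpha>"
  shows "(\<integral>\<^sup>+\<omega>. ennreal (max 0 (Y \<omega>) powr s) \<partial>M) < \<infinity>"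
proof -
  \<comment> \<open>Half of the gap: \<open>L\<close> costs t^\<beta>, and the exponent of the
    integrand at infinity becomes -1 - (\<alpha> - s)/2, still below -1.\<close>
  define \<beta> where "\<beta> = (\<alpha> - s) / 2"
  have \<beta>: "\<beta> > 0" "\<beta> \<le> \<alpha>" "s - 1 - (\<alpha> - \<beta>) < - 1" using assms by (auto simp: \<beta>_def field_simps)
  obtain C where C: "C > 0" "\<And>x. x > 0 \<Longrightarrow> L x \<le> C * x powr \<beta>" using L_le_powr_beta[OF \<beta>(1,2)] by blast
  have i1: "(\<integral>\<^sup>+t. ennreal (indicator {0..1} t * t powr (s - 1)) \<partial>lborel) = ennreal (1 powr s / s)"
    using has_integral_powr_from_0[of "s - 1" 1] assms by (intro nn_integral_has_integral_lebesgue) auto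
  have i2: "(\<integral>\<^sup>+t. ennreal (indicator {1..} t * t powr (s - 1 - (\<alpha> - \<beta>))) \<partial>lborel) < \<infinity>"
    using has_integral_powr_to_inf[OF \<beta>(3), of 1]
    by (subst nn_integral_has_integral_lebesgue) auto
  have "(\<integral>\<^sup>+\<omega>. ennreal (max 0 (Y \<omega>) powr s) \<partial>M)
    = (\<integral>\<^sup>+t. ennreal (s * t powr (s - 1) * prob {\<omega> \<in> space M. max 0 (Y \<omega>) > t}) * indicator {0<..} t \<partial>lborel)"
    using assms by (intro layer_cake) auto
  also have "\<dots> \<le> (\<integral>\<^sup>+t. ennreal s * ennreal (indicator {0..1} t * t powr (s - 1))
       + ennreal (s * C) * ennreal (indicator {1..} t * t powr (s - 1 - (\<alpha> - \<beta>))) \<partial>lborel)"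
  proof (rule nn_integral_mono)
    fix t :: real
    have eq: "prob {\<omega> \<in> space M. max 0 (Y \<omega>) > t} = G t" if "t > 0"
      unfolding G_def using that by (intro arg_cong[where f = prob]) auto
    have "s * t powr (s - 1) * G t \<le> s * C * t powr (s - 1 - (\<alpha> - \<beta>))" if "t \<ge> 1"
    proof -
      have "G t \<le> C * t powr \<beta> / t powr \<alpha>" using C(2)[of t] that by (simp add: L_eq field_simps)
      also have "\<dots> = C * t powr (\<beta> - \<alpha>)" using that by (simp add: powr_diff)
      finally have "s * t powr (s - 1) * G t \<le> s * t powr (s - 1) * (C * t powr (\<beta> - \<alpha>))"
        using assms by (intro mult_left_mono) auto
      also have "\<dots> = s * C * t powr (s - 1 - (\<alpha> - \<beta>))" by (simp add: powr_add[symmetric] algebra_simps)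
      finally show ?thesis .
    qed
    moreover have "s * t powr (s - 1) * G t \<le> s * t powr (s - 1)"
      using assms G_le_1[of t] by (simp add: mult_left_le)
    ultimately show "ennreal (s * t powr (s - 1) * prob {\<omega> \<in> space M. max 0 (Y \<omega>) > t}) * indicator {0<..} t
     \<le> ennreal s * ennreal (indicator {0..1} t * t powr (s - 1))
       + ennreal (s * C) * ennreal (indicator {1..} t * t powr (s - 1 - (\<alpha> - \<beta>)))"
      using assms C(1) eq by (cases "t \<le> 1")
        (auto simp: indicator_def ennreal_mult[symmetric] intro!: ennreal_leI add_increasing2)
  qed
  also have "\<dots> < \<infinity>"
    using i1 i2 by (simp add: nn_integral_add nn_integral_cmult ennreal_mult_less_top)
  finally show ?thesis .
qed

end

section \<open>The logarithmic integral as an approximate potential of the tail\<close>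

locale perpetuity_tail = tilted_multiplier M A \<alpha> + slowly_varying_tail M Y \<alpha>
  for M :: "'a measure" and A Y :: "'a \<Rightarrow> real" and \<alpha> :: real +
  assumes neg_moment: "\<And>s. 0 < s \<Longrightarrow> s < \<alpha> \<Longrightarrow> integrable M (\<lambda>\<omega>. max (- Y \<omega>) 0 powr s)"
    and mixed_moment: "\<exists>\<eta>\<in>{0<..<\<alpha>} \<inter> {0<..1}. integrable M (\<lambda>\<omega>. A \<omega> powr \<eta> * max (Y \<omega>) 0 powr (\<alpha> - \<eta>))"
begin

text \<open>Growth exponent of the class in which solutions are compared. Only
  \<open>0 < \<beta> < \<alpha>\<close> matters: \<open>T\<close> then contracts x^\<beta>, and
  moments of order \<alpha> - \<beta> are available.\<close>

definition \<beta> :: real where "\<beta> = \<alpha> / 2"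

lemma beta: "0 < \<beta>" "\<beta> < \<alpha>" "\<beta> \<le> \<alpha>" "\<alpha> - \<beta> > 0" "\<alpha> - \<beta> < \<alpha>"
  using alpha_pos by (auto simp: \<beta>_def)

definition \<theta> :: real where "\<theta> = \<phi> (\<alpha> - \<beta>)"

lemma theta: "0 \<le> \<theta>" "\<theta> < 1"
  using phi_less_1[of "\<alpha> - \<beta>"] beta phi_nonneg by (auto simp: \<theta>_def)

definition Cw :: real where "Cw = (SOME C. C > 0 \<and> (\<forall>x>0. w x \<le> C * x powr \<beta>))"

lemma Cw: "Cw > 0" "\<And>x. x > 0 \<Longrightarrow> w x \<le> Cw * x powr \<beta>"
proof -
  have "\<exists>C. C > 0 \<and> (\<forall>x>0. w x \<le> C * x powr \<beta>)" using w_le_powr_beta[of \<beta>] beta by blast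
  from someI_ex[OF this] show "Cw > 0" "\<And>x. x > 0 \<Longrightarrow> w x \<le> Cw * x powr \<beta>" by (auto simp: Cw_def)
qed

lemma T_powr_beta: "x > 0 \<Longrightarrow> T (\<lambda>x. ennreal (C * x powr \<beta>)) x = ennreal (C * \<theta> * x powr \<beta>)" if "C \<ge> 0"
proof -
  assume x: "x > 0"
  have "T (\<lambda>x. ennreal (C * x powr \<beta>)) x = T (\<lambda>x. ennreal C * ennreal (x powr \<beta>)) x"
    using that by (simp add: ennreal_mult)
  also have "\<dots> = ennreal C * ennreal (\<theta> * x powr \<beta>)"
    using beta x by (subst T_cmult) (auto simp: T_powr \<theta>_def)
  finally show ?thesis using that theta by (simp add: ennreal_mult mult.assoc)
qed

lemma T_w_le: "x > 0 \<Longrightarrow> T (\<lambda>x. ennreal (w x)) x \<le> ennreal (Cw * x powr \<beta>)"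
proof -
  assume x: "x > 0"
  have "T (\<lambda>x. ennreal (w x)) x \<le> T (\<lambda>x. ennreal (Cw * x powr \<beta>)) x"
    using Cw x by (intro T_mono ennreal_leI) auto
  also have "\<dots> = ennreal (Cw * \<theta> * x powr \<beta>)" using Cw(1) x by (intro T_powr_beta) auto
  also have "\<dots> \<le> ennreal (Cw * x powr \<beta>)" using theta Cw(1) by (intro ennreal_leI mult_right_mono) auto
  finally show ?thesis .
qed

lemma A_w_nonneg: "A \<omega> powr \<alpha> * w (x / A \<omega>) \<ge> 0" using w_nonneg by simp

lemma T_w:
  assumes "x > 0"
  shows "integrable M (\<lambda>\<omega>. A \<omega> powr \<alpha> * w (x / A \<omega>))"
    "T (\<lambda>x. ennreal (w x)) x = ennreal (\<integral>\<omega>. A \<omega> powr \<alpha> * w (x / A \<omega>) \<partial>M)"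
proof -
  have eq: "T (\<lambda>x. ennreal (w x)) x = (\<integral>\<^sup>+\<omega>. ennreal (A \<omega> powr \<alpha> * w (x / A \<omega>)) \<partial>M)"
    unfolding T_def by (simp add: ennreal_mult w_nonneg)
  also have "\<dots> < \<infinity>" using T_w_le[OF assms] eq le_less_trans by fastforce
  finally show int: "integrable M (\<lambda>\<omega>. A \<omega> powr \<alpha> * w (x / A \<omega>))"
    using A_w_nonneg by (intro integrableI_nonneg) (auto simp: eq)
  show "T (\<lambda>x. ennreal (w x)) x = ennreal (\<integral>\<omega>. A \<omega> powr \<alpha> * w (x / A \<omega>) \<partial>M)"
    unfolding eq using int A_w_nonneg by (intro nn_integral_eq_integral) auto
qed

definition \<rho>K :: "real \<Rightarrow> real" where
  "\<rho>K K = (\<integral>\<omega>. indicator {..K} (A \<omega>) * (A \<omega> powr \<alpha> * ln (A \<omega>)) \<partial>M)"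

text \<open>The mean decrease of \<open>w\<close> along one step of the tilted walk, restricted to
  \<open>A \<le> K\<close>. The cut-off supplies an integrable majorant of the quotient by
  \<open>L x\<close> that does not depend on \<open>x\<close>; larger jumps are estimated
  separately.\<close>

definition q :: "real \<Rightarrow> real \<Rightarrow> real" where
  "q K x = (\<integral>\<omega>. indicator {..K} (A \<omega>) * (A \<omega> powr \<alpha> * (w x - w (x / A \<omega>))) \<partial>M)"

lemma q_integrable: "x > 0 \<Longrightarrow> integrable M (\<lambda>\<omega>. A \<omega> powr \<alpha> * (w x - w (x / A \<omega>)))"
  using T_w(1)[of x] A_int by (simp add: right_diff_distrib)

lemma rhoK_integrable: "integrable M (\<lambda>\<omega>. indicator {..K} (A \<omega>) * (A \<omega> powr \<alpha> * ln (A \<omega>)))"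
  by (rule Bochner_Integration.integrable_bound[OF A_ln_int]) (auto simp: indicator_def)

lemma rhoK_lim: "(\<rho>K \<longlongrightarrow> \<rho>) at_top"
  unfolding \<rho>K_def \<rho>_def
proof (rule integral_dominated_convergence_at_top)
  show "integrable M (\<lambda>\<omega>. \<bar>A \<omega> powr \<alpha> * ln (A \<omega>)\<bar>)" using A_ln_int by (rule integrable_abs)
  show "AE \<omega> in M. ((\<lambda>K. indicator {..K} (A \<omega>) * (A \<omega> powr \<alpha> * ln (A \<omega>))) \<longlongrightarrow> A \<omega> powr \<alpha> * ln (A \<omega>)) at_top"
  proof (rule AE_I2)
    fix \<omega>
    show "((\<lambda>K. indicator {..K} (A \<omega>) * (A \<omega> powr \<alpha> * ln (A \<omega>))) \<longlongrightarrow> A \<omega> powr \<alpha> * ln (A \<omega>)) at_top"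
      by (rule tendsto_eventually) (auto intro!: eventually_mono[OF eventually_ge_at_top[of "A \<omega>"]])
  qed
qed (auto simp: indicator_def)

lemma rhoK_le: "K \<ge> 1 \<Longrightarrow> \<rho>K K \<le> \<rho>"
  unfolding \<rho>K_def \<rho>_def using rhoK_integrable A_ln_int by (intro integral_mono) (auto simp: indicator_def)

text \<open>Dominated convergence on top of \<open>w_decr_lim\<close>. Values
  \<open>1 \<le> A \<le> K\<close> are dominated by the largest of them, \<open>A = K\<close>, whose
  quotient tends to \<open>ln K\<close>; values below 1 are dominated through the elementary growth
  bound for \<open>w\<close>.\<close>

lemma q_lim:
  assumes K: "K \<ge> 1"
  shows "((\<lambda>x. q K x / L x) \<longlongrightarrow> \<rho>K K) at_top"
proof -
  have "((\<lambda>x. \<integral>\<omega>. indicator {..K} (A \<omega>) * (A \<omega> powr \<alpha> * ((w x - w (x / A \<omega>)) / L x)) \<partial>M) \<longlongrightarrow> \<rho>K K) at_top"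
    unfolding \<rho>K_def
  proof (rule integral_dominated_convergence_at_top)
    show "integrable M (\<lambda>\<omega>. (ln K + 1) * A \<omega> powr \<alpha> + 1 / \<alpha>)" using A_int by simp
    show "AE \<omega> in M. ((\<lambda>x. indicator {..K} (A \<omega>) * (A \<omega> powr \<alpha> * ((w x - w (x / A \<omega>)) / L x))) \<longlongrightarrow>
       indicator {..K} (A \<omega>) * (A \<omega> powr \<alpha> * ln (A \<omega>))) at_top"
    proof (rule AE_I2)
      fix \<omega>
      show "((\<lambda>x. indicator {..K} (A \<omega>) * (A \<omega> powr \<alpha> * ((w x - w (x / A \<omega>)) / L x))) \<longlongrightarrow>
       indicator {..K} (A \<omega>) * (A \<omega> powr \<alpha> * ln (A \<omega>))) at_top"
        proof (cases "A \<omega> = 0")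
        case False
        then show ?thesis using A_nonneg[of \<omega>] by (intro tendsto_mult tendsto_const w_decr_lim) auto
      qed simp
    qed
    have "\<forall>\<^sub>F x in at_top. (w x - w (x / K)) / L x < ln K + 1"
      using K by (intro order_tendstoD(2)[OF w_decr_lim]) auto
    then show "\<forall>\<^sub>F x in at_top. AE \<omega> in M. norm (indicator {..K} (A \<omega>) * (A \<omega> powr \<alpha> * ((w x - w (x / A \<omega>)) / L x)))
       \<le> (ln K + 1) * A \<omega> powr \<alpha> + 1 / \<alpha>"
      using eventually_gt_at_top[of 0]
    proof eventually_elim
      case (elim x)
      note Lx = L_pos[OF elim(2)]
      have "norm (indicator {..K} (A \<omega>) * (A \<omega> powr \<alpha> * ((w x - w (x / A \<omega>)) / L x)))
       \<le> (ln K + 1) * A \<omega> powr \<alpha> + 1 / \<alpha>" for \<omega>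
      proof -
        consider "A \<omega> = 0 \<or> A \<omega> > K" | "0 < A \<omega>" "A \<omega> < 1" | "1 \<le> A \<omega>" "A \<omega> \<le> K" using A_nonneg[of \<omega>] by force
        then show ?thesis
        proof cases
          case 1
          then show ?thesis using K alpha_pos A_nonneg[of \<omega>] by (auto simp: indicator_def)
        next
          case 2
          \<comment> \<open>The growth bound costs a factor of order A^(-\<alpha>), which the
            tilting weight compensates exactly, leaving at most
            \<open>(1 - A powr \<alpha>) / \<alpha>\<close>.\<close>
          then have le: "x \<le> x / A \<omega>" using elim by (simp add: field_simps)
          have "\<bar>(w x - w (x / A \<omega>)) / L x\<bar> = (w (x / A \<omega>) - w x) / L x"
            using Lx w_mono[OF le] by (simp add: abs_if divide_less_0_iff minus_divide_left)
          also have "\<dots> \<le> ((x / A \<omega> / x) powr \<alpha> - 1) / \<alpha>"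
            using L_growth[OF elim(2) le] Lx by (simp add: field_simps)
          finally have "A \<omega> powr \<alpha> * \<bar>(w x - w (x / A \<omega>)) / L x\<bar> \<le> A \<omega> powr \<alpha> * (((x / A \<omega> / x) powr \<alpha> - 1) / \<alpha>)"
            by (intro mult_left_mono) auto
          also have "\<dots> = (1 - A \<omega> powr \<alpha>) / \<alpha>" using 2 elim by (simp add: powr_divide right_diff_distrib)
          also have "\<dots> \<le> (ln K + 1) * A \<omega> powr \<alpha> + 1 / \<alpha>" using K alpha_pos
            by (intro add_increasing divide_right_mono) auto
          finally show ?thesis using 2 K by (simp add: abs_mult indicator_def)
        next
          case 3
          then have "x / K \<le> x / A \<omega>" "x / A \<omega> \<le> x" using elim by (auto simp: field_simps)
          then have w: "w (x / K) \<le> w (x / A \<omega>)" "w (x / A \<omega>) \<le> w x" by (auto intro: w_mono)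
          then have "\<bar>(w x - w (x / A \<omega>)) / L x\<bar> = (w x - w (x / A \<omega>)) / L x"
            using Lx by simp
          also have "\<dots> \<le> (w x - w (x / K)) / L x" using w Lx by (intro divide_right_mono) auto
          also have "\<dots> \<le> ln K + 1" using elim by simp
          finally have "A \<omega> powr \<alpha> * \<bar>(w x - w (x / A \<omega>)) / L x\<bar> \<le> A \<omega> powr \<alpha> * (ln K + 1)"
            by (intro mult_left_mono) auto
          moreover have "1 / \<alpha> > 0" using alpha_pos by simp
          ultimately have "A \<omega> powr \<alpha> * \<bar>(w x - w (x / A \<omega>)) / L x\<bar> \<le> (ln K + 1) * A \<omega> powr \<alpha> + 1 / \<alpha>"
            by (simp only: mult.commute[of "ln K + 1"])
          then show ?thesis using 3 by (simp add: abs_mult indicator_def)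
        qed
      qed
      then show ?case by simp
    qed
  qed measurable
  moreover have "(\<integral>\<omega>. indicator {..K} (A \<omega>) * (A \<omega> powr \<alpha> * ((w x - w (x / A \<omega>)) / L x)) \<partial>M) = q K x / L x" for x
    unfolding q_def by (subst integral_divide_zero[symmetric]) simp
  ultimately show ?thesis by (simp only:)
qed

text \<open>Jumps with \<open>A > K\<close> only help here, since \<open>w (x / A) \<le> w x\<close>
  for them. Hence they are dropped, and \<open>K\<close> is taken so large that
  \<open>\<rho>K K\<close> is close to \<rho>.\<close>

lemma w_supersolution:
  assumes "\<epsilon> > 0" "\<epsilon> < 1"
  shows "\<exists>x0>0. \<forall>x\<ge>x0. T (\<lambda>x. ennreal (w x)) x + ennreal ((1 - \<epsilon>) * \<rho> * L x) \<le> ennreal (w x)"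
proof -
  have "\<forall>\<^sub>F K in at_top. \<rho>K K > (1 - \<epsilon>) * \<rho> \<and> K \<ge> 1"
    using rho_pos assms by (intro eventually_conj order_tendstoD(1)[OF rhoK_lim] eventually_ge_at_top) auto
  then obtain K where K: "\<rho>K K > (1 - \<epsilon>) * \<rho>" "K \<ge> 1"
    using eventually_happens'[OF trivial_limit_at_top_linorder] by blast
  have "\<forall>\<^sub>F x in at_top. q K x / L x > (1 - \<epsilon>) * \<rho> \<and> x > 0"
    by (intro eventually_conj order_tendstoD(1)[OF q_lim] eventually_gt_at_top K)
  then obtain x1 where x1: "\<And>x. x \<ge> x1 \<Longrightarrow> q K x / L x > (1 - \<epsilon>) * \<rho> \<and> x > 0"
    by (auto simp: eventually_at_top_linorder)
  have "T (\<lambda>x. ennreal (w x)) x + ennreal ((1 - \<epsilon>) * \<rho> * L x) \<le> ennreal (w x)" if "x \<ge> x1" for x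
  proof -
    have x: "x > 0" "q K x / L x > (1 - \<epsilon>) * \<rho>" using x1[OF that] by auto
    note Lx = L_pos[OF x(1)]
    have "(1 - \<epsilon>) * \<rho> * L x \<le> q K x" using x Lx by (simp add: field_simps)
    also have "\<dots> \<le> (\<integral>\<omega>. A \<omega> powr \<alpha> * (w x - w (x / A \<omega>)) \<partial>M)"
      unfolding q_def
    proof (rule integral_mono)
      show "integrable M (\<lambda>\<omega>. indicator {..K} (A \<omega>) * (A \<omega> powr \<alpha> * (w x - w (x / A \<omega>))))"
        by (rule Bochner_Integration.integrable_bound[OF q_integrable[OF x(1)]]) (auto simp: indicator_def)
      fix \<omega>
      have "w (x / A \<omega>) \<le> w x" if "A \<omega> > K"
        using that K x by (intro w_mono) (auto simp: field_simps)
      then show "indicator {..K} (A \<omega>) * (A \<omega> powr \<alpha> * (w x - w (x / A \<omega>))) \<le> A \<omega> powr \<alpha> * (w x - w (x / A \<omega>))"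
        by (auto simp: indicator_def)
    qed (use q_integrable x in auto)
    also have "\<dots> = w x - (\<integral>\<omega>. A \<omega> powr \<alpha> * w (x / A \<omega>) \<partial>M)"
      using T_w(1)[OF x(1)] A_int by (simp add: right_diff_distrib A_one)
    finally have *: "(1 - \<epsilon>) * \<rho> * L x \<le> w x - (\<integral>\<omega>. A \<omega> powr \<alpha> * w (x / A \<omega>) \<partial>M)" .
    have nn: "0 \<le> (\<integral>\<omega>. A \<omega> powr \<alpha> * w (x / A \<omega>) \<partial>M)" by (simp add: w_nonneg)
    have "0 \<le> (1 - \<epsilon>) * \<rho> * L x" using assms rho_pos Lx by simp
    with * nn show ?thesis unfolding T_w(2)[OF x(1)]
      by (simp add: ennreal_plus[symmetric] del: ennreal_plus)
  qed
  then show ?thesis by (intro exI[of _ "max 1 x1"]) auto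
qed


text \<open>Repairs a function that is a supersolution only from \<open>x0\<close> on. Below
  \<open>x0\<close> the added multiple of \<open>min x x0 powr \<beta>\<close> gains
  \<open>C * x powr \<beta>\<close>, which pays for \<open>T P + s\<close> completely; beyond
  \<open>x0\<close> the added term is still not increased by \<open>T\<close>. The correction is
  bounded.\<close>

lemma pot_patch:
  assumes [measurable]: "P \<in> borel_measurable borel" and x0: "x0 > 0" and C: "C \<ge> 0"
    and hi: "\<And>x. x \<ge> x0 \<Longrightarrow> T P x + s x \<le> P x"
    and lo: "\<And>x. 0 < x \<Longrightarrow> x < x0 \<Longrightarrow> T P x + s x \<le> ennreal (C * x powr \<beta>)"
  shows "pot (\<lambda>x. P x + ennreal (C / (1 - \<theta>)) * ennreal (min x x0 powr \<beta>)) s"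
  unfolding pot_def
proof safe
  show "(\<lambda>x. P x + ennreal (C / (1 - \<theta>)) * ennreal (min x x0 powr \<beta>)) \<in> borel_measurable borel" by measurable
  fix x :: real assume x: "x > 0"
  define g where "g x = ennreal (C / (1 - \<theta>)) * ennreal (min x x0 powr \<beta>)" for x
  have [measurable]: "g \<in> borel_measurable borel" unfolding g_def by measurable
  have "pot g (\<lambda>x. ennreal (C / (1 - \<theta>)) * (ennreal ((1 - \<theta>) * x powr \<beta>) * indicator {..x0} x))"
    unfolding g_def \<theta>_def using beta x0 by (intro pot_cmult pot_min_powr) auto
  then have g: "T g x + ennreal (C / (1 - \<theta>)) * (ennreal ((1 - \<theta>) * x powr \<beta>) * indicator {..x0} x) \<le> g x"
    using x by (auto simp: pot_def)
  have eq: "ennreal (C / (1 - \<theta>)) * ennreal ((1 - \<theta>) * x powr \<beta>) = ennreal (C * x powr \<beta>)"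
    using theta C by (simp add: ennreal_mult[symmetric])
  have "T (\<lambda>x. P x + g x) x + s x \<le> P x + g x"
  proof (cases "x < x0")
    case True
    have "T (\<lambda>x. P x + g x) x + s x = (T P x + s x) + T g x" by (simp add: T_add ac_simps)
    also have "\<dots> \<le> ennreal (C * x powr \<beta>) + T g x" using lo[OF x True] by (rule add_right_mono)
    also have "\<dots> \<le> g x" using g True by (simp add: eq add.commute)
    also have "\<dots> \<le> P x + g x" by simp
    finally show ?thesis .
  next
    case False
    have "T (\<lambda>x. P x + g x) x + s x = (T P x + s x) + T g x" by (simp add: T_add ac_simps)
    also have "\<dots> \<le> P x + g x" using hi[of x] False g by (intro add_mono) (auto elim: order.trans[rotated])
    finally show ?thesis .
  qed
  then show "T (\<lambda>x. P x + ennreal (C / (1 - \<theta>)) * ennreal (min x x0 powr \<beta>)) x + s x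
     \<le> P x + ennreal (C / (1 - \<theta>)) * ennreal (min x x0 powr \<beta>)" by (simp add: g_def)
qed

definition dw :: "real \<Rightarrow> real" where "dw x = w x - w (x / exp 1)"

lemma lw_nonneg: "x > 0 \<Longrightarrow> dw x \<ge> 0"
  unfolding dw_def using w_mono[of "x / exp 1" x] one_le_exp_iff[of 1] by (simp add: field_simps)

text \<open>Serves the estimate of large jumps, where it is applied at the contracted arguments
  \<open>exp (- j) * x\<close>. Monotonicity is recorded in order to bound all these copies by the
  value at \<open>x\<close>.\<close>

lemma pot_lambda:
  "\<exists>C\<ge>0. \<exists>P. pot P (\<lambda>x. ennreal (dw x)) \<and> (\<forall>x>0. P x \<le> ennreal (C * (w x + 1))) \<and> mono_on {0<..} P"
proof -
  obtain x0 where x0: "x0 > 0" "\<And>x. x \<ge> x0 \<Longrightarrow> T (\<lambda>x. ennreal (w x)) x + ennreal ((1 - 1/2) * \<rho> * L x) \<le> ennreal (w x)"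
    using w_supersolution[of "1/2"] by auto
  have "\<forall>\<^sub>F x in at_top. (w x - w (x / exp 1)) / L x < 2"
    by (rule order_tendstoD(2)[OF w_decr_lim]) auto
  then obtain x1 where x1: "\<And>x. x \<ge> x1 \<Longrightarrow> (w x - w (x / exp 1)) / L x < 2"
    by (auto simp: eventually_at_top_linorder)
  define x2 where "x2 = max x0 x1"
  have x2: "x2 > 0" using x0 by (simp add: x2_def)
  \<comment> \<open>With \<open>\<epsilon> = 1/2\<close> the function \<open>w\<close> absorbs the
    source \<open>\<rho> * L x / 2\<close>, while \<open>dw x \<le> 2 * L x\<close> eventually, as
    the quotient tends to \<open>ln (exp 1) = 1\<close>. The factor \<open>4 / \<rho>\<close>
    matches the two.\<close>
  define P where "P x = ennreal (4 / \<rho>) * ennreal (w x)" for x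
  have Pm [measurable]: "P \<in> borel_measurable borel" unfolding P_def by measurable
  have TP: "T P x = ennreal (4 / \<rho>) * T (\<lambda>x. ennreal (w x)) x" for x
    unfolding P_def by (rule T_cmult) measurable
  define C where "C = 4 / \<rho> * Cw + Cw"
  have C0: "C \<ge> 0" using rho_pos Cw by (simp add: C_def)
  have *: "pot (\<lambda>x. P x + ennreal (C / (1 - \<theta>)) * ennreal (min x x2 powr \<beta>)) (\<lambda>x. ennreal (dw x))"
  proof (rule pot_patch[OF Pm x2 C0])
    fix x assume x: "x \<ge> x2"
    then have xp: "x > 0" using x2 by simp
    have "dw x \<le> 2 * L x" using x1[of x] x L_pos[OF xp] by (simp add: x2_def dw_def field_simps)
    then have "ennreal (dw x) \<le> ennreal (4 / \<rho>) * ennreal ((1 - 1/2) * \<rho> * L x)"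
      using rho_pos L_pos[OF xp] by (simp add: ennreal_mult[symmetric])
    then have "T P x + ennreal (dw x) \<le> ennreal (4 / \<rho>) * (T (\<lambda>x. ennreal (w x)) x + ennreal ((1 - 1/2) * \<rho> * L x))"
      unfolding TP distrib_left by (rule add_left_mono)
    also have "\<dots> \<le> P x" unfolding P_def using x0(2)[of x] x by (intro mult_left_mono) (auto simp: x2_def)
    finally show "T P x + ennreal (dw x) \<le> P x" .
  next
    fix x assume x: "0 < x" "x < x2"
    have "dw x \<le> Cw * x powr \<beta>" using Cw(2)[OF x(1)] w_nonneg[of "x / exp 1"] by (simp add: dw_def)
    then have "T P x + ennreal (dw x) \<le> ennreal (4 / \<rho>) * ennreal (Cw * x powr \<beta>) + ennreal (Cw * x powr \<beta>)"
      unfolding TP using T_w_le[OF x(1)] by (intro add_mono mult_left_mono ennreal_leI) auto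
    also have "\<dots> = ennreal (C * x powr \<beta>)" using rho_pos Cw
      by (simp add: C_def ennreal_mult[symmetric] ennreal_plus[symmetric] algebra_simps del: ennreal_plus)
    finally show "T P x + ennreal (dw x) \<le> ennreal (C * x powr \<beta>)" .
  qed
  have bound: "P x + ennreal (C / (1 - \<theta>)) * ennreal (min x x2 powr \<beta>) \<le> ennreal ((4 / \<rho> + C / (1 - \<theta>) * x2 powr \<beta>) * (w x + 1))"
    if "x > 0" for x
  proof -
    have "P x + ennreal (C / (1 - \<theta>)) * ennreal (min x x2 powr \<beta>) = ennreal (4 / \<rho> * w x + C / (1 - \<theta>) * min x x2 powr \<beta>)"
      using rho_pos C0 theta w_nonneg by (simp add: P_def ennreal_mult[symmetric] ennreal_plus[symmetric] del: ennreal_plus)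
    also have "\<dots> \<le> ennreal (4 / \<rho> * (w x + 1) + C / (1 - \<theta>) * x2 powr \<beta> * (w x + 1))"
    proof (intro ennreal_leI add_mono)
      show "4 / \<rho> * w x \<le> 4 / \<rho> * (w x + 1)" using rho_pos by (intro mult_left_mono) auto
      have "C / (1 - \<theta>) * min x x2 powr \<beta> \<le> C / (1 - \<theta>) * x2 powr \<beta>"
        using C0 theta that x2 beta by (intro mult_left_mono powr_mono2) auto
      also have "\<dots> * 1 \<le> C / (1 - \<theta>) * x2 powr \<beta> * (w x + 1)" using C0 theta w_nonneg
        by (intro mult_left_mono) auto
      finally show "C / (1 - \<theta>) * min x x2 powr \<beta> \<le> C / (1 - \<theta>) * x2 powr \<beta> * (w x + 1)" by simp
    qed
    finally show ?thesis by (simp add: distrib_right)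
  qed
  have "mono_on {0<..} (\<lambda>x. P x + ennreal (C / (1 - \<theta>)) * ennreal (min x x2 powr \<beta>))"
    using x2 beta by (intro mono_onI add_mono mult_left_mono) (auto simp: P_def intro!: mult_left_mono ennreal_leI powr_mono2 w_mono)
  with * bound rho_pos C0 theta show ?thesis
    by (intro exI[of _ "4 / \<rho> + C / (1 - \<theta>) * x2 powr \<beta>"] conjI
      exI[of _ "\<lambda>x. P x + ennreal (C / (1 - \<theta>)) * ennreal (min x x2 powr \<beta>)"]) auto
qed

section \<open>Subsolutions and the contribution of large jumps\<close>

definition eK :: "real \<Rightarrow> real \<Rightarrow> ennreal" where
  "eK K x = (\<integral>\<^sup>+\<omega>. ennreal (indicator {K<..} (A \<omega>) * (A \<omega> powr \<alpha> * (w x - w (x / A \<omega>)))) \<partial>M)"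

text \<open>From below, the jumps above \<open>K\<close> have the unfavourable sign and are kept as
  the error \<open>eK K\<close>. Since \<open>\<rho>K K \<le> \<rho>\<close> for every
  \<open>K \<ge> 1\<close>, the cut-off stays free and can later be chosen to make the potential of
  this error small.\<close>

lemma w_subsolution:
  assumes "\<epsilon> > 0" and K: "K \<ge> 1"
  shows "\<exists>x0>0. \<forall>x\<ge>x0. ennreal (w x) \<le> T (\<lambda>x. ennreal (w x)) x + ennreal ((1 + \<epsilon>) * \<rho> * L x) + eK K x"
proof -
  have "\<rho>K K < (1 + \<epsilon>) * \<rho>" using rhoK_le[OF K] assms rho_pos by (simp add: algebra_simps add_pos_nonneg le_less_trans)
  then have "\<forall>\<^sub>F x in at_top. q K x / L x < (1 + \<epsilon>) * \<rho> \<and> x > 0"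
    by (intro eventually_conj order_tendstoD(2)[OF q_lim] eventually_gt_at_top K)
  then obtain x1 where x1: "\<And>x. x \<ge> x1 \<Longrightarrow> q K x / L x < (1 + \<epsilon>) * \<rho> \<and> x > 0"
    by (auto simp: eventually_at_top_linorder)
  have "ennreal (w x) \<le> T (\<lambda>x. ennreal (w x)) x + ennreal ((1 + \<epsilon>) * \<rho> * L x) + eK K x" if "x \<ge> x1" for x
  proof -
    have x: "x > 0" "q K x / L x < (1 + \<epsilon>) * \<rho>" using x1[OF that] by auto
    note Lx = L_pos[OF x(1)]
    define e where "e = (\<integral>\<omega>. indicator {K<..} (A \<omega>) * (A \<omega> powr \<alpha> * (w x - w (x / A \<omega>))) \<partial>M)"
    have i1: "integrable M (\<lambda>\<omega>. indicator {..K} (A \<omega>) * (A \<omega> powr \<alpha> * (w x - w (x / A \<omega>))))"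
      "integrable M (\<lambda>\<omega>. indicator {K<..} (A \<omega>) * (A \<omega> powr \<alpha> * (w x - w (x / A \<omega>))))"
      by (rule Bochner_Integration.integrable_bound[OF q_integrable[OF x(1)]], auto simp: indicator_def)+
    have nn: "0 \<le> indicator {K<..} (A \<omega>) * (A \<omega> powr \<alpha> * (w x - w (x / A \<omega>)))" for \<omega>
    proof -
      have "w (x / A \<omega>) \<le> w x" if "A \<omega> > K"
        using that K x by (intro w_mono) (auto simp: field_simps)
      then show ?thesis by (auto simp: indicator_def)
    qed
    have eK: "eK K x = ennreal e" "e \<ge> 0" unfolding eK_def e_def
      using i1(2) nn by (auto intro!: nn_integral_eq_integral)
    have "w x - (\<integral>\<omega>. A \<omega> powr \<alpha> * w (x / A \<omega>) \<partial>M) = (\<integral>\<omega>. A \<omega> powr \<alpha> * (w x - w (x / A \<omega>)) \<partial>M)"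
      using T_w(1)[OF x(1)] A_int by (simp add: right_diff_distrib A_one)
    also have "\<dots> = q K x + e"
      unfolding q_def e_def Bochner_Integration.integral_add[OF i1, symmetric]
      by (rule Bochner_Integration.integral_cong) (auto simp: indicator_def)
    also have "\<dots> \<le> (1 + \<epsilon>) * \<rho> * L x + e" using x Lx by (simp add: field_simps)
    finally have *: "w x \<le> (\<integral>\<omega>. A \<omega> powr \<alpha> * w (x / A \<omega>) \<partial>M) + (1 + \<epsilon>) * \<rho> * L x + e" by simp
    have nn: "0 \<le> (\<integral>\<omega>. A \<omega> powr \<alpha> * w (x / A \<omega>) \<partial>M)" by (simp add: w_nonneg)
    show ?thesis unfolding T_w(2)[OF x(1)] eK(1) using * nn assms rho_pos Lx eK(2)
      by (simp add: ennreal_plus[symmetric] del: ennreal_plus)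
  qed
  then show ?thesis by (intro exI[of _ "max 1 x1"]) auto
qed

text \<open>Splitting the range of a jump into factors \<open>exp 1\<close> bounds the contribution of jumps above \<open>K\<close> by
  rescaled copies of \<open>dw\<close>. As \<open>T\<close> commutes with scaling, a single supersolution for \<open>dw\<close> suffices.\<close>

definition \<kappa> :: "real \<Rightarrow> real \<Rightarrow> ennreal" where
  "\<kappa> K t = (\<integral>\<^sup>+\<omega>. ennreal (A \<omega> powr \<alpha>) * (indicator {K<..} (A \<omega>) * indicator {t<..} (A \<omega>)) \<partial>M)"

text \<open>With \<open>J\<close> the ceiling of \<open>ln A\<close>, monotonicity replaces
  \<open>x / A\<close> by \<open>exp (- J) * x\<close>, and the difference telescopes into
  \<open>J\<close> increments over factors \<open>exp 1\<close>. Each index \<open>j < J\<close>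
  satisfies \<open>exp j < A\<close>, so the weights are the tilted tails \<kappa>.\<close>

lemma eK_le:
  assumes x: "x > 0" and K: "K \<ge> 1"
  shows "eK K x \<le> (\<Sum>j. \<kappa> K (exp (real j)) * ennreal (dw (exp (- real j) * x)))"
proof -
  have "eK K x \<le> (\<integral>\<^sup>+\<omega>. (\<Sum>j. ennreal (A \<omega> powr \<alpha>) * (indicator {K<..} (A \<omega>) * indicator {exp (real j)<..} (A \<omega>)) * ennreal (dw (exp (- real j) * x))) \<partial>M)"
    unfolding eK_def
  proof (rule nn_integral_mono)
    fix \<omega>
    show "ennreal (indicator {K<..} (A \<omega>) * (A \<omega> powr \<alpha> * (w x - w (x / A \<omega>))))
       \<le> (\<Sum>j. ennreal (A \<omega> powr \<alpha>) * (indicator {K<..} (A \<omega>) * indicator {exp (real j)<..} (A \<omega>)) * ennreal (dw (exp (- real j) * x)))"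
    proof (cases "A \<omega> > K")
      case True
      then have A1: "A \<omega> > 1" using K by simp
      define J where "J = nat \<lceil>ln (A \<omega>)\<rceil>"
      have "A \<omega> = exp (ln (A \<omega>))" using A1 by simp
      also have "\<dots> \<le> exp (real J)" unfolding exp_le_cancel_iff J_def using A1 by (simp add: real_nat_ceiling_ge)
      finally have J: "A \<omega> \<le> exp (real J)" .
      have J2: "A \<omega> > exp (real j)" if "j < J" for j
      proof -
        have "real j < ln (A \<omega>)" using that A1 unfolding J_def by linarith
        then have "exp (real j) < exp (ln (A \<omega>))" by simp
        then show ?thesis using A1 by simp
      qed
      have "w x - w (x / A \<omega>) \<le> w (exp (- real 0) * x) - w (exp (- real J) * x)"
        using J A1 x by (auto intro!: w_mono simp: exp_minus field_simps)
      also have "\<dots> = (\<Sum>j<J. dw (exp (- real j) * x))"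
      proof -
        have "dw (exp (- real j) * x) = w (exp (- real j) * x) - w (exp (- real (Suc j)) * x)" for j
          by (simp add: dw_def exp_diff exp_add exp_minus field_simps)
        then show ?thesis using sum_lessThan_telescope'[of "\<lambda>j. w (exp (- real j) * x)" J] by simp
      qed
      finally have "ennreal (A \<omega> powr \<alpha> * (w x - w (x / A \<omega>))) \<le> ennreal (A \<omega> powr \<alpha> * (\<Sum>j<J. dw (exp (- real j) * x)))"
        by (intro ennreal_leI mult_left_mono) auto
      also have "\<dots> = (\<Sum>j<J. ennreal (A \<omega> powr \<alpha>) * (indicator {K<..} (A \<omega>) * indicator {exp (real j)<..} (A \<omega>)) * ennreal (dw (exp (- real j) * x)))"
        using x True J2 by (simp add: ennreal_mult sum_nonneg lw_nonneg sum_ennreal[symmetric] sum_distrib_left del: sum_ennreal)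
      also have "\<dots> \<le> (\<Sum>j. ennreal (A \<omega> powr \<alpha>) * (indicator {K<..} (A \<omega>) * indicator {exp (real j)<..} (A \<omega>)) * ennreal (dw (exp (- real j) * x)))"
        by (rule sum_le_suminf) auto
      finally show ?thesis using True by simp
    qed simp
  qed
  also have "\<dots> = (\<Sum>j. \<kappa> K (exp (real j)) * ennreal (dw (exp (- real j) * x)))"
    unfolding \<kappa>_def by (subst nn_integral_suminf) (auto simp: nn_integral_multc)
  finally show ?thesis .
qed

lemma kappa_sum: "K \<ge> 1 \<Longrightarrow> (\<Sum>j. \<kappa> K (exp (real j))) \<le> (\<integral>\<^sup>+\<omega>. ennreal (indicator {K<..} (A \<omega>) * (A \<omega> powr \<alpha> * (ln (A \<omega>) + 1))) \<partial>M)"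
proof -
  assume K: "K \<ge> 1"
  have "(\<Sum>j. \<kappa> K (exp (real j))) = (\<integral>\<^sup>+\<omega>. (\<Sum>j. ennreal (A \<omega> powr \<alpha>) * (indicator {K<..} (A \<omega>) * indicator {exp (real j)<..} (A \<omega>))) \<partial>M)"
    unfolding \<kappa>_def by (rule nn_integral_suminf[symmetric]) measurable
  also have "\<dots> \<le> (\<integral>\<^sup>+\<omega>. ennreal (indicator {K<..} (A \<omega>) * (A \<omega> powr \<alpha> * (ln (A \<omega>) + 1))) \<partial>M)"
  proof (rule nn_integral_mono)
    fix \<omega>
    show "(\<Sum>j. ennreal (A \<omega> powr \<alpha>) * (indicator {K<..} (A \<omega>) * indicator {exp (real j)<..} (A \<omega>)))
      \<le> ennreal (indicator {K<..} (A \<omega>) * (A \<omega> powr \<alpha> * (ln (A \<omega>) + 1)))"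
    proof (cases "A \<omega> > K")
      case True
      then have A1: "A \<omega> > 1" using K by simp
      define J where "J = nat \<lceil>ln (A \<omega>)\<rceil>"
      have J: "real J \<le> ln (A \<omega>) + 1" using A1 unfolding J_def by (simp add: of_nat_nat)
      have z: "indicator {exp (real j)<..} (A \<omega>) = (0::ennreal)" if "j \<notin> {..<J}" for j
      proof -
        have "ln (A \<omega>) \<le> real j" using that A1 unfolding J_def by (auto simp: not_less)
        then have "exp (ln (A \<omega>)) \<le> exp (real j)" by simp
        then show ?thesis using A1 by simp
      qed
      have "(\<Sum>j. ennreal (A \<omega> powr \<alpha>) * (indicator {K<..} (A \<omega>) * indicator {exp (real j)<..} (A \<omega>)))
        = (\<Sum>j<J. ennreal (A \<omega> powr \<alpha>) * (indicator {K<..} (A \<omega>) * indicator {exp (real j)<..} (A \<omega>)))"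
        using z by (intro suminf_finite) auto
      also have "\<dots> \<le> (\<Sum>j<J. ennreal (A \<omega> powr \<alpha>))"
        by (intro sum_mono) (auto simp: indicator_def)
      also have "\<dots> = ennreal (A \<omega> powr \<alpha> * real J)"
        by (simp add: ennreal_mult mult.commute ennreal_of_nat_eq_real_of_nat)
      also have "\<dots> \<le> ennreal (A \<omega> powr \<alpha> * (ln (A \<omega>) + 1))"
        using J by (intro ennreal_leI mult_left_mono) auto
      finally show ?thesis using True by simp
    qed simp
  qed
  finally show ?thesis .
qed

text \<open>At most \<open>ln A + 1\<close> grid points \<open>exp j\<close> lie below
  \<open>A > 1\<close>, so the total weight is bounded by a mean of A^\<alpha> (ln A + 1) over
  \<open>A > K\<close>. It vanishes as \<open>K\<close> grows by integrability of A^\<alpha> ln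
  A.\<close>

lemma kappa_small:
  assumes "\<delta> > 0"
  shows "\<exists>K\<ge>1. (\<Sum>j. \<kappa> K (exp (real j))) \<le> ennreal \<delta>"
proof -
  define h where "h K \<omega> = indicator {K<..} (A \<omega>) * (A \<omega> powr \<alpha> * (ln (A \<omega>) + 1))" for K \<omega>
  have [measurable]: "h K \<in> borel_measurable M" for K unfolding h_def by measurable
  have h_bound: "\<bar>h K \<omega>\<bar> \<le> \<bar>A \<omega> powr \<alpha> * ln (A \<omega>)\<bar> + A \<omega> powr \<alpha>" for K \<omega>
    by (auto simp: h_def indicator_def distrib_left intro: order.trans[OF abs_triangle_ineq])
  have "((\<lambda>K. \<integral>\<omega>. h K \<omega> \<partial>M) \<longlongrightarrow> (\<integral>\<omega>. 0 \<partial>M)) at_top"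
  proof (rule integral_dominated_convergence_at_top)
    show "integrable M (\<lambda>\<omega>. \<bar>A \<omega> powr \<alpha> * ln (A \<omega>)\<bar> + A \<omega> powr \<alpha>)" using A_ln_int A_int by auto
    show "AE \<omega> in M. ((\<lambda>K. h K \<omega>) \<longlongrightarrow> 0) at_top"
    proof (rule AE_I2)
      fix \<omega>
      show "((\<lambda>K. h K \<omega>) \<longlongrightarrow> 0) at_top"
        unfolding h_def by (rule tendsto_eventually) (auto intro!: eventually_mono[OF eventually_ge_at_top[of "A \<omega>"]])
    qed
    from h_bound show "\<forall>\<^sub>F K in at_top. AE \<omega> in M. norm (h K \<omega>) \<le> \<bar>A \<omega> powr \<alpha> * ln (A \<omega>)\<bar> + A \<omega> powr \<alpha>"
      by simp
  qed (auto simp: h_def)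
  then have "\<forall>\<^sub>F K in at_top. (\<integral>\<omega>. h K \<omega> \<partial>M) < \<delta> \<and> K \<ge> 1"
    using assms by (intro eventually_conj order_tendstoD(2) eventually_ge_at_top) auto
  then obtain K where K: "(\<integral>\<omega>. h K \<omega> \<partial>M) < \<delta>" "K \<ge> 1"
    using eventually_happens'[OF trivial_limit_at_top_linorder] by blast
  have "integrable M (h K)"
    by (rule Bochner_Integration.integrable_bound[of _ "\<lambda>\<omega>. \<bar>A \<omega> powr \<alpha> * ln (A \<omega>)\<bar> + A \<omega> powr \<alpha>"])
      (use A_ln_int A_int h_bound in auto)
  moreover have "h K \<omega> \<ge> 0" for \<omega> using K by (auto simp: h_def indicator_def)
  ultimately have "(\<integral>\<^sup>+\<omega>. ennreal (h K \<omega>) \<partial>M) \<le> ennreal \<delta>"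
    using K(1) by (subst nn_integral_eq_integral) (auto intro!: ennreal_leI)
  with kappa_sum[OF K(2)] K(2) show ?thesis unfolding h_def by (meson order.trans)
qed

text \<open>A superposition of rescaled copies of one supersolution for \<open>dw\<close>. By
  monotonicity each copy is at most \<open>C * (w x + 1)\<close>, and the total weight is below
  \<open>\<delta> / (C + 1)\<close>.\<close>

lemma pot_eK:
  assumes \<delta>: "\<delta> > 0"
  shows "\<exists>K\<ge>1. \<exists>P. pot P (eK K) \<and> (\<forall>x>0. P x \<le> ennreal (\<delta> * (w x + 1)))"
proof -
  obtain C P where C: "C \<ge> 0" and P: "pot P (\<lambda>x. ennreal (dw x))"
    and Pb: "\<And>x. x > 0 \<Longrightarrow> P x \<le> ennreal (C * (w x + 1))" and Pm: "mono_on {0<..} P"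
    using pot_lambda by blast
  obtain K where K: "K \<ge> 1" "(\<Sum>j. \<kappa> K (exp (real j))) \<le> ennreal (\<delta> / (C + 1))"
    using kappa_small[of "\<delta> / (C + 1)"] \<delta> C by auto
  define Q where "Q x = (\<integral>\<^sup>+j. \<kappa> K (exp (real j)) * P (exp (- real j) * x) \<partial>count_space UNIV)" for x
  have [measurable]: "P \<in> borel_measurable borel" using P by (simp add: pot_def)
  have [measurable]: "dw \<in> borel_measurable borel" unfolding dw_def by measurable
  have "pot Q (\<lambda>x. \<integral>\<^sup>+j. \<kappa> K (exp (real j)) * ennreal (dw (exp (- real j) * x)) \<partial>count_space UNIV)"
    unfolding Q_def
  proof (rule pot_nn_integral)
    show "sigma_finite_measure (count_space (UNIV :: nat set))" by (rule sigma_finite_measure_count_space)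
    show "(\<lambda>(j::nat, x). \<kappa> K (exp (real j)) * P (exp (- real j) * x)) \<in> borel_measurable (count_space UNIV \<Otimes>\<^sub>M borel)"
      by (rule measurable_pair_measure_countable1) auto
    show "(\<lambda>(j::nat, x). \<kappa> K (exp (real j)) * ennreal (dw (exp (- real j) * x))) \<in> borel_measurable (count_space UNIV \<Otimes>\<^sub>M borel)"
      by (rule measurable_pair_measure_countable1) auto
    show "pot (\<lambda>x. \<kappa> K (exp (real j)) * P (exp (- real j) * x)) (\<lambda>x. \<kappa> K (exp (real j)) * ennreal (dw (exp (- real j) * x)))" for j
      by (intro pot_cmult pot_scale[OF P]) auto
  qed
  then have "pot Q (eK K)"
    by (rule pot_le) (simp add: nn_integral_count_space_nat eK_le K)
  moreover have "Q x \<le> ennreal (\<delta> * (w x + 1))" if "x > 0" for x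
  proof -
    have "Q x \<le> (\<integral>\<^sup>+j. \<kappa> K (exp (real j)) * ennreal (C * (w x + 1)) \<partial>count_space UNIV)"
      unfolding Q_def
    proof (intro nn_integral_mono mult_left_mono)
      fix j :: nat
      have "P (exp (- real j) * x) \<le> P x" using that by (intro mono_onD[OF Pm]) auto
      with Pb[OF that] show "P (exp (- real j) * x) \<le> ennreal (C * (w x + 1))" by (rule order.trans[rotated])
    qed auto
    also have "\<dots> = (\<Sum>j. \<kappa> K (exp (real j))) * ennreal (C * (w x + 1))"
      by (subst nn_integral_multc) (auto simp: nn_integral_count_space_nat)
    also have "\<dots> \<le> ennreal (\<delta> / (C + 1)) * ennreal (C * (w x + 1))" by (rule mult_right_mono[OF K(2)]) simp
    also have "\<dots> \<le> ennreal (\<delta> * (w x + 1))"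
    proof -
      have "\<delta> / (C + 1) * (C * (w x + 1)) = \<delta> * (w x + 1) * (C / (C + 1))" by simp
      also have "\<dots> \<le> \<delta> * (w x + 1) * 1" using C \<delta> w_nonneg[of x] by (intro mult_left_mono) auto
      finally show ?thesis using C \<delta> w_nonneg[of x] by (simp add: ennreal_mult[symmetric])
    qed
    finally show ?thesis .
  qed
  ultimately show ?thesis using K(1) by blast
qed

end

section \<open>The upper bound\<close>

definition st_le :: "real measure \<Rightarrow> real measure \<Rightarrow> bool" where
  "st_le N N' \<longleftrightarrow> (\<forall>h::real \<Rightarrow> ennreal. mono h \<longrightarrow> h \<in> borel_measurable borel \<longrightarrow> (\<integral>\<^sup>+z. h z \<partial>N) \<le> (\<integral>\<^sup>+z. h z \<partial>N'))"

lemma st_leD: "st_le N N' \<Longrightarrow> mono h \<Longrightarrow> h \<in> borel_measurable borel \<Longrightarrow> (\<integral>\<^sup>+z. h z \<partial>N) \<le> (\<integral>\<^sup>+z. h z \<partial>N')"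
  by (simp add: st_le_def)

lemma st_le_refl: "st_le N N" by (simp add: st_le_def)
lemma st_le_trans: "st_le N N' \<Longrightarrow> st_le N' N'' \<Longrightarrow> st_le N N''" unfolding st_le_def by (meson order.trans)

lemma (in prob_space) st_le_pair:
  assumes le: "st_le N N'" and sets [measurable_cong]: "sets N = sets borel" "sets N' = sets borel"
    and mono: "\<And>z z' \<omega>. z \<le> z' \<Longrightarrow> f (z, \<omega>) \<le> f (z', \<omega>)"
    and [measurable]: "f \<in> borel_measurable (borel \<Otimes>\<^sub>M M)"
  shows "(\<integral>\<^sup>+p. (f p :: ennreal) \<partial>(N \<Otimes>\<^sub>M M)) \<le> (\<integral>\<^sup>+p. f p \<partial>(N' \<Otimes>\<^sub>M M))"
proof -
  have "(\<integral>\<^sup>+z. \<integral>\<^sup>+\<omega>. f (z, \<omega>) \<partial>M \<partial>N) \<le> (\<integral>\<^sup>+z. \<integral>\<^sup>+\<omega>. f (z, \<omega>) \<partial>M \<partial>N')"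
    by (rule st_leD[OF le]) (auto intro!: monoI nn_integral_mono mono)
  then show ?thesis by (simp add: nn_integral_fst)
qed

definition ramp :: "real \<Rightarrow> real \<Rightarrow> real" where "ramp l z = min 1 (max 0 ((z - 1) / (l - 1)))"

lemma ramp_bounds: "0 \<le> ramp l z" "ramp l z \<le> 1" by (auto simp: ramp_def)
lemma ramp_meas [measurable]: "ramp l \<in> borel_measurable borel" unfolding ramp_def by measurable
lemma ramp_mono: "l > 1 \<Longrightarrow> x \<le> y \<Longrightarrow> ramp l x \<le> ramp l y"
  unfolding ramp_def by (intro min.mono max.mono divide_right_mono order.refl) auto
lemma ramp_0: "l > 1 \<Longrightarrow> z \<le> 1 \<Longrightarrow> ramp l z = 0"
  using divide_le_0_iff[of "z - 1" "l - 1"] by (simp add: ramp_def max_absorb1)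
lemma ramp_1: "l > 1 \<Longrightarrow> z \<ge> l \<Longrightarrow> ramp l z = 1" by (auto simp: ramp_def min_def max_def)

lemma ramp_add_le:
  assumes "l > 1" "q \<ge> 0"
  shows "ramp l (p + q) \<le> ramp l p + q / (l - 1)"
proof -
  have "(p + q - 1) / (l - 1) = (p - 1) / (l - 1) + q / (l - 1)" by (simp add: add_divide_distrib diff_divide_distrib)
  moreover have "q / (l - 1) \<ge> 0" using assms by simp
  ultimately show ?thesis unfolding ramp_def by linarith
qed

text \<open>The change is bounded both by 1 and by the Lipschitz bound, hence by any power of the
  latter with exponent in (0, 1]. The freedom in \<open>s\<close> allows the exponents to be matched
  to the available mixed moments.\<close>

lemma ramp_perturb:
  assumes l: "l > 1" and s: "0 < s" "s \<le> 1"
  shows "ramp l (p + q) \<le> ramp l p + (max 0 q / (l - 1)) powr s"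
proof (cases "q \<ge> 0")
  case True
  have "ramp l (p + q) \<le> ramp l p + min 1 (q / (l - 1))"
    using ramp_add_le[OF l True, of p] ramp_bounds[of l "p + q"] ramp_bounds[of l p] by (auto simp: min_def)
  also have "min 1 (q / (l - 1)) \<le> (q / (l - 1)) powr s" using True l s by (intro min1_le_powr) auto
  finally show ?thesis using True by (simp add: max_def)
next
  case False
  then show ?thesis using ramp_mono[OF l, of "p + q" p] by simp
qed

text \<open>If \<open>p + q > 1\<close>, one of the summands is at least 1/2 and the other one is
  treated as its perturbation. Each cost is a power of one variable times the indicator that the
  other one is large, which is the shape of a source covered by \<open>pot_mix\<close>.\<close>

lemma ramp_subadd:
  assumes l: "l > 1" and s: "0 < s" "s \<le> 1" "0 < t" "t \<le> 1"
  shows "ramp l (p + q) \<le> ramp l p + ramp l q + (max 0 q / (l - 1)) powr s * indicator {1..} (2 * max 0 p)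
     + (max 0 p / (l - 1)) powr t * indicator {1..} (2 * max 0 q)"
proof -
  consider "p \<ge> 1/2" | "q \<ge> 1/2" | "p + q \<le> 1" by linarith
  then show ?thesis
  proof cases
    case 1
    then have i: "indicator {1..} (2 * max 0 p) = (1::real)" by (simp add: indicator_def)
    have "0 \<le> (max 0 p / (l - 1)) powr t * indicator {1..} (2 * max 0 q)" by simp
    then show ?thesis unfolding i using ramp_perturb[OF l s(1,2), of p q] ramp_bounds[of l q] by linarith
  next
    case 2
    then have i: "indicator {1..} (2 * max 0 q) = (1::real)" by (simp add: indicator_def)
    have "0 \<le> (max 0 q / (l - 1)) powr s * indicator {1..} (2 * max 0 p)" by simp
    then show ?thesis unfolding i add.commute[of p q]
      using ramp_perturb[OF l s(3,4), of q p] ramp_bounds[of l p] by linarith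
  next
    case 3
    then show ?thesis using ramp_0[OF l 3] ramp_bounds[of l p] ramp_bounds[of l q] by (simp add: indicator_def)
  qed
qed

text \<open>For \<open>q > 1\<close> the error is charged to \<open>p\<close>, whatever its sign. If
  only \<open>p > 1\<close>, then just the negative part of \<open>q\<close> does harm; this cost is
  kept in the form \<open>min 1 (...)\<close> because replacing it by a power would later require an
  integrability that need not hold.\<close>

lemma ramp_superadd:
  assumes l: "l > 1" and s: "0 < s" "s \<le> 1"
  shows "ramp l p + ramp l q \<le> ramp l (p + q) + (1 + (1 / (l - 1)) powr s) * \<bar>p\<bar> powr s * indicator {1<..} q
    + min 1 (1 / (l - 1) * max 0 (- q)) * indicator {1<..} p"
proof -
  define K where "K = 1 / (l - 1)"
  have K: "K \<ge> 0" using l by (simp add: K_def)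
  have K': "0 \<le> (1 + K powr s) * \<bar>p\<bar> powr s" by simp
  have m0: "0 \<le> min 1 (K * max 0 (- q))" using K by simp
  have "ramp l p + ramp l q \<le> ramp l (p + q) + (1 + K powr s) * \<bar>p\<bar> powr s" if "q > 1"
  proof (cases "p \<ge> 0")
    case True
    have 1: "ramp l q \<le> ramp l (p + q)" using True by (intro ramp_mono l) auto
    have "ramp l p \<le> \<bar>p\<bar> powr s"
    proof (cases "p \<le> 1")
      case False
      then have "1 \<le> \<bar>p\<bar> powr s" using s by (intro ge_one_powr_ge_zero) auto
      with ramp_bounds[of l p] show ?thesis by simp
    qed (simp add: ramp_0[OF l])
    also have "\<dots> \<le> (1 + K powr s) * \<bar>p\<bar> powr s" by (simp add: algebra_simps)
    finally show ?thesis using 1 by simp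
  next
    case False
    have "ramp l q \<le> ramp l (p + q) + (max 0 (- p) / (l - 1)) powr s"
      using ramp_perturb[OF l s, of "p + q" "- p"] by simp
    also have "(max 0 (- p) / (l - 1)) powr s = K powr s * \<bar>p\<bar> powr s"
    proof -
      have "max 0 (- p) / (l - 1) = K * \<bar>p\<bar>" using False by (simp add: K_def)
      then show ?thesis using K by (simp add: powr_mult)
    qed
    also have "\<dots> \<le> (1 + K powr s) * \<bar>p\<bar> powr s" by (simp add: algebra_simps)
    finally show ?thesis using False ramp_0[OF l, of p] by simp
  qed
  moreover have "ramp l p + ramp l q \<le> ramp l (p + q) + min 1 (K * max 0 (- q))" if "q \<le> 1" "p > 1"
  proof -
    have "ramp l p \<le> ramp l (p + q) + K * max 0 (- q)"
      using ramp_add_le[OF l, of "- q" "p + q"] ramp_mono[OF l, of p "p + q"] by (cases "q \<ge> 0") (auto simp: K_def)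
    then show ?thesis using that ramp_0[OF l, of q] ramp_bounds[of l p] ramp_bounds[of l "p + q"] by (simp add: min_def)
  qed
  moreover have "ramp l p + ramp l q \<le> ramp l (p + q)" if "q \<le> 1" "p \<le> 1"
    using that ramp_0[OF l] ramp_bounds[of l "p + q"] by simp
  ultimately show ?thesis using K' m0 unfolding K_def[symmetric]
    by (cases "q \<le> 1"; cases "p \<le> 1") (force simp: indicator_def)+
qed

section \<open>One-step inequalities for the smoothed tail\<close>

context perpetuity_tail
begin

definition aff :: "real measure \<Rightarrow> real measure" where
  "aff N = distr (N \<Otimes>\<^sub>M M) borel (\<lambda>(z, \<omega>). A \<omega> * z + Y \<omega>)"

definition H :: "real \<Rightarrow> real measure \<Rightarrow> real \<Rightarrow> ennreal" where
  "H l N x = ennreal (x powr \<alpha>) * (\<integral>\<^sup>+z. ennreal (ramp l (z / x)) \<partial>N)"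

lemma nn_aff:
  assumes [measurable_cong]: "sets N = sets borel" and [measurable]: "h \<in> borel_measurable borel"
  shows "(\<integral>\<^sup>+z. h z \<partial>aff N) = (\<integral>\<^sup>+z. \<integral>\<^sup>+\<omega>. h (A \<omega> * z + Y \<omega>) \<partial>M \<partial>N)"
  unfolding aff_def by (subst nn_integral_distr, measurable) (simp add: nn_integral_fst[symmetric] case_prod_unfold)

lemma sets_aff [simp]: "sets (aff N) = sets borel" by (simp add: aff_def)

lemma prob_aff:
  assumes "prob_space N" and [measurable_cong]: "sets N = sets borel"
  shows "prob_space (aff N)"
proof -
  interpret N: prob_space N by fact
  interpret P: pair_prob_space N M ..
  show ?thesis unfolding aff_def by (rule P.prob_space_distr) measurable
qed

lemma aff_mono:
  assumes le: "st_le N N'" and [measurable_cong]: "sets N = sets borel" "sets N' = sets borel"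
  shows "st_le (aff N) (aff N')"
  unfolding st_le_def
proof safe
  fix h :: "real \<Rightarrow> ennreal" assume h: "mono h" and hm [measurable]: "h \<in> borel_measurable borel"
  have "mono (\<lambda>z. \<integral>\<^sup>+\<omega>. h (A \<omega> * z + Y \<omega>) \<partial>M)"
    by (intro monoI nn_integral_mono monoD[OF h] add_right_mono mult_left_mono A_nonneg)
  then show "(\<integral>\<^sup>+z. h z \<partial>aff N) \<le> (\<integral>\<^sup>+z. h z \<partial>aff N')"
    unfolding nn_aff[OF assms(2) hm] nn_aff[OF assms(3) hm] by (intro st_leD[OF le]) measurable
qed

lemma H_meas [measurable]:
  assumes "prob_space N" and [measurable_cong]: "sets N = sets borel" shows "H l N \<in> borel_measurable borel"
proof -
  interpret N: prob_space N by fact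
  show ?thesis unfolding H_def by measurable
qed

text \<open>Conditioning on \<open>A\<close> and scaling: \<open>T\<close> turns the smoothed tail
  of \<open>Z\<close> into that of \<open>A * Z\<close>. Realisations with \<open>A = 0\<close>
  contribute nothing to either side, because the ramp vanishes at 0.\<close>

lemma T_H:
  assumes "prob_space N" and [measurable_cong]: "sets N = sets borel" and l: "l > 1" and x: "x > 0"
  shows "T (H l N) x = ennreal (x powr \<alpha>) * (\<integral>\<^sup>+z. \<integral>\<^sup>+\<omega>. ennreal (ramp l (A \<omega> * z / x)) \<partial>M \<partial>N)"
proof -
  interpret N: prob_space N by fact
  interpret pair_sigma_finite N M ..
  have "T (H l N) x = (\<integral>\<^sup>+\<omega>. ennreal (x powr \<alpha>) * (\<integral>\<^sup>+z. ennreal (ramp l (A \<omega> * z / x)) \<partial>N) \<partial>M)"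
    unfolding T_def H_def
  proof (rule nn_integral_cong)
    fix \<omega>
    show "ennreal (A \<omega> powr \<alpha>) * (ennreal ((x / A \<omega>) powr \<alpha>) * (\<integral>\<^sup>+z. ennreal (ramp l (z / (x / A \<omega>))) \<partial>N))
      = ennreal (x powr \<alpha>) * (\<integral>\<^sup>+z. ennreal (ramp l (A \<omega> * z / x)) \<partial>N)"
    proof (cases "A \<omega> = 0")
      case False
      then have "A \<omega> > 0" using A_nonneg[of \<omega>] by simp
      then have "ennreal (A \<omega> powr \<alpha>) * ennreal ((x / A \<omega>) powr \<alpha>) = ennreal (x powr \<alpha>)"
        using x by (simp add: ennreal_mult[symmetric] powr_divide)
      moreover have "z / (x / A \<omega>) = A \<omega> * z / x" for z by simp
      ultimately show ?thesis by (simp only: mult.assoc[symmetric])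
    qed (simp add: ramp_0[OF l])
  qed
  also have "\<dots> = ennreal (x powr \<alpha>) * (\<integral>\<^sup>+\<omega>. \<integral>\<^sup>+z. ennreal (ramp l (A \<omega> * z / x)) \<partial>N \<partial>M)"
    by (rule nn_integral_cmult) measurable
  also have "(\<integral>\<^sup>+\<omega>. \<integral>\<^sup>+z. ennreal (ramp l (A \<omega> * z / x)) \<partial>N \<partial>M) = (\<integral>\<^sup>+z. \<integral>\<^sup>+\<omega>. ennreal (ramp l (A \<omega> * z / x)) \<partial>M \<partial>N)"
    by (rule Fubini') measurable
  finally show ?thesis .
qed

lemma nn_indicator_Y: "ennreal (x powr \<alpha>) * (\<integral>\<^sup>+\<omega>. indicator {x<..} (Y \<omega>) \<partial>M) = ennreal (L x)"
proof -
  have "(\<integral>\<^sup>+\<omega>. indicator {x<..} (Y \<omega>) \<partial>M) = (\<integral>\<^sup>+\<omega>. indicator {\<omega> \<in> space M. Y \<omega> > x} \<omega> \<partial>M)"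
    by (intro nn_integral_cong) (auto simp: indicator_def)
  also have "\<dots> = emeasure M {\<omega> \<in> space M. Y \<omega> > x}" by simp
  finally have "(\<integral>\<^sup>+\<omega>. indicator {x<..} (Y \<omega>) \<partial>M) = ennreal (G x)"
    by (simp add: emeasure_eq_measure G_def)
  then show ?thesis by (simp add: L_eq ennreal_mult G_nonneg)
qed

lemma pot_L:
  assumes "\<epsilon> > 0" "\<epsilon> < 1"
  shows "\<exists>C\<ge>0. \<exists>P. pot P (\<lambda>x. ennreal (L x)) \<and> (\<forall>x>0. P x \<le> ennreal (w x / ((1 - \<epsilon>) * \<rho>)) + ennreal C)"
proof -
  obtain x0 where x0: "x0 > 0" "\<And>x. x \<ge> x0 \<Longrightarrow> T (\<lambda>x. ennreal (w x)) x + ennreal ((1 - \<epsilon>) * \<rho> * L x) \<le> ennreal (w x)"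
    using w_supersolution[OF assms] by auto
  define c where "c = 1 / ((1 - \<epsilon>) * \<rho>)"
  have c: "c > 0" using assms rho_pos by (simp add: c_def)
  define P where "P x = ennreal c * ennreal (w x)" for x
  have Pm [measurable]: "P \<in> borel_measurable borel" unfolding P_def by measurable
  have TP: "T P x = ennreal c * T (\<lambda>x. ennreal (w x)) x" for x
    unfolding P_def by (rule T_cmult) measurable
  \<comment> \<open>Collects what has to be paid below \<open>x0\<close>: \<open>T P x\<close> is at
    most \<open>c * Cw * x powr \<beta>\<close>, and \<open>L x \<le> x powr \<alpha>\<close> is at
    most \<open>x0 powr (\<alpha> - \<beta>) * x powr \<beta>\<close>.\<close>
  define C where "C = c * Cw + x0 powr (\<alpha> - \<beta>)"
  have C0: "C \<ge> 0" using c Cw by (simp add: C_def)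
  have *: "pot (\<lambda>x. P x + ennreal (C / (1 - \<theta>)) * ennreal (min x x0 powr \<beta>)) (\<lambda>x. ennreal (L x))"
  proof (rule pot_patch[OF Pm x0(1) C0])
    fix x assume x: "x \<ge> x0"
    then have xp: "x > 0" using x0 by simp
    have "ennreal (L x) = ennreal c * ennreal ((1 - \<epsilon>) * \<rho> * L x)"
      using rho_pos L_pos[OF xp] assms by (simp add: ennreal_mult[symmetric] c_def)
    then have "T P x + ennreal (L x) = ennreal c * (T (\<lambda>x. ennreal (w x)) x + ennreal ((1 - \<epsilon>) * \<rho> * L x))"
      unfolding TP distrib_left by (rule arg_cong)
    also have "\<dots> \<le> P x" unfolding P_def using x0(2)[of x] x by (intro mult_left_mono) auto
    finally show "T P x + ennreal (L x) \<le> P x" .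
  next
    fix x assume x: "0 < x" "x < x0"
    have "L x \<le> x powr \<alpha>" using G_le_1[of x] by (simp add: L_eq mult_left_le)
    also have "\<dots> = x powr (\<alpha> - \<beta>) * x powr \<beta>" by (simp add: powr_add[symmetric])
    also have "\<dots> \<le> x0 powr (\<alpha> - \<beta>) * x powr \<beta>" using x beta by (intro mult_right_mono powr_mono2) auto
    finally have "T P x + ennreal (L x) \<le> ennreal c * ennreal (Cw * x powr \<beta>) + ennreal (x0 powr (\<alpha> - \<beta>) * x powr \<beta>)"
      unfolding TP using T_w_le[OF x(1)] by (intro add_mono mult_left_mono ennreal_leI) auto
    also have "\<dots> = ennreal (C * x powr \<beta>)" using c Cw
      by (simp add: C_def ennreal_mult[symmetric] ennreal_plus[symmetric] algebra_simps del: ennreal_plus)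
    finally show "T P x + ennreal (L x) \<le> ennreal (C * x powr \<beta>)" .
  qed
  have "P x + ennreal (C / (1 - \<theta>)) * ennreal (min x x0 powr \<beta>) \<le> ennreal (w x / ((1 - \<epsilon>) * \<rho>)) + ennreal (C / (1 - \<theta>) * x0 powr \<beta>)"
    if "x > 0" for x
  proof (rule add_mono)
    show "P x \<le> ennreal (w x / ((1 - \<epsilon>) * \<rho>))"
      using c w_nonneg by (simp add: P_def c_def ennreal_mult[symmetric])
    show "ennreal (C / (1 - \<theta>)) * ennreal (min x x0 powr \<beta>) \<le> ennreal (C / (1 - \<theta>) * x0 powr \<beta>)"
    proof -
      have "C / (1 - \<theta>) * min x x0 powr \<beta> \<le> C / (1 - \<theta>) * x0 powr \<beta>"
        using C0 theta that x0(1) beta by (intro mult_left_mono powr_mono2) auto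
      then show ?thesis using C0 theta by (subst ennreal_mult[symmetric]) (auto intro!: ennreal_leI)
    qed
  qed
  with * C0 theta show ?thesis
    by (intro exI[of _ "C / (1 - \<theta>) * x0 powr \<beta>"] conjI exI[of _ "\<lambda>x. P x + ennreal (C / (1 - \<theta>)) * ennreal (min x x0 powr \<beta>)"]) auto
qed

text \<open>\<open>pot_mix\<close> with \<open>\<gamma> = \<alpha> - s\<close> and cut-off
  \<open>2 * V\<close>. The exponents of the power of \<open>U\<close> and of the cut-off add up to
  \<alpha>, so the supersolution is bounded by a multiple of the mixed moment in \<open>fin\<close>,
  uniformly in \<open>x\<close>.\<close>

lemma pot_pair:
  assumes S: "sigma_finite_measure S" and [measurable]: "U \<in> borel_measurable S" "V \<in> borel_measurable S"
    and nn: "\<And>i. U i \<ge> 0" "\<And>i. V i \<ge> 0" and s: "0 < s" "s < \<alpha>" and K: "K \<ge> 0"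
    and fin: "(\<integral>\<^sup>+i. ennreal (U i powr s * V i powr (\<alpha> - s)) \<partial>S) < \<infinity>"
  shows "\<exists>C\<ge>0. \<exists>P. pot P (\<lambda>x. \<integral>\<^sup>+i. ennreal ((K * U i) powr s) * (ennreal (x powr (\<alpha> - s)) * indicator {x..} (2 * V i)) \<partial>S)
     \<and> (\<forall>x>0. P x \<le> ennreal C)"
proof -
  define c where "c = 1 / (1 - \<phi> s)"
  have c: "c > 0" using phi_less_1[OF s] by (simp add: c_def)
  have "1 - \<phi> s > 0" using phi_less_1[OF s] by simp
  then have one: "ennreal c * ennreal (1 - \<phi> s) = 1" by (simp add: c_def ennreal_mult[symmetric])
  define P where "P x = ennreal c * (\<integral>\<^sup>+i. ennreal ((K * U i) powr s) * ennreal (min x (2 * V i) powr (\<alpha> - s)) \<partial>S)" for x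
  have "pot P (\<lambda>x. ennreal c * (ennreal (1 - \<phi> (\<alpha> - (\<alpha> - s))) * (\<integral>\<^sup>+i. ennreal ((K * U i) powr s) * (ennreal (x powr (\<alpha> - s)) * indicator {x..} (2 * V i)) \<partial>S)))"
    unfolding P_def using nn s by (intro pot_cmult pot_mix[OF S]) auto
  then have P: "pot P (\<lambda>x. \<integral>\<^sup>+i. ennreal ((K * U i) powr s) * (ennreal (x powr (\<alpha> - s)) * indicator {x..} (2 * V i)) \<partial>S)"
    by (simp add: mult.assoc[symmetric] one)
  define I where "I = (\<integral>\<^sup>+i. ennreal (U i powr s * V i powr (\<alpha> - s)) \<partial>S)"
  have Pb: "P x \<le> ennreal c * (ennreal (K powr s * 2 powr (\<alpha> - s)) * I)" if "x > 0" for x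
    unfolding P_def
  proof (rule mult_left_mono)
    have "(\<integral>\<^sup>+i. ennreal ((K * U i) powr s) * ennreal (min x (2 * V i) powr (\<alpha> - s)) \<partial>S)
      \<le> (\<integral>\<^sup>+i. ennreal (K powr s * 2 powr (\<alpha> - s)) * ennreal (U i powr s * V i powr (\<alpha> - s)) \<partial>S)"
    proof (rule nn_integral_mono)
      fix i
      have "(K * U i) powr s * min x (2 * V i) powr (\<alpha> - s) \<le> (K * U i) powr s * (2 * V i) powr (\<alpha> - s)"
        using nn[of i] that s by (intro mult_left_mono powr_mono2) auto
      also have "\<dots> = K powr s * 2 powr (\<alpha> - s) * (U i powr s * V i powr (\<alpha> - s))"
        using nn[of i] K by (simp add: powr_mult)
      finally show "ennreal ((K * U i) powr s) * ennreal (min x (2 * V i) powr (\<alpha> - s))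
        \<le> ennreal (K powr s * 2 powr (\<alpha> - s)) * ennreal (U i powr s * V i powr (\<alpha> - s))"
        by (simp add: ennreal_mult[symmetric] ennreal_leI)
    qed
    also have "\<dots> = ennreal (K powr s * 2 powr (\<alpha> - s)) * I"
      unfolding I_def by (rule nn_integral_cmult) measurable
    finally show "(\<integral>\<^sup>+i. ennreal ((K * U i) powr s) * ennreal (min x (2 * V i) powr (\<alpha> - s)) \<partial>S)
      \<le> ennreal (K powr s * 2 powr (\<alpha> - s)) * I" .
  qed simp
  have "ennreal c * (ennreal (K powr s * 2 powr (\<alpha> - s)) * I) < \<infinity>"
    using fin by (simp add: I_def ennreal_mult_less_top)
  then obtain C where C: "C \<ge> 0" "ennreal c * (ennreal (K powr s * 2 powr (\<alpha> - s)) * I) = ennreal C"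
    by (metis less_top_ennreal infinity_ennreal_def)
  show ?thesis
    by (intro exI[of _ C] exI[of _ P] conjI C(1) P) (use Pb C(2) in auto)
qed

text \<open>The defining inequality of \<open>W\<close> reproduces itself under the recursion, while
  the remaining power is multiplied by \<theta> in each step. This takes the place of a uniqueness
  theorem.\<close>

lemma comparison:
  assumes Hm: "\<And>n. Hs n \<in> borel_measurable borel"
    and step: "\<And>n x. x > 0 \<Longrightarrow> Hs (Suc n) x \<le> T (Hs n) x + s x"
    and W: "pot W s" and C: "C \<ge> 0" and base: "\<And>x. x > 0 \<Longrightarrow> Hs 0 x \<le> ennreal (C * x powr \<beta>)" and x: "x > 0"
  shows "Hs n x \<le> W x + ennreal (C * \<theta> ^ n * x powr \<beta>)"
  using x
proof (induction n arbitrary: x)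
  case 0
  then show ?case using base[of x] by (simp add: add_increasing)
next
  case (Suc n)
  have [measurable]: "W \<in> borel_measurable borel" using W by (simp add: pot_def)
  have "Hs (Suc n) x \<le> T (Hs n) x + s x" using step Suc by simp
  also have "T (Hs n) x \<le> T (\<lambda>x. W x + ennreal (C * \<theta> ^ n * x powr \<beta>)) x"
    by (rule T_mono[OF Suc.IH Suc.prems])
  also have "\<dots> = T W x + ennreal (C * \<theta> ^ n * \<theta> * x powr \<beta>)"
    using C theta Suc.prems by (subst T_add) (auto simp: T_powr_beta)
  also have "\<dots> + s x = (T W x + s x) + ennreal (C * \<theta> ^ Suc n * x powr \<beta>)" by (simp add: ac_simps)
  also have "\<dots> \<le> W x + ennreal (C * \<theta> ^ Suc n * x powr \<beta>)"
    using W Suc.prems by (intro add_right_mono) (auto simp: pot_def)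
  finally show ?case by (auto intro: add_right_mono)
qed

lemma H_le_powr:
  assumes l: "l > 1" and s: "0 < s" and [measurable_cong]: "sets N = sets borel" and x: "x > 0"
  shows "H l N x \<le> ennreal (x powr (\<alpha> - s)) * (\<integral>\<^sup>+z. ennreal (\<bar>z\<bar> powr s) \<partial>N)"
proof -
  have "(\<integral>\<^sup>+z. ennreal (ramp l (z / x)) \<partial>N) \<le> (\<integral>\<^sup>+z. ennreal (1 / x powr s) * ennreal (\<bar>z\<bar> powr s) \<partial>N)"
  proof (rule nn_integral_mono)
    fix z :: real
    have "ramp l (z / x) \<le> (\<bar>z\<bar> / x) powr s"
    proof (cases "z / x \<le> 1")
      case False
      then have "1 \<le> \<bar>z\<bar> / x" using x by (auto simp: field_simps)
      then have "1 \<le> (\<bar>z\<bar> / x) powr s" using s by (intro ge_one_powr_ge_zero) auto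
      then show ?thesis using ramp_bounds[of l "z / x"] by simp
    qed (simp add: ramp_0[OF l])
    then show "ennreal (ramp l (z / x)) \<le> ennreal (1 / x powr s) * ennreal (\<bar>z\<bar> powr s)"
      using x by (simp add: ennreal_mult[symmetric] powr_divide ennreal_leI)
  qed
  also have "\<dots> = ennreal (1 / x powr s) * (\<integral>\<^sup>+z. ennreal (\<bar>z\<bar> powr s) \<partial>N)"
    by (rule nn_integral_cmult) measurable
  finally have "H l N x \<le> ennreal (x powr \<alpha>) * (ennreal (1 / x powr s) * (\<integral>\<^sup>+z. ennreal (\<bar>z\<bar> powr s) \<partial>N))"
    unfolding H_def by (rule mult_left_mono) simp
  also have "\<dots> = ennreal (x powr (\<alpha> - s)) * (\<integral>\<^sup>+z. ennreal (\<bar>z\<bar> powr s) \<partial>N)"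
    using x by (simp add: mult.assoc[symmetric] ennreal_mult[symmetric] powr_diff)
  finally show ?thesis .
qed

text \<open>Stated for a sequence of laws in order to serve twice: for the constant sequence of the
  stationary law and for the decreasing iterates in the lower bound. Domination by
  \<open>N 0\<close> makes the sources independent of \<open>n\<close>, so that one supersolution
  handles all steps.\<close>

lemma upper_bound:
  assumes prob: "\<And>n. prob_space (N n)" and sets [measurable_cong]: "\<And>n. sets (N n) = sets borel"
    and step: "\<And>n. st_le (N (Suc n)) (aff (N n))" and dom: "\<And>n. st_le (N n) (N 0)"
    and mom: "\<And>s. 0 < s \<Longrightarrow> s < \<alpha> \<Longrightarrow> (\<integral>\<^sup>+z. ennreal (\<bar>z\<bar> powr s) \<partial>N 0) < \<infinity>"
    and l: "l > 1" and \<epsilon>: "\<epsilon> > 0" "\<epsilon> < 1"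
  shows "\<exists>C\<ge>0. \<forall>n. \<forall>x>0. H l (N n) x \<le> ennreal (w x / ((1 - \<epsilon>) * \<rho>)) + ennreal C + ennreal (C * \<theta> ^ n * x powr \<beta>)"
proof -
  interpret N: prob_space "N n" for n by (rule prob)
  interpret NM: pair_prob_space "N n" M for n ..
  obtain \<eta> where \<eta>: "0 < \<eta>" "\<eta> < \<alpha>" "\<eta> \<le> 1" and mixed: "integrable M (\<lambda>\<omega>. A \<omega> powr \<eta> * max (Y \<omega>) 0 powr (\<alpha> - \<eta>))"
    using mixed_moment by auto
  \<comment> \<open>The ramp estimate needs \<open>s \<le> 1\<close>. The moment
    E[A^(\<alpha>-s) Y_+^s] needs \<open>\<alpha> - s \<ge> \<eta>\<close>, from where on
    interpolation with E[A^\<alpha>] makes it finite.\<close>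
  define s where "s = min 1 (\<alpha> - \<eta>)"
  have s: "0 < s" "s \<le> 1" "s < \<alpha>" "\<alpha> - s \<ge> \<eta>" using \<eta> by (auto simp: s_def)
  define K where "K = 1 / (l - 1)"
  have K: "K \<ge> 0" using l by (simp add: K_def)
  define U where "U p = max 0 (Y (snd p))" for p :: "real \<times> 'a"
  define V where "V p = A (snd p) * max 0 (fst p)" for p :: "real \<times> 'a"
  have UV: "U p \<ge> 0" "V p \<ge> 0" for p using A_nonneg by (auto simp: U_def V_def)
  have [measurable]: "U \<in> borel_measurable (N n \<Otimes>\<^sub>M M)" "V \<in> borel_measurable (N n \<Otimes>\<^sub>M M)" for n
    unfolding U_def V_def by measurable
  have mom': "(\<integral>\<^sup>+z. ennreal (max 0 z powr t) \<partial>N 0) < \<infinity>" if "0 < t" "t < \<alpha>" for t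
  proof -
    have "(\<integral>\<^sup>+z. ennreal (max 0 z powr t) \<partial>N 0) \<le> (\<integral>\<^sup>+z. ennreal (\<bar>z\<bar> powr t) \<partial>N 0)"
      using that by (intro nn_integral_mono ennreal_leI powr_mono2) auto
    with mom[OF that] show ?thesis by (rule le_less_trans[rotated])
  qed
  \<comment> \<open>Interpolation: where \<open>y \<le> A\<close> the product is at most A^\<alpha>,
    and elsewhere the surplus power A^(t-\<eta>) is at most y^(t-\<eta>).\<close>
  have fin_mixed: "(\<integral>\<^sup>+\<omega>. ennreal (A \<omega> powr t * max 0 (Y \<omega>) powr (\<alpha> - t)) \<partial>M) < \<infinity>" if t: "\<eta> \<le> t" "t < \<alpha>" for t
  proof -
    have int: "integrable M (\<lambda>\<omega>. A \<omega> powr \<alpha> + A \<omega> powr \<eta> * max (Y \<omega>) 0 powr (\<alpha> - \<eta>))"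
      using A_int mixed by auto
    have "(\<integral>\<^sup>+\<omega>. ennreal (A \<omega> powr t * max 0 (Y \<omega>) powr (\<alpha> - t)) \<partial>M)
      \<le> (\<integral>\<^sup>+\<omega>. ennreal (A \<omega> powr \<alpha> + A \<omega> powr \<eta> * max (Y \<omega>) 0 powr (\<alpha> - \<eta>)) \<partial>M)"
    proof (intro nn_integral_mono ennreal_leI)
      fix \<omega>
      define y where "y = max 0 (Y \<omega>)"
      have y: "y \<ge> 0" "max (Y \<omega>) 0 = y" by (auto simp: y_def)
      note A0 = A_nonneg[of \<omega>]
      have "A \<omega> powr t * y powr (\<alpha> - t) \<le> A \<omega> powr \<alpha> + A \<omega> powr \<eta> * y powr (\<alpha> - \<eta>)"
      proof (cases "y \<le> A \<omega>")
        case True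
        then have "A \<omega> powr t * y powr (\<alpha> - t) \<le> A \<omega> powr t * A \<omega> powr (\<alpha> - t)"
          using y t by (intro mult_left_mono powr_mono2) auto
        also have "\<dots> = A \<omega> powr \<alpha>" by (simp add: powr_add[symmetric])
        finally show ?thesis using y by (simp add: add_increasing2)
      next
        case False
        have "A \<omega> powr t * y powr (\<alpha> - t) = A \<omega> powr \<eta> * A \<omega> powr (t - \<eta>) * y powr (\<alpha> - t)"
          by (simp add: powr_add[symmetric])
        also have "\<dots> \<le> A \<omega> powr \<eta> * y powr (t - \<eta>) * y powr (\<alpha> - t)"
          using False A0 t by (intro mult_right_mono mult_left_mono powr_mono2) auto
        also have "\<dots> = A \<omega> powr \<eta> * y powr (\<alpha> - \<eta>)" by (simp add: powr_add[symmetric] mult.assoc)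
        finally show ?thesis by (simp add: add_increasing)
      qed
      then show "A \<omega> powr t * max 0 (Y \<omega>) powr (\<alpha> - t) \<le> A \<omega> powr \<alpha> + A \<omega> powr \<eta> * max (Y \<omega>) 0 powr (\<alpha> - \<eta>)"
        unfolding y(2) y_def .
    qed
    also have "\<dots> < \<infinity>" using nn_integral_eq_integral[OF int] by simp
    finally show ?thesis .
  qed
  have fin1: "(\<integral>\<^sup>+p. ennreal (U p powr s * V p powr (\<alpha> - s)) \<partial>(N 0 \<Otimes>\<^sub>M M)) < \<infinity>"
  proof -
    have "(\<integral>\<^sup>+p. ennreal (U p powr s * V p powr (\<alpha> - s)) \<partial>(N 0 \<Otimes>\<^sub>M M))
      = (\<integral>\<^sup>+p. ennreal (max 0 (fst p) powr (\<alpha> - s)) * ennreal (A (snd p) powr (\<alpha> - s) * max 0 (Y (snd p)) powr s) \<partial>(N 0 \<Otimes>\<^sub>M M))"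
      using A_nonneg by (intro nn_integral_cong) (auto simp: U_def V_def powr_mult ennreal_mult[symmetric] mult_ac)
    also have "\<dots> = (\<integral>\<^sup>+z. ennreal (max 0 z powr (\<alpha> - s)) \<partial>N 0) * (\<integral>\<^sup>+\<omega>. ennreal (A \<omega> powr (\<alpha> - s) * max 0 (Y \<omega>) powr s) \<partial>M)"
      by (rule nn_integral_pair_mult[OF prob]) measurable
    also have "\<dots> < \<infinity>" using mom'[of "\<alpha> - s"] fin_mixed[of "\<alpha> - s"] s by (simp add: ennreal_mult_less_top)
    finally show ?thesis .
  qed
  have fin2: "(\<integral>\<^sup>+p. ennreal (V p powr \<eta> * U p powr (\<alpha> - \<eta>)) \<partial>(N 0 \<Otimes>\<^sub>M M)) < \<infinity>"
  proof -
    have "(\<integral>\<^sup>+p. ennreal (V p powr \<eta> * U p powr (\<alpha> - \<eta>)) \<partial>(N 0 \<Otimes>\<^sub>M M))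
      = (\<integral>\<^sup>+p. ennreal (max 0 (fst p) powr \<eta>) * ennreal (A (snd p) powr \<eta> * max 0 (Y (snd p)) powr (\<alpha> - \<eta>)) \<partial>(N 0 \<Otimes>\<^sub>M M))"
      using A_nonneg by (intro nn_integral_cong) (auto simp: U_def V_def powr_mult ennreal_mult[symmetric] mult_ac)
    also have "\<dots> = (\<integral>\<^sup>+z. ennreal (max 0 z powr \<eta>) \<partial>N 0) * (\<integral>\<^sup>+\<omega>. ennreal (A \<omega> powr \<eta> * max 0 (Y \<omega>) powr (\<alpha> - \<eta>)) \<partial>M)"
      by (rule nn_integral_pair_mult[OF prob]) measurable
    also have "\<dots> < \<infinity>" using mom'[of "\<eta>"] fin_mixed[of "\<eta>"] \<eta> by (simp add: ennreal_mult_less_top)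
    finally show ?thesis .
  qed
  \<comment> \<open>\<open>R1\<close> is the cost of perturbing a large \<open>A * z\<close> by
    \<open>Y\<close>, and \<open>R2\<close> the cost of perturbing a large \<open>Y\<close> by
    \<open>A * z\<close>.\<close>
  define R1 where "R1 n x = (\<integral>\<^sup>+p. ennreal ((K * U p) powr s) * (ennreal (x powr (\<alpha> - s)) * indicator {x..} (2 * V p)) \<partial>(N n \<Otimes>\<^sub>M M))" for n x
  define R2 where "R2 n x = (\<integral>\<^sup>+p. ennreal ((K * V p) powr \<eta>) * (ennreal (x powr (\<alpha> - \<eta>)) * indicator {x..} (2 * U p)) \<partial>(N n \<Otimes>\<^sub>M M))" for n x
  have sf: "sigma_finite_measure (N 0 \<Otimes>\<^sub>M M)" ..
  obtain C1 P1 where C1: "C1 \<ge> 0" "pot P1 (R1 0)" "\<And>x. x > 0 \<Longrightarrow> P1 x \<le> ennreal C1"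
    using pot_pair[OF sf _ _ UV s(1,3) K fin1] unfolding R1_def by auto
  obtain C2 P2 where C2: "C2 \<ge> 0" "pot P2 (R2 0)" "\<And>x. x > 0 \<Longrightarrow> P2 x \<le> ennreal C2"
    using pot_pair[OF sf _ _ UV(2,1) \<eta>(1,2) K fin2] unfolding R2_def by auto
  obtain C3 P3 where C3: "C3 \<ge> 0" "pot P3 (\<lambda>x. ennreal (L x))" "\<And>x. x > 0 \<Longrightarrow> P3 x \<le> ennreal (w x / ((1 - \<epsilon>) * \<rho>)) + ennreal C3"
    using pot_L[OF \<epsilon>] by auto
  have W: "pot (\<lambda>x. P3 x + (P1 x + P2 x)) (\<lambda>x. ennreal (L x) + (R1 0 x + R2 0 x))"
    by (intro pot_add C1 C2 C3)
  have V_mono: "z \<le> z' \<Longrightarrow> V (z, \<omega>) \<le> V (z', \<omega>)" for z z' \<omega>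
    using A_nonneg[of \<omega>] by (auto simp: V_def intro!: mult_left_mono)
  \<comment> \<open>The integrand depends on \<open>z\<close> monotonically through
    \<open>V\<close>, so the stochastically largest law \<open>N 0\<close> has the largest
    source.\<close>
  have R1_mono: "R1 n x \<le> R1 0 x" for n x
    unfolding R1_def
  proof (rule st_le_pair[OF dom sets sets])
    fix z z' :: real and \<omega> assume "z \<le> z'"
    then show "ennreal ((K * U (z, \<omega>)) powr s) * (ennreal (x powr (\<alpha> - s)) * indicator {x..} (2 * V (z, \<omega>)))
      \<le> ennreal ((K * U (z', \<omega>)) powr s) * (ennreal (x powr (\<alpha> - s)) * indicator {x..} (2 * V (z', \<omega>)))"
      using V_mono[of z z' \<omega>] by (auto simp: indicator_def U_def)
  qed (unfold U_def V_def, measurable)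
  have R2_mono: "R2 n x \<le> R2 0 x" for n x
    unfolding R2_def
  proof (rule st_le_pair[OF dom sets sets])
    fix z z' :: real and \<omega> assume "z \<le> z'"
    then have "(K * V (z, \<omega>)) powr \<eta> \<le> (K * V (z', \<omega>)) powr \<eta>"
      using K UV \<eta> V_mono by (intro powr_mono2 mult_left_mono) auto
    then show "ennreal ((K * V (z, \<omega>)) powr \<eta>) * (ennreal (x powr (\<alpha> - \<eta>)) * indicator {x..} (2 * U (z, \<omega>)))
      \<le> ennreal ((K * V (z', \<omega>)) powr \<eta>) * (ennreal (x powr (\<alpha> - \<eta>)) * indicator {x..} (2 * U (z', \<omega>)))"
      by (auto simp: indicator_def U_def intro!: mult_right_mono ennreal_leI)
  qed (unfold U_def V_def, measurable)
  have rec: "H l (N (Suc n)) x \<le> T (H l (N n)) x + (ennreal (L x) + (R1 0 x + R2 0 x))" if x: "x > 0" for n x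
  proof -
    have "mono (\<lambda>z. ennreal (ramp l (z / x)))" using l x by (intro monoI ennreal_leI ramp_mono divide_right_mono) auto
    then have "(\<integral>\<^sup>+z. ennreal (ramp l (z / x)) \<partial>N (Suc n)) \<le> (\<integral>\<^sup>+z. ennreal (ramp l (z / x)) \<partial>aff (N n))"
      by (intro st_leD[OF step]) measurable
    also have "\<dots> = (\<integral>\<^sup>+z. \<integral>\<^sup>+\<omega>. ennreal (ramp l ((A \<omega> * z + Y \<omega>) / x)) \<partial>M \<partial>N n)"
      by (rule nn_aff) (auto simp: sets)
    also have "\<dots> = (\<integral>\<^sup>+p. ennreal (ramp l ((A (snd p) * fst p + Y (snd p)) / x)) \<partial>(N n \<Otimes>\<^sub>M M))"
      by (subst nn_integral_fst[symmetric]) auto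
    finally have "H l (N (Suc n)) x \<le> ennreal (x powr \<alpha>) * (\<integral>\<^sup>+p. ennreal (ramp l ((A (snd p) * fst p + Y (snd p)) / x)) \<partial>(N n \<Otimes>\<^sub>M M))"
      unfolding H_def by (rule mult_left_mono) simp
    also have "\<dots> = (\<integral>\<^sup>+p. ennreal (x powr \<alpha>) * ennreal (ramp l ((A (snd p) * fst p + Y (snd p)) / x)) \<partial>(N n \<Otimes>\<^sub>M M))"
      by (rule nn_integral_cmult[symmetric]) measurable
    also have "\<dots> \<le> (\<integral>\<^sup>+p. ennreal (x powr \<alpha>) * ennreal (ramp l (A (snd p) * fst p / x))
       + (ennreal (x powr \<alpha>) * indicator {x<..} (Y (snd p))
       + (ennreal ((K * U p) powr s) * (ennreal (x powr (\<alpha> - s)) * indicator {x..} (2 * V p))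
       + ennreal ((K * V p) powr \<eta>) * (ennreal (x powr (\<alpha> - \<eta>)) * indicator {x..} (2 * U p)))) \<partial>(N n \<Otimes>\<^sub>M M))"
    proof (rule nn_integral_mono)
      fix p :: "real \<times> 'a"
      let ?a = "A (snd p) * fst p / x" and ?y = "Y (snd p) / x"
      have xs: "x powr \<alpha> = x powr s * x powr (\<alpha> - s)" "x powr \<alpha> = x powr \<eta> * x powr (\<alpha> - \<eta>)"
        by (simp_all add: powr_add[symmetric])
      have eU: "max 0 ?y = U p / x" using x by (auto simp: U_def max_def field_simps)
      have eV: "max 0 ?a = V p / x" using x A_nonneg[of "snd p"]
        by (auto simp: V_def max_def field_simps mult_le_0_iff zero_le_mult_iff)
      have Up: "max 0 ?y / (l - 1) = K * U p / x" "x \<le> 2 * U p \<longleftrightarrow> 1 \<le> 2 * max 0 ?y"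
        unfolding eU K_def using x by (auto simp: pos_le_divide_eq)
      have Vp: "max 0 ?a / (l - 1) = K * V p / x" "x \<le> 2 * V p \<longleftrightarrow> 1 \<le> 2 * max 0 ?a"
        unfolding eV K_def using x by (auto simp: pos_le_divide_eq)
      have "ramp l ((A (snd p) * fst p + Y (snd p)) / x) \<le> ramp l ?a + ramp l ?y
         + (max 0 ?y / (l - 1)) powr s * indicator {1..} (2 * max 0 ?a)
         + (max 0 ?a / (l - 1)) powr \<eta> * indicator {1..} (2 * max 0 ?y)"
        unfolding add_divide_distrib by (rule ramp_subadd[OF l s(1,2) \<eta>(1,3)])
      also have "ramp l ?y \<le> indicator {x<..} (Y (snd p))"
        using x ramp_bounds[of l ?y] ramp_0[OF l, of ?y] by (auto simp: indicator_def)
      also have "(max 0 ?y / (l - 1)) powr s * indicator {1..} (2 * max 0 ?a) = (K * U p / x) powr s * indicator {x..} (2 * V p)"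
        using Vp(2) by (simp add: Up(1) indicator_def)
      also have "(max 0 ?a / (l - 1)) powr \<eta> * indicator {1..} (2 * max 0 ?y) = (K * V p / x) powr \<eta> * indicator {x..} (2 * U p)"
        using Up(2) by (simp add: Vp(1) indicator_def)
      finally have le: "ramp l ((A (snd p) * fst p + Y (snd p)) / x) \<le> ramp l ?a + indicator {x<..} (Y (snd p))
        + (K * U p / x) powr s * indicator {x..} (2 * V p) + (K * V p / x) powr \<eta> * indicator {x..} (2 * U p)"
        by (simp add: add_mono)
      have "x powr \<alpha> * ramp l ((A (snd p) * fst p + Y (snd p)) / x) \<le> x powr \<alpha> * (ramp l ?a + indicator {x<..} (Y (snd p))
        + (K * U p / x) powr s * indicator {x..} (2 * V p) + (K * V p / x) powr \<eta> * indicator {x..} (2 * U p))"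
        by (intro mult_left_mono le) simp
      also have "\<dots> = x powr \<alpha> * ramp l ?a + (x powr \<alpha> * indicator {x<..} (Y (snd p))
        + ((K * U p) powr s * (x powr (\<alpha> - s) * indicator {x..} (2 * V p)) + (K * V p) powr \<eta> * (x powr (\<alpha> - \<eta>) * indicator {x..} (2 * U p))))"
      proof -
        have "x powr \<alpha> * (K * U p / x) powr s = (K * U p) powr s * x powr (\<alpha> - s)"
          unfolding xs(1) using x K UV[of p] by (simp add: powr_divide)
        moreover have "x powr \<alpha> * (K * V p / x) powr \<eta> = (K * V p) powr \<eta> * x powr (\<alpha> - \<eta>)"
          unfolding xs(2) using x K UV[of p] by (simp add: powr_divide)
        ultimately show ?thesis by (simp add: distrib_left mult.assoc[symmetric])
      qed
      finally have "ennreal (x powr \<alpha> * ramp l ((A (snd p) * fst p + Y (snd p)) / x)) \<le> ennreal \<dots>" by (rule ennreal_leI)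
      then show "ennreal (x powr \<alpha>) * ennreal (ramp l ((A (snd p) * fst p + Y (snd p)) / x))
        \<le> ennreal (x powr \<alpha>) * ennreal (ramp l (A (snd p) * fst p / x))
       + (ennreal (x powr \<alpha>) * indicator {x<..} (Y (snd p))
       + (ennreal ((K * U p) powr s) * (ennreal (x powr (\<alpha> - s)) * indicator {x..} (2 * V p))
       + ennreal ((K * V p) powr \<eta>) * (ennreal (x powr (\<alpha> - \<eta>)) * indicator {x..} (2 * U p))))"
        using ramp_bounds by (simp add: ennreal_mult ennreal_indicator)
    qed
    also have "\<dots> = (\<integral>\<^sup>+p. ennreal (x powr \<alpha>) * ennreal (ramp l (A (snd p) * fst p / x)) \<partial>(N n \<Otimes>\<^sub>M M))
       + ((\<integral>\<^sup>+p. ennreal (x powr \<alpha>) * indicator {x<..} (Y (snd p)) \<partial>(N n \<Otimes>\<^sub>M M)) + (R1 n x + R2 n x))"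
      unfolding R1_def R2_def by (simp add: nn_integral_add)
    also have "(\<integral>\<^sup>+p. ennreal (x powr \<alpha>) * ennreal (ramp l (A (snd p) * fst p / x)) \<partial>(N n \<Otimes>\<^sub>M M)) = T (H l (N n)) x"
      unfolding T_H[OF prob sets l x]
      by (subst nn_integral_cmult, measurable) (subst nn_integral_fst[symmetric], auto)
    also have "(\<integral>\<^sup>+p. ennreal (x powr \<alpha>) * indicator {x<..} (Y (snd p)) \<partial>(N n \<Otimes>\<^sub>M M)) = ennreal (L x)"
      by (subst nn_integral_fst[symmetric]) (auto simp: nn_integral_cmult nn_indicator_Y N.emeasure_space_1)
    also have "T (H l (N n)) x + (ennreal (L x) + (R1 n x + R2 n x)) \<le> T (H l (N n)) x + (ennreal (L x) + (R1 0 x + R2 0 x))"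
      by (intro add_left_mono add_mono R1_mono R2_mono)
    finally show ?thesis .
  qed
  \<comment> \<open>By Markov's inequality a moment of order \<alpha> - \<beta> bounds the smoothed
    tail by a multiple of x^\<beta>, which starts the comparison.\<close>
  obtain m where m: "m \<ge> 0" "(\<integral>\<^sup>+z. ennreal (\<bar>z\<bar> powr (\<alpha> - \<beta>)) \<partial>N 0) = ennreal m"
    using mom[of "\<alpha> - \<beta>"] beta by (cases "(\<integral>\<^sup>+z. ennreal (\<bar>z\<bar> powr (\<alpha> - \<beta>)) \<partial>N 0)") auto
  have base: "H l (N 0) x \<le> ennreal (m * x powr \<beta>)" if "x > 0" for x
    using H_le_powr[OF l _ sets that, of "\<alpha> - \<beta>" 0] beta m by (simp add: ennreal_mult[symmetric] mult.commute)
  define C where "C = C1 + C2 + C3 + m"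
  have "H l (N n) x \<le> ennreal (w x / ((1 - \<epsilon>) * \<rho>)) + ennreal C + ennreal (C * \<theta> ^ n * x powr \<beta>)" if x: "x > 0" for n x
  proof -
    have "H l (N n) x \<le> (P3 x + (P1 x + P2 x)) + ennreal (m * \<theta> ^ n * x powr \<beta>)"
      using comparison[of "\<lambda>n. H l (N n)", OF H_meas[OF prob sets] rec W m(1) base x] .
    also have "\<dots> \<le> (ennreal (w x / ((1 - \<epsilon>) * \<rho>)) + ennreal C3 + (ennreal C1 + ennreal C2)) + ennreal (C * \<theta> ^ n * x powr \<beta>)"
      using C1 C2 C3 m theta x by (intro add_mono ennreal_leI mult_right_mono) (auto simp: C_def)
    also have "ennreal (w x / ((1 - \<epsilon>) * \<rho>)) + ennreal C3 + (ennreal C1 + ennreal C2) = ennreal (w x / ((1 - \<epsilon>) * \<rho>)) + ennreal (C3 + (C1 + C2))"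
      using C1 C2 C3 by (simp add: add.assoc)
    also have "\<dots> \<le> ennreal (w x / ((1 - \<epsilon>) * \<rho>)) + ennreal C" using m by (intro add_left_mono ennreal_leI) (simp add: C_def)
    finally show ?thesis by (simp add: add_right_mono)
  qed
  moreover have "C \<ge> 0" using C1 C2 C3 m by (simp add: C_def)
  ultimately show ?thesis by blast
qed

section \<open>The lower bound\<close>

lemma Y_moment:
  assumes "0 < s" "s < \<alpha>" shows "(\<integral>\<^sup>+\<omega>. ennreal (\<bar>Y \<omega>\<bar> powr s) \<partial>M) < \<infinity>"
proof -
  have "(\<integral>\<^sup>+\<omega>. ennreal (\<bar>Y \<omega>\<bar> powr s) \<partial>M) \<le> (\<integral>\<^sup>+\<omega>. ennreal (max 0 (Y \<omega>) powr s) + ennreal (max (- Y \<omega>) 0 powr s) \<partial>M)"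
    by (intro nn_integral_mono) (auto simp: max_def abs_if)
  also have "\<dots> = (\<integral>\<^sup>+\<omega>. ennreal (max 0 (Y \<omega>) powr s) \<partial>M) + (\<integral>\<^sup>+\<omega>. ennreal (max (- Y \<omega>) 0 powr s) \<partial>M)"
    by (rule nn_integral_add) auto
  also have "\<dots> < \<infinity>"
    using Y_pos_moment[OF assms] nn_integral_eq_integral[OF neg_moment[OF assms]] by simp
  finally show ?thesis .
qed

lemma pot_const_mult_le:
  assumes "pot P s" "c > 0" "\<And>x. x > 0 \<Longrightarrow> s' x \<le> ennreal c * s x"
  shows "pot (\<lambda>x. ennreal c * P x) s'"
  using pot_cmult[OF assms(1), of "ennreal c"] assms(3) by (rule pot_le)

text \<open>No power of \<open>Y\<^sub>-\<close> need be integrable against \<open>A\<^sup>\<alpha>\<close>, but \<open>log\<^sup>+ Y\<^sub>-\<close> always is; this is why the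
  loss caused by large negative values of \<open>Y\<close> is estimated on an exponential grid.\<close>

definition e2 :: "real \<Rightarrow> real \<Rightarrow> ennreal" where
  "e2 K x = (\<integral>\<^sup>+\<omega>. ennreal (min 1 (K * max 0 (- Y \<omega>) / x) * (1 + A \<omega> powr \<alpha>)) \<partial>M)"

text \<open>Summing over the grid turns \<open>min 1 (c / x)\<close> into at most 3 + log^+ c. To
  integrate log^+ c against A^\<alpha>, note that if \<open>c \<le> A\<^sup>2\<close> the logarithm
  is at most \<open>2 * ln A\<close>; otherwise A^\<alpha> is at most c^(\<alpha>/2), and a moment
  of \<open>c\<close> of order below \<alpha> suffices.\<close>

lemma e2_sum:
  assumes K: "K > 0" shows "(\<Sum>j. e2 K (exp (real j))) < \<infinity>"
proof -
  define c where "c \<omega> = K * max 0 (- Y \<omega>)" for \<omega>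
  have [measurable]: "c \<in> borel_measurable M" unfolding c_def by measurable
  have c0: "c \<omega> \<ge> 0" for \<omega> using K by (simp add: c_def)
  \<comment> \<open>A logarithm costs an arbitrarily small power; with \<open>\<alpha> / 4\<close>
    the total order \<open>\<alpha> / 2 + r\<close> stays below \<alpha>.\<close>
  define r where "r = \<alpha> / 4"
  have r: "r > 0" "r < \<alpha>" "\<alpha> / 2 + r > 0" "\<alpha> / 2 + r < \<alpha>" using alpha_pos by (auto simp: r_def)
  have int_c: "integrable M (\<lambda>\<omega>. c \<omega> powr s)" if "0 < s" "s < \<alpha>" for s
  proof -
    have "(\<lambda>\<omega>. c \<omega> powr s) = (\<lambda>\<omega>. K powr s * max (- Y \<omega>) 0 powr s)"
      using K by (auto simp: c_def powr_mult max.commute fun_eq_iff)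
    then show ?thesis using neg_moment[OF that] by simp
  qed
  define g where "g \<omega> = 3 + 3 * A \<omega> powr \<alpha> + c \<omega> powr r / r + 2 * \<bar>A \<omega> powr \<alpha> * ln (A \<omega>)\<bar> + c \<omega> powr (\<alpha> / 2 + r) / r" for \<omega>
  have g: "integrable M g" unfolding g_def
    using A_int A_ln_int int_c r by (intro Bochner_Integration.integrable_add integrable_mult_right integrable_divide integrable_abs) auto
  have bound: "(1 + A \<omega> powr \<alpha>) * (3 + ln (max 1 (c \<omega>))) \<le> g \<omega>" for \<omega>
  proof (cases "c \<omega> \<le> 1")
    case True
    then show ?thesis using r by (simp add: g_def max_def algebra_simps)
  next
    case False
    then have ln_le: "ln (c \<omega>) \<le> c \<omega> powr r / r" "ln (c \<omega>) \<ge> 0" using r by (auto intro: ln_powr_bound)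
    have "A \<omega> powr \<alpha> * ln (c \<omega>) \<le> 2 * \<bar>A \<omega> powr \<alpha> * ln (A \<omega>)\<bar> + c \<omega> powr (\<alpha> / 2 + r) / r"
    proof (cases "c \<omega> \<le> A \<omega> ^ 2")
      case True
      have A0: "A \<omega> > 0" using True False A_nonneg[of \<omega>] by (cases "A \<omega> = 0") auto
      have "ln (c \<omega>) \<le> ln (A \<omega> ^ 2)" using True False A0 by (subst ln_le_cancel_iff) auto
      also have "\<dots> = 2 * ln (A \<omega>)" using A0 by (simp add: ln_realpow)
      finally have "A \<omega> powr \<alpha> * ln (c \<omega>) \<le> A \<omega> powr \<alpha> * (2 * ln (A \<omega>))" by (intro mult_left_mono) auto
      also have "\<dots> \<le> 2 * \<bar>A \<omega> powr \<alpha> * ln (A \<omega>)\<bar>" by simp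
      finally show ?thesis using r by (simp add: add_increasing2)
    next
      case False2: False
      have "A \<omega> powr \<alpha> = (A \<omega> ^ 2) powr (\<alpha> / 2)"
      proof (cases "A \<omega> = 0")
        case False
        then have "A \<omega> ^ 2 = A \<omega> powr 2" using A_nonneg[of \<omega>] by simp
        then have "(A \<omega> ^ 2) powr (\<alpha> / 2) = A \<omega> powr (2 * (\<alpha> / 2))" by (simp only: powr_powr)
        then show ?thesis by simp
      qed simp
      also have "\<dots> \<le> c \<omega> powr (\<alpha> / 2)" using False2 alpha_pos by (intro powr_mono2) auto
      finally have "A \<omega> powr \<alpha> * ln (c \<omega>) \<le> c \<omega> powr (\<alpha> / 2) * (c \<omega> powr r / r)"
        using ln_le by (intro mult_mono) auto
      also have "\<dots> = c \<omega> powr (\<alpha> / 2 + r) / r" by (simp add: powr_add)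
      finally show ?thesis by (simp add: add_increasing)
    qed
    then show ?thesis using ln_le False by (simp add: g_def max_def algebra_simps)
  qed
  have "(\<Sum>j. e2 K (exp (real j))) = (\<integral>\<^sup>+\<omega>. (\<Sum>j. ennreal (min 1 (c \<omega> * exp (- real j)) * (1 + A \<omega> powr \<alpha>))) \<partial>M)"
    unfolding e2_def c_def[symmetric] exp_minus divide_inverse by (rule nn_integral_suminf[symmetric]) measurable
  also have "\<dots> \<le> (\<integral>\<^sup>+\<omega>. ennreal (g \<omega>) \<partial>M)"
  proof (rule nn_integral_mono)
    fix \<omega>
    have "(\<Sum>j. ennreal (min 1 (c \<omega> * exp (- real j)) * (1 + A \<omega> powr \<alpha>)))
      = (\<Sum>j. ennreal (1 + A \<omega> powr \<alpha>) * ennreal (min 1 (c \<omega> * exp (- real j))))"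
      using c0 by (intro suminf_cong) (simp add: ennreal_mult[symmetric] mult.commute del: ennreal_plus)
    also have "\<dots> = ennreal (1 + A \<omega> powr \<alpha>) * (\<Sum>j. ennreal (min 1 (c \<omega> * exp (- real j))))" by simp
    also have "\<dots> \<le> ennreal (1 + A \<omega> powr \<alpha>) * ennreal (3 + ln (max 1 (c \<omega>)))"
      by (intro mult_left_mono suminf_min_exp_le c0) auto
    also have "\<dots> = ennreal ((1 + A \<omega> powr \<alpha>) * (3 + ln (max 1 (c \<omega>))))"
      by (rule ennreal_mult[symmetric]) auto
    also have "\<dots> \<le> ennreal (g \<omega>)" using bound by (rule ennreal_leI)
    finally show "(\<Sum>j. ennreal (min 1 (c \<omega> * exp (- real j)) * (1 + A \<omega> powr \<alpha>))) \<le> ennreal (g \<omega>)" .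
  qed
  also have "\<dots> < \<infinity>"
    using integrableD(2)[OF g] by (simp add: less_top)
  finally show ?thesis .
qed

text \<open>The source created by events where \<open>A * z > x\<close> but a negative
  \<open>Y\<close> destroys the exceedance. The function \<open>w + min _ 1 powr \<beta>\<close>
  stands for the a priori bound on the tails of the iterates; the second summand replaces a constant
  so that the source is O(x^\<beta>) near 0.\<close>

definition E2 :: "real \<Rightarrow> real \<Rightarrow> ennreal" where
  "E2 K x = (\<integral>\<^sup>+\<omega>. ennreal (min 1 (K * max 0 (- Y \<omega>) / x)) * (ennreal (A \<omega> powr \<alpha>) * ennreal (w (x / A \<omega>) + min (x / A \<omega>) 1 powr \<beta>)) \<partial>M)"

text \<open>For \<open>A \<ge> 1\<close> monotonicity of \<open>w\<close> suffices. For
  \<open>A < 1\<close> the Potter bound costs A^(-\<beta>), which the weight A^\<alpha> absorbs.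
  Additive constants are absorbed by \<open>w x \<ge> w 1 > 0\<close>.\<close>

lemma E2_le_e2:
  "\<exists>C>0. \<forall>K>0. \<forall>x\<ge>1. E2 K x \<le> ennreal (C * w x) * e2 K x"
proof -
  obtain Cp where Cp: "Cp > 0" "\<And>x v. x \<ge> 1 \<Longrightarrow> v \<ge> 1 \<Longrightarrow> w (v * x) \<le> Cp * v powr \<beta> * w x"
    using w_potter[OF beta(1)] by blast
  have w1: "w 1 > 0" by (rule w_pos) simp
  define C where "C = Cp + 1 / w 1 + 1"
  have C: "C > 0" using Cp w1 by (simp add: C_def add_pos_pos)
  have "E2 K x \<le> ennreal (C * w x) * e2 K x" if K: "K > 0" and x: "x \<ge> 1" for K x
  proof -
    have wx: "w x \<ge> w 1" using x by (rule w_mono)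
    then have one: "1 \<le> 1 / w 1 * w x" using w1 by simp
    have le: "A \<omega> powr \<alpha> * (w (x / A \<omega>) + min (x / A \<omega>) 1 powr \<beta>) \<le> C * w x * (1 + A \<omega> powr \<alpha>)" for \<omega>
    proof -
      consider "A \<omega> = 0" | "0 < A \<omega>" "A \<omega> < 1" | "1 \<le> A \<omega>" using A_nonneg[of \<omega>] by linarith
      then show ?thesis
      proof cases
        case 1
        then show ?thesis using C w_nonneg by simp
      next
        case 2
        have m1: "min (x / A \<omega>) 1 powr \<beta> \<le> 1"
          using 2 x beta powr_mono2[of \<beta> "min (x / A \<omega>) 1" 1] by (simp add: min_def)
        have A1: "A \<omega> powr \<alpha> \<le> 1" using 2 alpha_pos by (simp add: powr_le1)
        have A2: "A \<omega> powr \<alpha> * (1 / A \<omega>) powr \<beta> \<le> 1"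
        proof -
          have "A \<omega> powr \<alpha> * (1 / A \<omega>) powr \<beta> = A \<omega> powr (\<alpha> - \<beta>)" using 2 by (simp add: powr_divide powr_diff)
          then show ?thesis using 2 beta by (simp add: powr_le1)
        qed
        have "w (x / A \<omega>) \<le> Cp * (1 / A \<omega>) powr \<beta> * w x" using Cp(2)[of x "1 / A \<omega>"] x 2 by simp
        then have "A \<omega> powr \<alpha> * (w (x / A \<omega>) + min (x / A \<omega>) 1 powr \<beta>) \<le> A \<omega> powr \<alpha> * (Cp * (1 / A \<omega>) powr \<beta> * w x + 1)"
          using m1 by (intro mult_left_mono add_mono) auto
        also have "\<dots> = Cp * w x * (A \<omega> powr \<alpha> * (1 / A \<omega>) powr \<beta>) + A \<omega> powr \<alpha>" by (simp add: algebra_simps)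
        also have "\<dots> \<le> Cp * w x * 1 + 1" using A1 A2 Cp w_nonneg by (intro add_mono mult_left_mono) auto
        also have "\<dots> \<le> C * w x" using one w_nonneg[of x] by (simp add: C_def algebra_simps)
        also have "\<dots> * 1 \<le> C * w x * (1 + A \<omega> powr \<alpha>)" using C w_nonneg by (intro mult_left_mono) auto
        finally show ?thesis by simp
      next
        case 3
        have "w (x / A \<omega>) \<le> w x" using 3 x by (intro w_mono) (simp add: field_simps)
        moreover have "min (x / A \<omega>) 1 powr \<beta> \<le> 1"
          using 3 x beta powr_mono2[of \<beta> "min (x / A \<omega>) 1" 1] by (simp add: min_def)
        ultimately have "A \<omega> powr \<alpha> * (w (x / A \<omega>) + min (x / A \<omega>) 1 powr \<beta>) \<le> A \<omega> powr \<alpha> * (w x + 1)"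
          by (intro mult_left_mono add_mono) auto
        also have "\<dots> \<le> A \<omega> powr \<alpha> * (C * w x)"
        proof (rule mult_left_mono)
          have "w x + 1 \<le> w x + 1 / w 1 * w x" using one by simp
          also have "\<dots> \<le> C * w x" using Cp w_nonneg[of x] by (simp add: C_def algebra_simps)
          finally show "w x + 1 \<le> C * w x" .
        qed simp
        also have "\<dots> \<le> C * w x * (1 + A \<omega> powr \<alpha>)" using C w_nonneg[of x] by (simp add: algebra_simps)
        finally show ?thesis .
      qed
    qed
    have "E2 K x \<le> (\<integral>\<^sup>+\<omega>. ennreal (C * w x) * ennreal (min 1 (K * max 0 (- Y \<omega>) / x) * (1 + A \<omega> powr \<alpha>)) \<partial>M)"
      unfolding E2_def
    proof (rule nn_integral_mono)
      fix \<omega>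
      let ?m = "min 1 (K * max 0 (- Y \<omega>) / x)"
      have m: "?m \<ge> 0" using K x by simp
      have "?m * (A \<omega> powr \<alpha> * (w (x / A \<omega>) + min (x / A \<omega>) 1 powr \<beta>)) \<le> ?m * (C * w x * (1 + A \<omega> powr \<alpha>))"
        by (rule mult_left_mono[OF le m])
      then have "ennreal (?m * (A \<omega> powr \<alpha> * (w (x / A \<omega>) + min (x / A \<omega>) 1 powr \<beta>))) \<le> ennreal (C * w x * (?m * (1 + A \<omega> powr \<alpha>)))"
        by (intro ennreal_leI) (simp add: mult_ac)
      then show "ennreal ?m * (ennreal (A \<omega> powr \<alpha>) * ennreal (w (x / A \<omega>) + min (x / A \<omega>) 1 powr \<beta>))
        \<le> ennreal (C * w x) * ennreal (?m * (1 + A \<omega> powr \<alpha>))"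
        using m C w_nonneg by (simp add: ennreal_mult[symmetric] del: ennreal_plus)
    qed
    also have "\<dots> = ennreal (C * w x) * e2 K x"
      unfolding e2_def by (rule nn_integral_cmult) measurable
    finally show ?thesis .
  qed
  with C show ?thesis by blast
qed

lemma e2_antimono: "0 < x \<Longrightarrow> x \<le> y \<Longrightarrow> K > 0 \<Longrightarrow> e2 K y \<le> e2 K x"
  unfolding e2_def by (intro nn_integral_mono ennreal_leI mult_right_mono min.mono order.refl divide_left_mono) auto

lemma E2_small: "K > 0 \<Longrightarrow> x > 0 \<Longrightarrow> E2 K x \<le> ennreal ((Cw + 1) * x powr \<beta>)"
proof -
  assume K: "K > 0" and x: "x > 0"
  have "E2 K x \<le> T (\<lambda>x. ennreal ((Cw + 1) * x powr \<beta>)) x"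
    unfolding E2_def T_def
  proof (rule nn_integral_mono)
    fix \<omega>
    show "ennreal (min 1 (K * max 0 (- Y \<omega>) / x)) * (ennreal (A \<omega> powr \<alpha>) * ennreal (w (x / A \<omega>) + min (x / A \<omega>) 1 powr \<beta>))
      \<le> ennreal (A \<omega> powr \<alpha>) * ennreal ((Cw + 1) * (x / A \<omega>) powr \<beta>)"
    proof (cases "A \<omega> = 0")
      case False
      then have u: "x / A \<omega> > 0" using A_nonneg[of \<omega>] x by simp
      have "w (x / A \<omega>) + min (x / A \<omega>) 1 powr \<beta> \<le> Cw * (x / A \<omega>) powr \<beta> + (x / A \<omega>) powr \<beta>"
        using u beta by (intro add_mono Cw powr_mono2) auto
      then have "ennreal (w (x / A \<omega>) + min (x / A \<omega>) 1 powr \<beta>) \<le> ennreal ((Cw + 1) * (x / A \<omega>) powr \<beta>)"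
        by (intro ennreal_leI) (simp add: algebra_simps)
      then have "ennreal (min 1 (K * max 0 (- Y \<omega>) / x)) * (ennreal (A \<omega> powr \<alpha>) * ennreal (w (x / A \<omega>) + min (x / A \<omega>) 1 powr \<beta>))
        \<le> 1 * (ennreal (A \<omega> powr \<alpha>) * ennreal ((Cw + 1) * (x / A \<omega>) powr \<beta>))"
        by (intro mult_mono mult_left_mono) (auto simp: ennreal_le_1)
      then show ?thesis by simp
    qed simp
  qed
  also have "\<dots> = ennreal ((Cw + 1) * \<theta> * x powr \<beta>)" using Cw(1) x by (intro T_powr_beta) auto
  also have "\<dots> \<le> ennreal ((Cw + 1) * x powr \<beta>)" using theta Cw(1)
    by (intro ennreal_leI mult_right_mono) (auto simp: mult_left_le)
  finally show ?thesis .
qed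

text \<open>On each cell of an exponential grid the source is compared with x^\<beta> up to the
  right end of the cell, with weight \<open>e j\<close>. The pieces of the resulting supersolution
  are \<open>O(w x + 1)\<close> uniformly in \<open>j\<close>, and each is bounded by itself. As the
  weights are summable, a remote tail of the series costs at most a small multiple of
  \<open>w\<close>, and the finitely many remaining pieces cost a constant.\<close>

lemma pot_E2:
  assumes K: "K > 0" and \<delta>: "\<delta> > 0"
  shows "\<exists>C\<ge>0. \<exists>P. pot P (E2 K) \<and> (\<forall>x>0. P x \<le> ennreal (\<delta> * w x + C))"
proof -
  obtain C2 where C2: "C2 > 0" "\<And>x. x \<ge> 1 \<Longrightarrow> E2 K x \<le> ennreal (C2 * w x) * e2 K x"
    using E2_le_e2 K by blast
  obtain Cp where Cp: "Cp > 0" "\<And>x v. x \<ge> 1 \<Longrightarrow> v \<ge> 1 \<Longrightarrow> w (v * x) \<le> Cp * v powr \<beta> * w x"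
    using w_potter[OF beta(1)] by blast
  \<comment> \<open>The supersolution of the cell \<open>j\<close> with its weight
    \<open>e j\<close> removed: it grows like x^\<beta> up to \<open>exp (j + 1)\<close> and
    saturates there at \<open>w (exp (j + 1)) * exp \<beta>\<close>.\<close>
  define t where "t j x = w (exp (real j + 1)) * exp (- real j * \<beta>) * min x (exp (real j + 1)) powr \<beta>" for j :: nat and x :: real
  have t0: "t j x \<ge> 0" for j x using w_nonneg by (simp add: t_def)
  define D where "D = (Cp + 1) * exp \<beta>"
  have D: "D > 0" using Cp by (simp add: D_def add_pos_pos)
  have exp_powr: "exp (real j + 1) powr \<beta> * exp (- real j * \<beta>) = exp \<beta>" for j :: nat
    by (simp add: powr_def exp_add[symmetric] algebra_simps)
  have t_const: "t j x \<le> w (exp (real j + 1)) * exp \<beta>" if "x > 0" for j x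
  proof -
    have "t j x \<le> w (exp (real j + 1)) * exp (- real j * \<beta>) * exp (real j + 1) powr \<beta>"
      unfolding t_def using that beta w_nonneg by (intro mult_left_mono powr_mono2) auto
    also have "\<dots> = w (exp (real j + 1)) * exp \<beta>" using exp_powr[of j] by (simp add: mult_ac)
    finally show ?thesis .
  qed
  have t_w1: "t j x \<le> D * w x" if x: "x \<ge> 1" for j x
  proof (cases "exp (real j + 1) \<le> x")
    case True
    have "t j x \<le> w (exp (real j + 1)) * exp \<beta>" using x by (intro t_const) auto
    also have "\<dots> \<le> w x * exp \<beta>" using True by (intro mult_right_mono w_mono) auto
    also have "\<dots> \<le> D * w x" using Cp w_nonneg[of x] by (simp add: D_def algebra_simps)
    finally show ?thesis .
  next
    case False
    define v where "v = exp (real j + 1) / x"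
    have v: "v \<ge> 1" "exp (real j + 1) = v * x" using False x by (auto simp: v_def)
    have "t j x = w (v * x) * exp (- real j * \<beta>) * x powr \<beta>"
      using False v by (simp add: t_def)
    also have "\<dots> \<le> (Cp * v powr \<beta> * w x) * exp (- real j * \<beta>) * x powr \<beta>"
      using Cp(2)[OF x v(1)] by (intro mult_right_mono) auto
    also have "\<dots> = Cp * w x * (exp (- real j * \<beta>) * (v * x) powr \<beta>)"
      using v x by (simp add: powr_mult mult_ac)
    also have "exp (- real j * \<beta>) * (v * x) powr \<beta> = exp \<beta>" using exp_powr[of j] unfolding v(2) by (simp add: mult.commute)
    also have "Cp * w x * exp \<beta> \<le> D * w x" using w_nonneg[of x] by (simp add: D_def algebra_simps)
    finally show ?thesis .
  qed
  have t_w: "t j x \<le> D * (w x + w 1)" if x: "x > 0" for j x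
  proof (cases "x \<ge> 1")
    case True
    then have "t j x \<le> D * w x" by (rule t_w1)
    also have "\<dots> \<le> D * (w x + w 1)" using D w_nonneg by (intro mult_left_mono) auto
    finally show ?thesis .
  next
    case False
    have "t j x \<le> t j 1" unfolding t_def using False x beta w_nonneg
      by (intro mult_left_mono powr_mono2 min.mono) auto
    also have "\<dots> \<le> D * w 1" by (rule t_w1) simp
    also have "\<dots> \<le> D * (w x + w 1)" using D w_nonneg by (intro mult_left_mono) auto
    finally show ?thesis .
  qed
  define e where "e j = e2 K (exp (real j))" for j :: nat
  define k where "k j = ennreal (C2 / (1 - \<theta>)) * (e j * ennreal (w (exp (real j + 1)) * exp (- real j * \<beta>)))" for j :: nat
  define Q where "Q x = (\<integral>\<^sup>+j. k j * ennreal (min x (exp (real j + 1)) powr \<beta>) \<partial>count_space UNIV)" for x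
  have "pot Q (\<lambda>x. ennreal (1 - \<phi> (\<alpha> - \<beta>)) * (\<integral>\<^sup>+j. k j * (ennreal (x powr \<beta>) * indicator {x..} (exp (real j + 1))) \<partial>count_space UNIV))"
    unfolding Q_def using beta by (intro pot_mix sigma_finite_measure_count_space) auto
  then have Q1: "pot Q (\<lambda>x. if x \<ge> 1 then E2 K x else 0)"
  proof (rule pot_le)
    fix x :: real assume "x > 0"
    show "(if x \<ge> 1 then E2 K x else 0) \<le> ennreal (1 - \<phi> (\<alpha> - \<beta>)) * (\<integral>\<^sup>+j. k j * (ennreal (x powr \<beta>) * indicator {x..} (exp (real j + 1))) \<partial>count_space UNIV)"
    proof (cases "x \<ge> 1")
      case True
      \<comment> \<open>The cell containing \<open>x\<close>. Its summand alone dominates the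
        source, because there \<open>x powr \<beta> * exp (- j * \<beta>) \<ge> 1\<close>.\<close>
      define j where "j = nat \<lfloor>ln x\<rfloor>"
      have j: "real j \<le> ln x" "ln x \<le> real j + 1" using True by (auto simp: j_def)
      have "exp (real j) \<le> exp (ln x)" "exp (ln x) \<le> exp (real j + 1)" using j by (auto simp del: exp_ln exp_ln_iff)
      then have xj: "exp (real j) \<le> x" "x \<le> exp (real j + 1)" using True by auto
      have "E2 K x \<le> ennreal (C2 * w x) * e2 K x" using C2(2) True .
      also have "\<dots> \<le> ennreal (C2 * w (exp (real j + 1))) * e j"
        unfolding e_def using xj C2 K by (intro mult_mono ennreal_leI mult_left_mono w_mono e2_antimono) auto
      also have "\<dots> \<le> ennreal (1 - \<theta>) * (k j * ennreal (x powr \<beta>))"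
      proof -
        have "exp (real j) powr \<beta> = exp (real j * \<beta>)" by (simp add: powr_def mult.commute)
        then have "1 = exp (real j) powr \<beta> * exp (- real j * \<beta>)" by (simp add: exp_minus)
        also have "\<dots> \<le> x powr \<beta> * exp (- real j * \<beta>)" using xj beta by (intro mult_right_mono powr_mono2) auto
        finally have 1: "1 \<le> x powr \<beta> * exp (- real j * \<beta>)" .
        define a b where "a = C2 / (1 - \<theta>)" and "b = w (exp (real j + 1)) * exp (- real j * \<beta>)"
        have ab: "a \<ge> 0" "b \<ge> 0" using theta C2(1) w_nonneg by (auto simp: a_def b_def)
        have kj: "k j = ennreal a * (e j * ennreal b)" by (simp add: k_def a_def b_def)
        have C2a: "C2 = (1 - \<theta>) * a" using theta by (simp add: a_def)
        have "C2 * w (exp (real j + 1)) * 1 \<le> C2 * w (exp (real j + 1)) * (x powr \<beta> * exp (- real j * \<beta>))"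
          using 1 C2(1) w_nonneg by (intro mult_left_mono) auto
        also have "\<dots> = (1 - \<theta>) * (a * (b * x powr \<beta>))"
          unfolding C2a b_def by (simp only: mult_ac)
        finally have "ennreal (C2 * w (exp (real j + 1))) \<le> ennreal ((1 - \<theta>) * (a * (b * x powr \<beta>)))"
          by (intro ennreal_leI) simp
        also have "\<dots> = ennreal (1 - \<theta>) * (ennreal a * (ennreal b * ennreal (x powr \<beta>)))"
          using theta ab by (simp add: ennreal_mult)
        finally have "ennreal (C2 * w (exp (real j + 1))) * e j \<le> ennreal (1 - \<theta>) * (ennreal a * (ennreal b * ennreal (x powr \<beta>))) * e j"
          by (rule mult_right_mono) simp
        also have "\<dots> = ennreal (1 - \<theta>) * (k j * ennreal (x powr \<beta>))"
          unfolding kj by (simp only: mult_ac)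
        finally show ?thesis .
      qed
      also have "k j * ennreal (x powr \<beta>) = k j * (ennreal (x powr \<beta>) * indicator {x..} (exp (real j + 1)))" using xj by simp
      also have "\<dots> \<le> (\<Sum>j. k j * (ennreal (x powr \<beta>) * indicator {x..} (exp (real j + 1))))"
        using sum_le_suminf[of "\<lambda>j. k j * (ennreal (x powr \<beta>) * indicator {x..} (exp (real j + 1)))" "{j}"] by simp
      finally show ?thesis using True by (simp add: nn_integral_count_space_nat \<theta>_def mult_left_mono)
    qed simp
  qed
  have Q2: "pot (\<lambda>x. ennreal ((Cw + 1) / (1 - \<theta>)) * ennreal (min x 1 powr \<beta>)) (\<lambda>x. if x \<ge> 1 then 0 else E2 K x)"
  proof (rule pot_const_mult_le)
    show "pot (\<lambda>x. ennreal (min x 1 powr \<beta>)) (\<lambda>x. ennreal ((1 - \<theta>) * x powr \<beta>) * indicator {..1} x)"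
      unfolding \<theta>_def using beta by (intro pot_min_powr) auto
    show "(Cw + 1) / (1 - \<theta>) > 0" using theta Cw(1) by simp
    fix x :: real assume x: "x > 0"
    have "(Cw + 1) / (1 - \<theta>) * ((1 - \<theta>) * x powr \<beta>) = (Cw + 1) * x powr \<beta>" using theta by simp
    then have "ennreal ((Cw + 1) / (1 - \<theta>)) * ennreal ((1 - \<theta>) * x powr \<beta>) = ennreal ((Cw + 1) * x powr \<beta>)"
      using theta Cw(1) by (subst ennreal_mult[symmetric]) auto
    then show "(if x \<ge> 1 then 0 else E2 K x) \<le> ennreal ((Cw + 1) / (1 - \<theta>)) * (ennreal ((1 - \<theta>) * x powr \<beta>) * indicator {..1} x)"
      using E2_small[OF K x] by auto
  qed
  have P: "pot (\<lambda>x. Q x + ennreal ((Cw + 1) / (1 - \<theta>)) * ennreal (min x 1 powr \<beta>)) (E2 K)"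
    using pot_add[OF Q1 Q2] by (rule pot_le) auto
  define c where "c = C2 / (1 - \<theta>)"
  have c: "c > 0" using C2 theta by (simp add: c_def)
  have Q_eq: "Q x = ennreal c * (\<Sum>j. e j * ennreal (t j x))" for x
  proof -
    have "Q x = (\<Sum>j. ennreal c * (e j * ennreal (t j x)))"
      unfolding Q_def nn_integral_count_space_nat
    proof (rule suminf_cong)
      fix j
      define b where "b = w (exp (real j + 1)) * exp (- real j * \<beta>)"
      have b: "b \<ge> 0" using w_nonneg by (simp add: b_def)
      have "k j = ennreal c * (e j * ennreal b)" by (simp only: k_def c_def b_def)
      moreover have "ennreal (t j x) = ennreal b * ennreal (min x (exp (real j + 1)) powr \<beta>)"
        unfolding t_def b_def[symmetric] by (rule ennreal_mult[OF b]) simp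
      ultimately show "k j * ennreal (min x (exp (real j + 1)) powr \<beta>) = ennreal c * (e j * ennreal (t j x))"
        by (simp only: mult.assoc)
    qed
    then show ?thesis by simp
  qed
  have fin: "(\<Sum>j. e j) < \<infinity>" unfolding e_def using e2_sum[OF K] .
  then have e_fin: "e j < \<infinity>" for j
    using sum_le_suminf[of e "{j}"] le_less_trans by auto
  define er where "er j = enn2real (e j)" for j
  have er: "e j = ennreal (er j)" "er j \<ge> 0" for j using e_fin[of j] by (auto simp: er_def)
  have er_sum: "summable er"
    using fin er(2) by (intro summable_suminf_not_top) (auto simp: er(1)[symmetric] less_top[symmetric])
  \<comment> \<open>Chosen so that a tail of the weights below \<open>\<delta>'\<close>, multiplied
    by the prefactor \<open>c\<close> and the uniform bound \<open>D\<close>, contributes at most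
    \<open>\<delta> * (w x + w 1)\<close>.\<close>
  define \<delta>' where "\<delta>' = \<delta> / (c * D)"
  have \<delta>': "\<delta>' > 0" using \<delta> c D by (simp add: \<delta>'_def)
  have "(\<lambda>J. \<Sum>j. er (j + J)) \<longlonglongrightarrow> 0" using suminf_exist_split2[OF er_sum] .
  then have "\<forall>\<^sub>F J in sequentially. (\<Sum>j. er (j + J)) < \<delta>'" using \<delta>' by (rule order_tendstoD(2))
  then obtain J where J: "(\<Sum>j. er (j + J)) < \<delta>'" using eventually_happens'[OF sequentially_bot] by blast
  define B where "B = (\<Sum>j<J. er j * (w (exp (real j + 1)) * exp \<beta>))"
  have B: "B \<ge> 0" unfolding B_def using er w_nonneg by (intro sum_nonneg) auto
  have Qb: "Q x \<le> ennreal (c * (B + \<delta>' * (D * (w x + w 1))))" if x: "x > 0" for x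
  proof -
    have "(\<Sum>j. e j * ennreal (t j x)) = (\<Sum>j. e (j + J) * ennreal (t (j + J) x)) + (\<Sum>j<J. e j * ennreal (t j x))"
      by (rule suminf_offset) auto
    also have "\<dots> \<le> (\<Sum>j. ennreal (er (j + J)) * ennreal (D * (w x + w 1))) + (\<Sum>j<J. ennreal (er j * (w (exp (real j + 1)) * exp \<beta>)))"
    proof (rule add_mono)
      show "(\<Sum>j. e (j + J) * ennreal (t (j + J) x)) \<le> (\<Sum>j. ennreal (er (j + J)) * ennreal (D * (w x + w 1)))"
        unfolding er(1) using t_w[OF x] by (intro suminf_le mult_left_mono ennreal_leI) auto
      show "(\<Sum>j<J. e j * ennreal (t j x)) \<le> (\<Sum>j<J. ennreal (er j * (w (exp (real j + 1)) * exp \<beta>)))"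
      proof (rule sum_mono)
        fix j
        show "e j * ennreal (t j x) \<le> ennreal (er j * (w (exp (real j + 1)) * exp \<beta>))"
          unfolding er(1) using er(2)[of j] t_const[OF x, of j] t0[of j x] by (simp add: ennreal_mult[symmetric] ennreal_leI mult_left_mono)
      qed
    qed
    also have "(\<Sum>j<J. ennreal (er j * (w (exp (real j + 1)) * exp \<beta>))) = ennreal B"
      unfolding B_def using er w_nonneg by (intro sum_ennreal) auto
    also have "(\<Sum>j. ennreal (er (j + J)) * ennreal (D * (w x + w 1))) = ennreal (\<Sum>j. er (j + J)) * ennreal (D * (w x + w 1))"
      using er er_sum by (simp add: suminf_ennreal2 summable_iff_shift)
    also have "\<dots> \<le> ennreal \<delta>' * ennreal (D * (w x + w 1))" using J by (intro mult_right_mono ennreal_leI) auto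
    also have "\<dots> + ennreal B = ennreal (B + \<delta>' * (D * (w x + w 1)))"
      using \<delta>' D B w_nonneg by (simp add: ennreal_mult[symmetric] ennreal_plus[symmetric] add.commute del: ennreal_plus)
    finally have "Q x \<le> ennreal c * ennreal (B + \<delta>' * (D * (w x + w 1)))"
      unfolding Q_eq by (simp add: mult_left_mono add_right_mono)
    also have "\<dots> = ennreal (c * (B + \<delta>' * (D * (w x + w 1))))"
      using c by (simp add: ennreal_mult'[symmetric])
    finally show ?thesis .
  qed
  have eq: "c * (B + \<delta>' * (D * (w x + w 1))) = \<delta> * w x + (c * B + \<delta> * w 1)" for x
    using c D by (simp add: \<delta>'_def field_simps)
  define C where "C = c * B + \<delta> * w 1 + (Cw + 1) / (1 - \<theta>)"
  have "Q x + ennreal ((Cw + 1) / (1 - \<theta>)) * ennreal (min x 1 powr \<beta>) \<le> ennreal (\<delta> * w x + C)" if x: "x > 0" for x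
  proof -
    have "min x 1 powr \<beta> \<le> 1" using x beta powr_mono2[of \<beta> "min x 1" 1] by simp
    then have "ennreal ((Cw + 1) / (1 - \<theta>)) * ennreal (min x 1 powr \<beta>) \<le> ennreal ((Cw + 1) / (1 - \<theta>)) * 1"
      by (intro mult_left_mono) (auto simp: ennreal_le_1)
    with Qb[OF x] have "Q x + ennreal ((Cw + 1) / (1 - \<theta>)) * ennreal (min x 1 powr \<beta>) \<le> ennreal (\<delta> * w x + (c * B + \<delta> * w 1)) + ennreal ((Cw + 1) / (1 - \<theta>)) * 1"
      unfolding eq by (rule add_mono)
    also have "\<dots> = ennreal (\<delta> * w x + C)"
      using c B \<delta> w_nonneg[of x] w_nonneg[of 1] Cw(1) theta by (simp add: C_def ennreal_plus[symmetric] add.assoc del: ennreal_plus)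
    finally show ?thesis .
  qed
  moreover have "C \<ge> 0" using c B \<delta> w_nonneg[of 1] Cw(1) theta by (simp add: C_def)
  ultimately show ?thesis using P by blast
qed

section \<open>One step of the affine recursion from below\<close>

definition ell :: "real \<Rightarrow> real \<Rightarrow> ennreal" where
  "ell l x = ennreal (x powr \<alpha>) * (\<integral>\<^sup>+\<omega>. ennreal (ramp l (Y \<omega> / x)) \<partial>M)"

lemma ell_ge:
  assumes l: "l > 1" and x: "x > 0"
  shows "ennreal (L (l * x)) \<le> ennreal (l powr \<alpha>) * ell l x"
proof -
  have "ennreal (L (l * x)) = ennreal ((l * x) powr \<alpha>) * (\<integral>\<^sup>+\<omega>. indicator {l * x<..} (Y \<omega>) \<partial>M)"
    by (rule nn_indicator_Y[symmetric])
  also have "\<dots> \<le> ennreal ((l * x) powr \<alpha>) * (\<integral>\<^sup>+\<omega>. ennreal (ramp l (Y \<omega> / x)) \<partial>M)"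
  proof (intro mult_left_mono nn_integral_mono)
    fix \<omega>
    have "ramp l (Y \<omega> / x) = 1" if "Y \<omega> > l * x" using that x by (intro ramp_1[OF l]) (simp add: field_simps)
    then show "indicator {l * x<..} (Y \<omega>) \<le> ennreal (ramp l (Y \<omega> / x))" by (auto simp: indicator_def)
  qed simp
  also have "\<dots> = ennreal (l powr \<alpha>) * ell l x"
    using l x by (simp add: ell_def powr_mult ennreal_mult mult.assoc)
  finally show ?thesis .
qed

text \<open>Conditionally on \<open>(A, Y)\<close>, the event \<open>A * z > x\<close> is a tail
  event for the law \<open>N\<close>, to which the a priori bound \<open>b\<close> applies. The part
  of \<open>b\<close> that decays in \<open>n\<close> is integrated with the minimum replaced by 1
  and thus gains another factor \<theta>.\<close>

lemma J_bound:
  assumes N: "prob_space N" and sets [measurable_cong]: "sets N = sets borel" and l: "l > 1" and C1: "C1 \<ge> 0" and D: "D \<ge> 0"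
    and b: "\<And>u. u > 0 \<Longrightarrow> H l N u \<le> ennreal (C1 * (w u + min u 1 powr \<beta>)) + ennreal (D * u powr \<beta>)" and x: "x > 0"
  shows "ennreal (x powr \<alpha>) * (\<integral>\<^sup>+p. ennreal (min 1 (K * max 0 (- Y (snd p)) / x)) * indicator {x<..} (A (snd p) * fst p) \<partial>(N \<Otimes>\<^sub>M M))
    \<le> ennreal (l powr \<alpha> * C1) * E2 K x + ennreal (l powr \<alpha> * D * \<theta> * x powr \<beta>)"
proof -
  interpret N: prob_space N by fact
  interpret pair_sigma_finite N M ..
  let ?m = "\<lambda>\<omega>. ennreal (min 1 (K * max 0 (- Y \<omega>) / x))"
  have [measurable]: "Measurable.pred (N \<Otimes>\<^sub>M M) (\<lambda>p. x < A (snd p) * fst p)" by measurable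
  have "(\<integral>\<^sup>+p. ?m (snd p) * indicator {x<..} (A (snd p) * fst p) \<partial>(N \<Otimes>\<^sub>M M))
    = (\<integral>\<^sup>+\<omega>. \<integral>\<^sup>+z. ?m \<omega> * indicator {x<..} (A \<omega> * z) \<partial>N \<partial>M)"
    by (subst nn_integral_snd[symmetric]) auto
  also have "\<dots> = (\<integral>\<^sup>+\<omega>. ?m \<omega> * (\<integral>\<^sup>+z. indicator {x<..} (A \<omega> * z) \<partial>N) \<partial>M)"
    by (intro nn_integral_cong nn_integral_cmult) measurable
  finally have "ennreal (x powr \<alpha>) * (\<integral>\<^sup>+p. ?m (snd p) * indicator {x<..} (A (snd p) * fst p) \<partial>(N \<Otimes>\<^sub>M M))
    = (\<integral>\<^sup>+\<omega>. ennreal (x powr \<alpha>) * (?m \<omega> * (\<integral>\<^sup>+z. indicator {x<..} (A \<omega> * z) \<partial>N)) \<partial>M)"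
    by (simp add: nn_integral_cmult)
  also have "\<dots> \<le> (\<integral>\<^sup>+\<omega>. ennreal (l powr \<alpha> * C1) * (?m \<omega> * (ennreal (A \<omega> powr \<alpha>) * ennreal (w (x / A \<omega>) + min (x / A \<omega>) 1 powr \<beta>)))
      + ennreal (A \<omega> powr \<alpha>) * ennreal (l powr \<alpha> * D * (x / A \<omega>) powr \<beta>) \<partial>M)"
  proof (rule nn_integral_mono)
    fix \<omega>
    show "ennreal (x powr \<alpha>) * (?m \<omega> * (\<integral>\<^sup>+z. indicator {x<..} (A \<omega> * z) \<partial>N))
      \<le> ennreal (l powr \<alpha> * C1) * (?m \<omega> * (ennreal (A \<omega> powr \<alpha>) * ennreal (w (x / A \<omega>) + min (x / A \<omega>) 1 powr \<beta>)))
      + ennreal (A \<omega> powr \<alpha>) * ennreal (l powr \<alpha> * D * (x / A \<omega>) powr \<beta>)"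
    proof (cases "A \<omega> = 0")
      case True
      then show ?thesis using x by simp
    next
      case False
      then have A0: "A \<omega> > 0" using A_nonneg[of \<omega>] by simp
      \<comment> \<open>The scale at which the ramp equals 1 as soon as \<open>A * z > x\<close>.
        Afterwards the bound at \<open>u\<close> is enlarged to the one at \<open>v = x / A\<close>,
        since all terms in it are monotone.\<close>
      define u where "u = x / (l * A \<omega>)"
      define v where "v = x / A \<omega>"
      have u: "u > 0" "u \<le> v" using A0 x l by (auto simp: u_def v_def field_simps)
      have "(\<integral>\<^sup>+z. indicator {x<..} (A \<omega> * z) \<partial>N) \<le> (\<integral>\<^sup>+z. ennreal (ramp l (z / u)) \<partial>N)"
      proof (rule nn_integral_mono)
        fix z
        have "ramp l (z / u) = 1" if "A \<omega> * z > x"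
          using that x l A0 by (intro ramp_1[OF l]) (simp add: u_def field_simps)
        then show "indicator {x<..} (A \<omega> * z) \<le> ennreal (ramp l (z / u))" by (auto simp: indicator_def)
      qed
      then have "ennreal (x powr \<alpha>) * (\<integral>\<^sup>+z. indicator {x<..} (A \<omega> * z) \<partial>N) \<le> ennreal (x powr \<alpha>) * (\<integral>\<^sup>+z. ennreal (ramp l (z / u)) \<partial>N)"
        by (rule mult_left_mono) simp
      also have "\<dots> = ennreal (l powr \<alpha> * A \<omega> powr \<alpha>) * H l N u"
      proof -
        have "x powr \<alpha> = l powr \<alpha> * A \<omega> powr \<alpha> * u powr \<alpha>"
          using A0 l x by (simp add: u_def powr_mult[symmetric])
        then show ?thesis by (simp add: H_def ennreal_mult mult.assoc)
      qed
      also have "\<dots> \<le> ennreal (l powr \<alpha> * A \<omega> powr \<alpha>) * (ennreal (C1 * (w v + min v 1 powr \<beta>)) + ennreal (D * v powr \<beta>))"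
      proof (rule mult_left_mono)
        have "H l N u \<le> ennreal (C1 * (w u + min u 1 powr \<beta>)) + ennreal (D * u powr \<beta>)" by (rule b[OF u(1)])
        also have "\<dots> \<le> ennreal (C1 * (w v + min v 1 powr \<beta>)) + ennreal (D * v powr \<beta>)"
          using u C1 D beta by (intro add_mono ennreal_leI mult_left_mono w_mono powr_mono2 min.mono) auto
        finally show "H l N u \<le> ennreal (C1 * (w v + min v 1 powr \<beta>)) + ennreal (D * v powr \<beta>)" .
      qed simp
      finally have J: "ennreal (x powr \<alpha>) * (\<integral>\<^sup>+z. indicator {x<..} (A \<omega> * z) \<partial>N)
         \<le> ennreal (l powr \<alpha> * A \<omega> powr \<alpha>) * (ennreal (C1 * (w v + min v 1 powr \<beta>)) + ennreal (D * v powr \<beta>))" .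
      define W0 where "W0 = w v + min v 1 powr \<beta>"
      have W0: "W0 \<ge> 0" using w_nonneg by (simp add: W0_def)
      have "ennreal (x powr \<alpha>) * (?m \<omega> * (\<integral>\<^sup>+z. indicator {x<..} (A \<omega> * z) \<partial>N)) = ?m \<omega> * (ennreal (x powr \<alpha>) * (\<integral>\<^sup>+z. indicator {x<..} (A \<omega> * z) \<partial>N))"
        by (simp only: mult_ac)
      also have "\<dots> \<le> ?m \<omega> * (ennreal (l powr \<alpha> * A \<omega> powr \<alpha>) * (ennreal (C1 * W0) + ennreal (D * v powr \<beta>)))"
        unfolding W0_def by (rule mult_left_mono[OF J]) simp
      also have "\<dots> = ?m \<omega> * (ennreal (l powr \<alpha> * A \<omega> powr \<alpha>) * ennreal (C1 * W0)) + ?m \<omega> * (ennreal (l powr \<alpha> * A \<omega> powr \<alpha>) * ennreal (D * v powr \<beta>))"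
        by (simp only: distrib_left)
      also have "\<dots> \<le> ?m \<omega> * (ennreal (l powr \<alpha> * A \<omega> powr \<alpha>) * ennreal (C1 * W0)) + 1 * (ennreal (l powr \<alpha> * A \<omega> powr \<alpha>) * ennreal (D * v powr \<beta>))"
        by (intro add_left_mono mult_right_mono) (auto simp: ennreal_le_1)
      also have "1 * (ennreal (l powr \<alpha> * A \<omega> powr \<alpha>) * ennreal (D * v powr \<beta>)) = ennreal (A \<omega> powr \<alpha>) * ennreal (l powr \<alpha> * D * v powr \<beta>)"
        using D by (simp add: ennreal_mult mult_ac)
      also have "?m \<omega> * (ennreal (l powr \<alpha> * A \<omega> powr \<alpha>) * ennreal (C1 * W0)) = ennreal (l powr \<alpha> * C1) * (?m \<omega> * (ennreal (A \<omega> powr \<alpha>) * ennreal W0))"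
        using C1 W0 by (simp add: ennreal_mult mult_ac)
      finally show ?thesis unfolding W0_def v_def .
    qed
  qed
  also have "\<dots> = (\<integral>\<^sup>+\<omega>. ennreal (l powr \<alpha> * C1) * (?m \<omega> * (ennreal (A \<omega> powr \<alpha>) * ennreal (w (x / A \<omega>) + min (x / A \<omega>) 1 powr \<beta>))) \<partial>M)
    + T (\<lambda>x. ennreal (l powr \<alpha> * D * x powr \<beta>)) x"
    unfolding T_def by (rule nn_integral_add) measurable
  also have "T (\<lambda>x. ennreal (l powr \<alpha> * D * x powr \<beta>)) x = ennreal (l powr \<alpha> * D * \<theta> * x powr \<beta>)"
    using D x by (intro T_powr_beta) auto
  also have "(\<integral>\<^sup>+\<omega>. ennreal (l powr \<alpha> * C1) * (?m \<omega> * (ennreal (A \<omega> powr \<alpha>) * ennreal (w (x / A \<omega>) + min (x / A \<omega>) 1 powr \<beta>))) \<partial>M)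
    = ennreal (l powr \<alpha> * C1) * E2 K x"
    unfolding E2_def by (rule nn_integral_cmult) measurable
  finally show ?thesis .
qed

text \<open>\<open>ramp_superadd\<close> integrated over the product law. In the error for large
  \<open>Y\<close>, independence splits off the moment of order \<eta> of \<open>N\<close>; what
  remains is a source in \<open>(A, Y)\<close> alone, the same for all iterates.\<close>

lemma lower_step:
  assumes N: "prob_space N" and sets [measurable_cong]: "sets N = sets borel" and l: "l > 1" and x: "x > 0"
    and \<eta>: "0 < \<eta>" "\<eta> \<le> 1" "\<eta> < \<alpha>" and m: "(\<integral>\<^sup>+z. ennreal (\<bar>z\<bar> powr \<eta>) \<partial>N) \<le> ennreal m" and m0: "m \<ge> 0"
  shows "T (H l N) x + ell l x \<le> H l (aff N) x
    + (ennreal ((1 + (1 / (l - 1)) powr \<eta>) * m) * (\<integral>\<^sup>+\<omega>. ennreal ((1 * A \<omega>) powr \<eta>) * (ennreal (x powr (\<alpha> - \<eta>)) * indicator {x..} (2 * max 0 (Y \<omega>))) \<partial>M)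
    + ennreal (x powr \<alpha>) * (\<integral>\<^sup>+p. ennreal (min 1 (1 / (l - 1) * max 0 (- Y (snd p)) / x)) * indicator {x<..} (A (snd p) * fst p) \<partial>(N \<Otimes>\<^sub>M M)))"
proof -
  interpret N: prob_space N by fact
  define K where "K = 1 / (l - 1)"
  define K' where "K' = 1 + K powr \<eta>"
  have K: "K \<ge> 0" "K' \<ge> 0" using l by (auto simp: K_def K'_def)
  have xs: "x powr \<alpha> = x powr \<eta> * x powr (\<alpha> - \<eta>)" by (simp add: powr_add[symmetric])
  define f1 where "f1 p = ennreal (x powr \<alpha>) * ennreal (ramp l (A (snd p) * fst p / x))" for p :: "real \<times> 'a"
  define f2 where "f2 p = ennreal (x powr \<alpha>) * ennreal (ramp l (Y (snd p) / x))" for p :: "real \<times> 'a"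
  define g1 where "g1 p = ennreal (x powr \<alpha>) * ennreal (ramp l ((A (snd p) * fst p + Y (snd p)) / x))" for p :: "real \<times> 'a"
  define g2 where "g2 p = ennreal K' * (ennreal (\<bar>fst p\<bar> powr \<eta>) * (ennreal ((1 * A (snd p)) powr \<eta>) * (ennreal (x powr (\<alpha> - \<eta>)) * indicator {x..} (2 * max 0 (Y (snd p))))))" for p :: "real \<times> 'a"
  define g3 where "g3 p = ennreal (x powr \<alpha>) * (ennreal (min 1 (K * max 0 (- Y (snd p)) / x)) * indicator {x<..} (A (snd p) * fst p))" for p :: "real \<times> 'a"
  have [measurable]: "f1 \<in> borel_measurable (N \<Otimes>\<^sub>M M)" "f2 \<in> borel_measurable (N \<Otimes>\<^sub>M M)" "g1 \<in> borel_measurable (N \<Otimes>\<^sub>M M)"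
    "g2 \<in> borel_measurable (N \<Otimes>\<^sub>M M)" "g3 \<in> borel_measurable (N \<Otimes>\<^sub>M M)"
    unfolding f1_def f2_def g1_def g2_def g3_def by measurable
  have le: "f1 p + f2 p \<le> g1 p + (g2 p + g3 p)" for p
  proof -
    let ?p = "A (snd p) * fst p / x" and ?q = "Y (snd p) / x"
    have "ramp l ?p + ramp l ?q \<le> ramp l (?p + ?q) + K' * \<bar>?p\<bar> powr \<eta> * indicator {1<..} ?q
      + min 1 (K * max 0 (- ?q)) * indicator {1<..} ?p"
      unfolding K'_def K_def by (rule ramp_superadd[OF l \<eta>(1,2)])
    \<comment> \<open>A deliberate weakening of \<open>Y > x\<close> to
      \<open>2 * max 0 Y \<ge> x\<close>, which brings the term into the form handled by
      \<open>pot_pair\<close>.\<close>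
    also have "(indicator {1<..} ?q :: real) \<le> indicator {x..} (2 * max 0 (Y (snd p)))"
      using x by (auto simp: indicator_def field_simps)
    also have "(indicator {1<..} ?p :: real) = indicator {x<..} (A (snd p) * fst p)"
      using x by (auto simp: indicator_def field_simps)
    also have "K * max 0 (- ?q) = K * max 0 (- Y (snd p)) / x" using x by (auto simp: max_def field_simps)
    finally have "ramp l ?p + ramp l ?q \<le> ramp l (?p + ?q) + K' * \<bar>?p\<bar> powr \<eta> * indicator {x..} (2 * max 0 (Y (snd p)))
      + min 1 (K * max 0 (- Y (snd p)) / x) * indicator {x<..} (A (snd p) * fst p)"
      using K by (simp add: mult_left_mono)
    then have "x powr \<alpha> * (ramp l ?p + ramp l ?q) \<le> x powr \<alpha> * (ramp l (?p + ?q) + K' * \<bar>?p\<bar> powr \<eta> * indicator {x..} (2 * max 0 (Y (snd p)))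
      + min 1 (K * max 0 (- Y (snd p)) / x) * indicator {x<..} (A (snd p) * fst p))"
      by (intro mult_left_mono) auto
    also have "\<dots> = x powr \<alpha> * ramp l (?p + ?q) + (K' * (\<bar>fst p\<bar> powr \<eta> * (A (snd p) powr \<eta> * (x powr (\<alpha> - \<eta>) * indicator {x..} (2 * max 0 (Y (snd p))))))
      + x powr \<alpha> * (min 1 (K * max 0 (- Y (snd p)) / x) * indicator {x<..} (A (snd p) * fst p)))"
    proof -
      have "x powr \<alpha> * \<bar>?p\<bar> powr \<eta> = \<bar>fst p\<bar> powr \<eta> * (A (snd p) powr \<eta> * x powr (\<alpha> - \<eta>))"
        unfolding xs using x A_nonneg[of "snd p"] by (simp add: abs_mult powr_mult powr_divide)
      then have "x powr \<alpha> * (K' * \<bar>?p\<bar> powr \<eta> * indicator {x..} (2 * max 0 (Y (snd p)))) = K' * (\<bar>fst p\<bar> powr \<eta> * (A (snd p) powr \<eta> * (x powr (\<alpha> - \<eta>) * indicator {x..} (2 * max 0 (Y (snd p))))))"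
        by (simp add: mult_ac)
      then show ?thesis by (simp only: distrib_left add.assoc)
    qed
    finally have le: "x powr \<alpha> * ramp l ?p + x powr \<alpha> * ramp l ?q \<le> x powr \<alpha> * ramp l (?p + ?q) + (K' * (\<bar>fst p\<bar> powr \<eta> * (A (snd p) powr \<eta> * (x powr (\<alpha> - \<eta>) * indicator {x..} (2 * max 0 (Y (snd p))))))
      + x powr \<alpha> * (min 1 (K * max 0 (- Y (snd p)) / x) * indicator {x<..} (A (snd p) * fst p)))"
      by (simp only: distrib_left)
    have m0: "min 1 (K * max 0 (- Y (snd p)) / x) \<ge> 0" using K x by simp
    have e1: "f1 p = ennreal (x powr \<alpha> * ramp l ?p)" "f2 p = ennreal (x powr \<alpha> * ramp l ?q)" "g1 p = ennreal (x powr \<alpha> * ramp l (?p + ?q))"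
      using ramp_bounds by (auto simp: f1_def f2_def g1_def ennreal_mult add_divide_distrib)
    have e2: "g2 p = ennreal (K' * (\<bar>fst p\<bar> powr \<eta> * (A (snd p) powr \<eta> * (x powr (\<alpha> - \<eta>) * indicator {x..} (2 * max 0 (Y (snd p)))))))"
      using K by (simp add: g2_def ennreal_mult ennreal_indicator)
    have e3: "g3 p = ennreal (x powr \<alpha> * (min 1 (K * max 0 (- Y (snd p)) / x) * indicator {x<..} (A (snd p) * fst p)))"
      using m0 by (simp add: g3_def ennreal_mult ennreal_indicator)
    have aux: "ennreal a + ennreal b \<le> ennreal c + (ennreal d + ennreal e)"
      if "a + b \<le> c + (d + e)" "a \<ge> 0" "b \<ge> 0" "c \<ge> 0" "d \<ge> 0" "e \<ge> 0" for a b c d e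
      using that by (simp add: ennreal_plus[symmetric] ennreal_leI del: ennreal_plus)
    show ?thesis unfolding e1 e2 e3 using K m0 ramp_bounds by (intro aux le) auto
  qed
  have I1: "(\<integral>\<^sup>+p. f1 p \<partial>(N \<Otimes>\<^sub>M M)) = T (H l N) x"
  proof -
    have "(\<integral>\<^sup>+z. \<integral>\<^sup>+\<omega>. ennreal (ramp l (A \<omega> * z / x)) \<partial>M \<partial>N) = (\<integral>\<^sup>+p. ennreal (ramp l (A (snd p) * fst p / x)) \<partial>(N \<Otimes>\<^sub>M M))"
      using nn_integral_fst[of "\<lambda>p. ennreal (ramp l (A (snd p) * fst p / x))" N] by simp
    then show ?thesis unfolding T_H[OF N sets l x] f1_def by (simp add: nn_integral_cmult)
  qed
  have I2: "(\<integral>\<^sup>+p. f2 p \<partial>(N \<Otimes>\<^sub>M M)) = ell l x"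
    unfolding f2_def ell_def by (subst nn_integral_fst[symmetric]) (auto simp: nn_integral_cmult N.emeasure_space_1)
  have I3: "(\<integral>\<^sup>+p. g1 p \<partial>(N \<Otimes>\<^sub>M M)) = H l (aff N) x"
  proof -
    have "(\<integral>\<^sup>+z. ennreal (ramp l (z / x)) \<partial>aff N) = (\<integral>\<^sup>+z. \<integral>\<^sup>+\<omega>. ennreal (ramp l ((A \<omega> * z + Y \<omega>) / x)) \<partial>M \<partial>N)"
      by (rule nn_aff[OF sets]) measurable
    also have "\<dots> = (\<integral>\<^sup>+p. ennreal (ramp l ((A (snd p) * fst p + Y (snd p)) / x)) \<partial>(N \<Otimes>\<^sub>M M))"
      by (subst nn_integral_fst[symmetric]) auto
    finally show ?thesis unfolding H_def g1_def by (simp add: nn_integral_cmult)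
  qed
  have I4: "(\<integral>\<^sup>+p. g2 p \<partial>(N \<Otimes>\<^sub>M M)) \<le> ennreal (K' * m) * (\<integral>\<^sup>+\<omega>. ennreal ((1 * A \<omega>) powr \<eta>) * (ennreal (x powr (\<alpha> - \<eta>)) * indicator {x..} (2 * max 0 (Y \<omega>))) \<partial>M)"
  proof -
    have "(\<integral>\<^sup>+p. g2 p \<partial>(N \<Otimes>\<^sub>M M)) = ennreal K' * (\<integral>\<^sup>+p. ennreal (\<bar>fst p\<bar> powr \<eta>) * (ennreal ((1 * A (snd p)) powr \<eta>) * (ennreal (x powr (\<alpha> - \<eta>)) * indicator {x..} (2 * max 0 (Y (snd p))))) \<partial>(N \<Otimes>\<^sub>M M))"
      unfolding g2_def by (rule nn_integral_cmult) measurable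
    also have "(\<integral>\<^sup>+p. ennreal (\<bar>fst p\<bar> powr \<eta>) * (ennreal ((1 * A (snd p)) powr \<eta>) * (ennreal (x powr (\<alpha> - \<eta>)) * indicator {x..} (2 * max 0 (Y (snd p))))) \<partial>(N \<Otimes>\<^sub>M M))
      = (\<integral>\<^sup>+z. ennreal (\<bar>z\<bar> powr \<eta>) \<partial>N) * (\<integral>\<^sup>+\<omega>. ennreal ((1 * A \<omega>) powr \<eta>) * (ennreal (x powr (\<alpha> - \<eta>)) * indicator {x..} (2 * max 0 (Y \<omega>))) \<partial>M)"
      by (rule nn_integral_pair_mult[OF N]) measurable
    also have "ennreal K' * \<dots> \<le> ennreal K' * (ennreal m * (\<integral>\<^sup>+\<omega>. ennreal ((1 * A \<omega>) powr \<eta>) * (ennreal (x powr (\<alpha> - \<eta>)) * indicator {x..} (2 * max 0 (Y \<omega>))) \<partial>M))"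
      by (intro mult_left_mono mult_right_mono m) auto
    finally show ?thesis using K m0 by (simp only: ennreal_mult mult.assoc)
  qed
  have I5: "(\<integral>\<^sup>+p. g3 p \<partial>(N \<Otimes>\<^sub>M M)) = ennreal (x powr \<alpha>) * (\<integral>\<^sup>+p. ennreal (min 1 (K * max 0 (- Y (snd p)) / x)) * indicator {x<..} (A (snd p) * fst p) \<partial>(N \<Otimes>\<^sub>M M))"
    unfolding g3_def by (rule nn_integral_cmult) measurable
  have "T (H l N) x + ell l x = (\<integral>\<^sup>+p. f1 p + f2 p \<partial>(N \<Otimes>\<^sub>M M))"
    unfolding I1[symmetric] I2[symmetric] by (rule nn_integral_add[symmetric]) measurable
  also have "\<dots> \<le> (\<integral>\<^sup>+p. g1 p + (g2 p + g3 p) \<partial>(N \<Otimes>\<^sub>M M))" by (intro nn_integral_mono le)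
  also have "\<dots> = H l (aff N) x + ((\<integral>\<^sup>+p. g2 p \<partial>(N \<Otimes>\<^sub>M M)) + (\<integral>\<^sup>+p. g3 p \<partial>(N \<Otimes>\<^sub>M M)))"
    unfolding I3[symmetric] by (simp add: nn_integral_add)
  also have "\<dots> \<le> H l (aff N) x + (ennreal (K' * m) * (\<integral>\<^sup>+\<omega>. ennreal ((1 * A \<omega>) powr \<eta>) * (ennreal (x powr (\<alpha> - \<eta>)) * indicator {x..} (2 * max 0 (Y \<omega>))) \<partial>M) + (\<integral>\<^sup>+p. g3 p \<partial>(N \<Otimes>\<^sub>M M)))"
    by (intro add_left_mono add_right_mono I4)
  finally show ?thesis unfolding I5 K'_def K_def .
qed

text \<open>For exponents up to 1 the power is subadditive, so the moment obeys an affine recursion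
  with slope \<open>\<phi> \<eta> < 1\<close>. This bounds the moments uniformly along the
  iterates.\<close>

lemma moment_step:
  assumes N: "prob_space N" and sets [measurable_cong]: "sets N = sets borel" and \<eta>: "0 < \<eta>" "\<eta> \<le> 1" "\<eta> < \<alpha>"
  shows "(\<integral>\<^sup>+z. ennreal (\<bar>z\<bar> powr \<eta>) \<partial>aff N) \<le> ennreal (\<phi> \<eta>) * (\<integral>\<^sup>+z. ennreal (\<bar>z\<bar> powr \<eta>) \<partial>N) + (\<integral>\<^sup>+\<omega>. ennreal (\<bar>Y \<omega>\<bar> powr \<eta>) \<partial>M)"
proof -
  interpret N: prob_space N by fact
  have "(\<integral>\<^sup>+z. ennreal (\<bar>z\<bar> powr \<eta>) \<partial>aff N) = (\<integral>\<^sup>+z. \<integral>\<^sup>+\<omega>. ennreal (\<bar>A \<omega> * z + Y \<omega>\<bar> powr \<eta>) \<partial>M \<partial>N)"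
    by (rule nn_aff[OF sets]) measurable
  also have "\<dots> \<le> (\<integral>\<^sup>+z. \<integral>\<^sup>+\<omega>. ennreal (A \<omega> powr \<eta>) * ennreal (\<bar>z\<bar> powr \<eta>) + ennreal (\<bar>Y \<omega>\<bar> powr \<eta>) \<partial>M \<partial>N)"
  proof (intro nn_integral_mono)
    fix z \<omega>
    have "\<bar>A \<omega> * z + Y \<omega>\<bar> powr \<eta> \<le> (A \<omega> * \<bar>z\<bar> + \<bar>Y \<omega>\<bar>) powr \<eta>"
      using \<eta> A_nonneg[of \<omega>] abs_triangle_ineq[of "A \<omega> * z" "Y \<omega>"] by (intro powr_mono2) (auto simp: abs_mult)
    also have "\<dots> \<le> (A \<omega> * \<bar>z\<bar>) powr \<eta> + \<bar>Y \<omega>\<bar> powr \<eta>" using \<eta> A_nonneg[of \<omega>] by (intro powr_subadd) auto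
    also have "(A \<omega> * \<bar>z\<bar>) powr \<eta> = A \<omega> powr \<eta> * \<bar>z\<bar> powr \<eta>" using A_nonneg[of \<omega>] by (simp add: powr_mult)
    finally show "ennreal (\<bar>A \<omega> * z + Y \<omega>\<bar> powr \<eta>) \<le> ennreal (A \<omega> powr \<eta>) * ennreal (\<bar>z\<bar> powr \<eta>) + ennreal (\<bar>Y \<omega>\<bar> powr \<eta>)"
      by (simp add: ennreal_mult[symmetric] ennreal_plus[symmetric] ennreal_leI del: ennreal_plus)
  qed
  also have "\<dots> = (\<integral>\<^sup>+z. ennreal (\<phi> \<eta>) * ennreal (\<bar>z\<bar> powr \<eta>) + (\<integral>\<^sup>+\<omega>. ennreal (\<bar>Y \<omega>\<bar> powr \<eta>) \<partial>M) \<partial>N)"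
    using \<eta> by (intro nn_integral_cong) (simp add: nn_integral_add nn_integral_multc nn_A_powr)
  also have "\<dots> = ennreal (\<phi> \<eta>) * (\<integral>\<^sup>+z. ennreal (\<bar>z\<bar> powr \<eta>) \<partial>N) + (\<integral>\<^sup>+\<omega>. ennreal (\<bar>Y \<omega>\<bar> powr \<eta>) \<partial>M)"
    by (simp add: nn_integral_add nn_integral_cmult N.emeasure_space_1)
  finally show ?thesis .
qed

text \<open>Since \<open>aff N0\<close> lies below \<open>N0\<close>, the iterates of
  \<open>aff\<close> decrease stochastically, and \<open>upper_bound\<close> controls their tails by
  the \<open>w\<close> of the very \<open>Y\<close> in question, up to a term decaying like
  \<theta>^n. The tail of \<open>N0\<close> itself might be much heavier than this \<open>w\<close>.
  The comparison is carried out along the iterates, and only at the end is their smoothed tail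
  bounded by that of \<open>N0\<close>.\<close>

lemma lower_bound:
  assumes N0: "prob_space N0" and sets0: "sets N0 = sets borel" and le0: "st_le (aff N0) N0"
    and mom: "\<And>s. 0 < s \<Longrightarrow> s < \<alpha> \<Longrightarrow> (\<integral>\<^sup>+z. ennreal (\<bar>z\<bar> powr s) \<partial>N0) < \<infinity>"
    and l: "l > 1" and \<epsilon>: "\<epsilon> > 0"
  shows "\<exists>C\<ge>0. \<forall>x>0. ennreal (w x / ((1 + \<epsilon>)\<^sup>2 * \<rho> * l powr \<alpha>)) \<le> H l N0 x + ennreal (\<epsilon> * w x + C)"
proof -
  define Nn where "Nn n = (aff ^^ n) N0" for n
  have Nn_Suc: "Nn (Suc n) = aff (Nn n)" and Nn_0: "Nn 0 = N0" for n by (auto simp: Nn_def)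
  have sets: "sets (Nn n) = sets borel" for n by (cases n) (auto simp: Nn_Suc Nn_0 sets0)
  have prob: "prob_space (Nn n)" for n by (induction n) (auto simp: Nn_Suc Nn_0 N0 prob_aff sets)
  have dec: "st_le (Nn (Suc n)) (Nn n)" for n
  proof (induction n)
    case (Suc n)
    then show ?case unfolding Nn_Suc[of "Suc n"] Nn_Suc[of n, symmetric]
      by (subst (2) Nn_Suc) (intro aff_mono sets)
  qed (simp add: Nn_Suc Nn_0 le0)
  have dom: "st_le (Nn n) (Nn 0)" for n
    by (induction n) (auto intro: st_le_refl st_le_trans[OF dec])
  \<comment> \<open>A crude a priori bound suffices, as the potential of the error it enters can be
    made an arbitrarily small multiple of \<open>w\<close>, up to a constant; hence the choice
    1/2.\<close>
  obtain C where C: "C \<ge> 0" and Cb: "\<And>n x. x > 0 \<Longrightarrow> H l (Nn n) x \<le> ennreal (w x / ((1 - 1 / 2) * \<rho>)) + ennreal C + ennreal (C * \<theta> ^ n * x powr \<beta>)"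
    using upper_bound[of Nn l "1/2", OF prob sets _ dom _ l] mom by (auto simp: Nn_Suc Nn_0 st_le_refl)
  define C1 where "C1 = 2 / \<rho> + C + 1"
  have C1: "C1 \<ge> 1" using rho_pos C by (simp add: C1_def)
  \<comment> \<open>The additive constant is useful only for \<open>x \<ge> 1\<close>. Below 1 the
    trivial bound \<open>x powr \<alpha> \<le> x powr \<beta>\<close> replaces it, which gives the
    form required by \<open>J_bound\<close>.\<close>
  have Hb: "H l (Nn n) x \<le> ennreal (C1 * (w x + min x 1 powr \<beta>)) + ennreal (C * \<theta> ^ n * x powr \<beta>)" if x: "x > 0" for n x
  proof (cases "x \<ge> 1")
    case True
    have "w x / ((1 - 1 / 2) * \<rho>) + C = 2 / \<rho> * w x + C * 1" by simp
    also have "\<dots> \<le> C1 * w x + C1 * 1" using rho_pos C w_nonneg[of x]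
      by (intro add_mono mult_right_mono) (auto simp: C1_def)
    also have "\<dots> = C1 * (w x + min x 1 powr \<beta>)" using True by (simp add: min_def distrib_left)
    finally have "ennreal (w x / ((1 - 1 / 2) * \<rho>)) + ennreal C \<le> ennreal (C1 * (w x + min x 1 powr \<beta>))"
      using rho_pos C w_nonneg[of x] by (simp add: ennreal_plus[symmetric] ennreal_leI del: ennreal_plus)
    then show ?thesis using Cb[OF x, of n] by (meson add_right_mono order.trans)
  next
    case False
    interpret P: prob_space "Nn n" by (rule prob)
    have "(\<integral>\<^sup>+z. ennreal (ramp l (z / x)) \<partial>Nn n) \<le> (\<integral>\<^sup>+z. 1 \<partial>Nn n)"
      by (intro nn_integral_mono) (simp add: ennreal_le_1 ramp_bounds)
    then have "H l (Nn n) x \<le> ennreal (x powr \<alpha>) * 1" unfolding H_def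
      by (intro mult_left_mono) (auto simp: P.emeasure_space_1)
    also have "\<dots> \<le> ennreal (x powr \<beta>)" using False x beta by (simp add: ennreal_leI powr_mono')
    also have "x powr \<beta> \<le> C1 * (w x + min x 1 powr \<beta>)"
    proof -
      have "1 * x powr \<beta> \<le> C1 * (w x + min x 1 powr \<beta>)" using C1 w_nonneg[of x] False by (intro mult_mono) auto
      then show ?thesis by simp
    qed
    finally show ?thesis by (simp add: add_increasing2 ennreal_leI)
  qed
  obtain \<eta> where \<eta>: "0 < \<eta>" "\<eta> < \<alpha>" "\<eta> \<le> 1" and mixed: "integrable M (\<lambda>\<omega>. A \<omega> powr \<eta> * max (Y \<omega>) 0 powr (\<alpha> - \<eta>))"
    using mixed_moment by auto
  obtain m0 where m0: "(\<integral>\<^sup>+z. ennreal (\<bar>z\<bar> powr \<eta>) \<partial>N0) = ennreal m0" "m0 \<ge> 0"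
    using mom[OF \<eta>(1,2)] by (cases "(\<integral>\<^sup>+z. ennreal (\<bar>z\<bar> powr \<eta>) \<partial>N0)") auto
  obtain my where my: "(\<integral>\<^sup>+\<omega>. ennreal (\<bar>Y \<omega>\<bar> powr \<eta>) \<partial>M) = ennreal my" "my \<ge> 0"
    using Y_moment[OF \<eta>(1,2)] by (cases "(\<integral>\<^sup>+\<omega>. ennreal (\<bar>Y \<omega>\<bar> powr \<eta>) \<partial>M)") auto
  note ph = phi_less_1[OF \<eta>(1,2)] phi_nonneg[of \<eta>]
  \<comment> \<open>The second summand is the fixed point of the moment recursion; adding the
    initial value yields a bound that the recursion preserves.\<close>
  define m where "m = m0 + my / (1 - \<phi> \<eta>)"
  have m: "m \<ge> 0" "m0 \<le> m" "\<phi> \<eta> * m + my \<le> m"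
  proof -
    show "m \<ge> 0" "m0 \<le> m" using m0 my ph by (auto simp: m_def)
    have "\<phi> \<eta> * m0 \<le> m0" using ph m0 by (simp add: mult_left_le_one_le)
    moreover have "\<phi> \<eta> * (my / (1 - \<phi> \<eta>)) + my = my / (1 - \<phi> \<eta>)" using ph by (simp add: field_simps)
    ultimately show "\<phi> \<eta> * m + my \<le> m" by (simp add: m_def distrib_left)
  qed
  have momn: "(\<integral>\<^sup>+z. ennreal (\<bar>z\<bar> powr \<eta>) \<partial>Nn n) \<le> ennreal m" for n
  proof (induction n)
    case 0
    then show ?case using m0 m by (simp add: Nn_0 ennreal_leI)
  next
    case (Suc n)
    have "(\<integral>\<^sup>+z. ennreal (\<bar>z\<bar> powr \<eta>) \<partial>Nn (Suc n)) \<le> ennreal (\<phi> \<eta>) * (\<integral>\<^sup>+z. ennreal (\<bar>z\<bar> powr \<eta>) \<partial>Nn n) + ennreal my"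
      unfolding Nn_Suc my(1)[symmetric] by (rule moment_step[OF prob sets \<eta>(1,3,2)])
    also have "\<dots> \<le> ennreal (\<phi> \<eta>) * ennreal m + ennreal my" by (intro add_right_mono mult_left_mono Suc) simp
    also have "\<dots> = ennreal (\<phi> \<eta> * m + my)" using ph m my by (simp add: ennreal_mult)
    also have "\<dots> \<le> ennreal m" using m by (intro ennreal_leI)
    finally show ?case .
  qed
  define K where "K = 1 / (l - 1)"
  have K: "K > 0" using l by (simp add: K_def)
  define E1 where "E1 x = (\<integral>\<^sup>+\<omega>. ennreal ((1 * A \<omega>) powr \<eta>) * (ennreal (x powr (\<alpha> - \<eta>)) * indicator {x..} (2 * max 0 (Y \<omega>))) \<partial>M)" for x
  define a1 where "a1 = (1 + K powr \<eta>) * m"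
  have a1: "a1 \<ge> 0" using m by (simp add: a1_def)
  define a2 where "a2 = l powr \<alpha> * C1"
  have a2: "a2 > 0" using l C1 by (simp add: a2_def)
  have step: "T (H l (Nn n)) x + ell l x \<le> H l (Nn (Suc n)) x + (ennreal a1 * E1 x + (ennreal a2 * E2 K x + ennreal (l powr \<alpha> * C * \<theta> ^ Suc n * x powr \<beta>)))"
    if x: "x > 0" for n x
  proof -
    have "ennreal (x powr \<alpha>) * (\<integral>\<^sup>+p. ennreal (min 1 (K * max 0 (- Y (snd p)) / x)) * indicator {x<..} (A (snd p) * fst p) \<partial>(Nn n \<Otimes>\<^sub>M M))
      \<le> ennreal (l powr \<alpha> * C1) * E2 K x + ennreal (l powr \<alpha> * (C * \<theta> ^ n) * \<theta> * x powr \<beta>)"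
      using C1 C theta by (intro J_bound prob sets l Hb x) auto
    with lower_step[OF prob sets l x \<eta>(1,3,2) momn m(1), of n] show ?thesis
      unfolding Nn_Suc E1_def a1_def a2_def K_def[symmetric] power_Suc mult.assoc[symmetric]
      by (elim order.trans) (intro add_left_mono; simp add: mult_ac)
  qed
  have "(\<integral>\<^sup>+\<omega>. ennreal (A \<omega> powr \<eta> * max 0 (Y \<omega>) powr (\<alpha> - \<eta>)) \<partial>M) < \<infinity>"
    using nn_integral_eq_integral[OF mixed] by (simp add: max.commute)
  then obtain c1 P1 where P1: "pot P1 E1" "\<And>x. x > 0 \<Longrightarrow> P1 x \<le> ennreal c1" "c1 \<ge> 0"
    using pot_pair[of M A "\<lambda>\<omega>. max 0 (Y \<omega>)" \<eta> 1] A_nonneg \<eta> sigma_finite_measure_axioms unfolding E1_def by auto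
  \<comment> \<open>The negative part of \<open>Y\<close> costs \<open>a2 * \<delta> * w x\<close>,
    and the large jumps cost \<open>\<delta> * w x\<close>; together this is
    \<open>\<epsilon> * w x\<close>.\<close>
  define \<delta> where "\<delta> = \<epsilon> / (a2 + 1)"
  have \<delta>: "\<delta> > 0" using \<epsilon> a2 by (simp add: \<delta>_def)
  obtain c2 P2 where P2: "pot P2 (E2 K)" "\<And>x. x > 0 \<Longrightarrow> P2 x \<le> ennreal (\<delta> * w x + c2)" "c2 \<ge> 0"
    using pot_E2[OF K \<delta>] by blast
  \<comment> \<open>One factor \<open>1 + \<epsilon>\<close> comes from the subsolution property of
    \<open>w\<close>, the other one from replacing \<open>L x\<close> by \<open>L (l * x)\<close>,
    and \<open>l powr \<alpha>\<close> from smoothing the tail of \<open>Y\<close>.\<close>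
  define c where "c = (1 + \<epsilon>)\<^sup>2 * \<rho> * l powr \<alpha>"
  have c: "c > 0" using \<epsilon> rho_pos l by (simp add: c_def)
  obtain K' P3 where K': "K' \<ge> 1" and P3: "pot P3 (eK K')" "\<And>x. x > 0 \<Longrightarrow> P3 x \<le> ennreal (c * \<delta> * (w x + 1))"
    using pot_eK[of "c * \<delta>"] c \<delta> by auto
  obtain x0 where x0: "x0 > 0" "\<And>x. x \<ge> x0 \<Longrightarrow> ennreal (w x) \<le> T (\<lambda>x. ennreal (w x)) x + ennreal ((1 + \<epsilon>) * \<rho> * L x) + eK K' x"
    using w_subsolution[OF \<epsilon> K'] by auto
  have "\<forall>\<^sub>F x in at_top. L (l * x) / L x > 1 / (1 + \<epsilon>)"
    using \<epsilon> l by (intro order_tendstoD(1)[OF L_lim]) auto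
  then obtain x1 where x1: "\<And>x. x \<ge> x1 \<Longrightarrow> L (l * x) / L x > 1 / (1 + \<epsilon>)" by (auto simp: eventually_at_top_linorder)
  define x2 where "x2 = max x0 x1"
  have x2: "x2 > 0" using x0 by (simp add: x2_def)
  define lo where "lo x = ennreal (x powr \<beta>) * indicator {..x2} x" for x :: real
  have wsub: "ennreal (w x) \<le> T (\<lambda>x. ennreal (w x)) x + ennreal c * ell l x + (eK K' x + ennreal Cw * lo x)" if x: "x > 0" for x
  proof (cases "x \<le> x2")
    case True
    have "ennreal (w x) \<le> ennreal Cw * lo x" using Cw x True by (simp add: lo_def ennreal_mult[symmetric] ennreal_leI)
    then show ?thesis by (simp add: add_increasing)
  next
    case False
    have Lx: "L x > 0" using x by (rule L_pos)
    have "L (l * x) / L x > 1 / (1 + \<epsilon>)" using False by (intro x1) (simp add: x2_def)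
    then have "L x \<le> (1 + \<epsilon>) * L (l * x)" using Lx \<epsilon> by (simp add: field_simps)
    then have "ennreal ((1 + \<epsilon>) * \<rho> * L x) \<le> ennreal ((1 + \<epsilon>) * \<rho> * ((1 + \<epsilon>) * L (l * x)))"
      using \<epsilon> rho_pos by (intro ennreal_leI mult_left_mono) auto
    also have "\<dots> = ennreal ((1 + \<epsilon>)\<^sup>2 * \<rho>) * ennreal (L (l * x))"
      using \<epsilon> rho_pos L_pos[of "l * x"] l x by (simp add: ennreal_mult[symmetric] power2_eq_square mult_ac)
    also have "\<dots> \<le> ennreal ((1 + \<epsilon>)\<^sup>2 * \<rho>) * (ennreal (l powr \<alpha>) * ell l x)"
      by (intro mult_left_mono ell_ge l x) simp
    also have "\<dots> = ennreal c * ell l x" using rho_pos by (simp add: c_def ennreal_mult mult.assoc)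
    finally have "ennreal ((1 + \<epsilon>) * \<rho> * L x) \<le> ennreal c * ell l x" .
    then have "T (\<lambda>x. ennreal (w x)) x + ennreal ((1 + \<epsilon>) * \<rho> * L x) + eK K' x \<le> T (\<lambda>x. ennreal (w x)) x + ennreal c * ell l x + (eK K' x + ennreal Cw * lo x)"
      by (intro add_mono order.refl) simp_all
    moreover have "x \<ge> x0" using False by (simp add: x2_def)
    ultimately show ?thesis using order.trans[OF x0(2)] by blast
  qed
  define u where "u x = ennreal (1 / c) * ennreal (w x)" for x
  have um [measurable]: "u \<in> borel_measurable borel" unfolding u_def by measurable
  have c1: "ennreal (1 / c) * ennreal c = 1" using c by (simp add: ennreal_mult[symmetric])
  define R where "R x = ennreal (1 / c) * (eK K' x + ennreal Cw * lo x)" for x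
  have usub: "u x \<le> T u x + ell l x + R x" if "x > 0" for x
  proof -
    have "u x \<le> ennreal (1 / c) * (T (\<lambda>x. ennreal (w x)) x + ennreal c * ell l x + (eK K' x + ennreal Cw * lo x))"
      unfolding u_def by (intro mult_left_mono wsub that) simp
    also have "\<dots> = ennreal (1 / c) * T (\<lambda>x. ennreal (w x)) x + (ennreal (1 / c) * ennreal c) * ell l x + R x"
      unfolding R_def by (simp only: distrib_left mult.assoc)
    also have "ennreal (1 / c) * T (\<lambda>x. ennreal (w x)) x = T u x" unfolding u_def by (rule T_cmult[symmetric]) measurable
    finally show ?thesis unfolding c1 by simp
  qed
  define P4 where "P4 x = ennreal (1 / (1 - \<theta>)) * ennreal (min x x2 powr \<beta>)" for x
  have P4: "pot P4 lo" unfolding P4_def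
  proof (rule pot_const_mult_le)
    show "pot (\<lambda>x. ennreal (min x x2 powr \<beta>)) (\<lambda>x. ennreal ((1 - \<theta>) * x powr \<beta>) * indicator {..x2} x)"
      unfolding \<theta>_def using beta x2 by (intro pot_min_powr) auto
    show "1 / (1 - \<theta>) > 0" using theta by simp
    fix x :: real assume x: "x > 0"
    have "1 / (1 - \<theta>) * ((1 - \<theta>) * x powr \<beta>) = x powr \<beta>" using theta by simp
    then have "ennreal (1 / (1 - \<theta>)) * ennreal ((1 - \<theta>) * x powr \<beta>) = ennreal (x powr \<beta>)"
      using theta by (subst ennreal_mult[symmetric]) auto
    then show "lo x \<le> ennreal (1 / (1 - \<theta>)) * (ennreal ((1 - \<theta>) * x powr \<beta>) * indicator {..x2} x)"
      by (simp add: lo_def mult.assoc[symmetric])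
  qed
  define Z where "Z x = (ennreal a1 * P1 x + ennreal a2 * P2 x) + ennreal (1 / c) * (P3 x + ennreal Cw * P4 x)" for x
  have Z: "pot Z (\<lambda>x. (ennreal a1 * E1 x + ennreal a2 * E2 K x) + R x)"
    unfolding Z_def R_def by (intro pot_add pot_cmult P1 P2 P3 P4)
  \<comment> \<open>Solves \<open>D (n + 1) = \<theta> * D n + l powr \<alpha> * C * \<theta> ^ (n +
    1)\<close>: the old error is contracted, and the decaying part of the a priori bound is added.
    The linear factor \<open>n\<close> does not prevent \<open>D n\<close> from tending to
    0.\<close>
  define D where "D n = \<theta> ^ n * (Cw / c + real n * (l powr \<alpha> * C))" for n :: nat
  have D0: "D n \<ge> 0" for n using theta Cw(1) c C by (simp add: D_def)
  have main: "u x \<le> H l (Nn n) x + Z x + ennreal (D n * x powr \<beta>)" if "x > 0" for n x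
    using that
  proof (induction n arbitrary: x)
    case 0
    have "u x \<le> ennreal (1 / c) * ennreal (Cw * x powr \<beta>)" unfolding u_def using 0 Cw by (intro mult_left_mono ennreal_leI) auto
    also have "\<dots> = ennreal (D 0 * x powr \<beta>)" using c Cw(1) by (simp add: ennreal_mult[symmetric] D_def)
    finally show ?case by (simp add: add_increasing)
  next
    case (Suc n)
    have [measurable]: "H l (Nn n) \<in> borel_measurable borel" by (intro H_meas prob sets)
    have [measurable]: "Z \<in> borel_measurable borel" using Z by (simp add: pot_def)
    note x = Suc.prems
    have "T u x \<le> T (\<lambda>x. H l (Nn n) x + Z x + ennreal (D n * x powr \<beta>)) x" by (rule T_mono[OF Suc.IH x])
    also have "\<dots> = T (H l (Nn n)) x + T Z x + ennreal (D n * \<theta> * x powr \<beta>)"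
      using D0 x by (simp add: T_add T_powr_beta)
    finally have Tu: "T u x \<le> T (H l (Nn n)) x + T Z x + ennreal (D n * \<theta> * x powr \<beta>)" .
    define E where "E = ennreal (l powr \<alpha> * C * \<theta> ^ Suc n * x powr \<beta>)"
    have "u x \<le> T u x + ell l x + R x" by (rule usub[OF x])
    also have "\<dots> \<le> T (H l (Nn n)) x + T Z x + ennreal (D n * \<theta> * x powr \<beta>) + ell l x + R x"
      by (intro add_right_mono Tu)
    also have "\<dots> = (T (H l (Nn n)) x + ell l x) + (T Z x + R x + ennreal (D n * \<theta> * x powr \<beta>))"
      by (simp only: ac_simps)
    also have "\<dots> \<le> (H l (Nn (Suc n)) x + (ennreal a1 * E1 x + (ennreal a2 * E2 K x + E))) + (T Z x + R x + ennreal (D n * \<theta> * x powr \<beta>))"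
      unfolding E_def by (intro add_right_mono step x)
    also have "\<dots> = H l (Nn (Suc n)) x + (T Z x + ((ennreal a1 * E1 x + ennreal a2 * E2 K x) + R x)) + (E + ennreal (D n * \<theta> * x powr \<beta>))"
      by (simp only: ac_simps)
    also have "\<dots> \<le> H l (Nn (Suc n)) x + Z x + (E + ennreal (D n * \<theta> * x powr \<beta>))"
      using Z x by (intro add_right_mono add_left_mono) (auto simp: pot_def)
    also have "E + ennreal (D n * \<theta> * x powr \<beta>) = ennreal (D (Suc n) * x powr \<beta>)"
    proof -
      have "l powr \<alpha> * C * \<theta> ^ Suc n * x powr \<beta> + D n * \<theta> * x powr \<beta> = D (Suc n) * x powr \<beta>"
        by (simp add: D_def algebra_simps)
      then show ?thesis unfolding E_def using D0 theta C by (subst ennreal_plus[symmetric]) auto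
    qed
    finally show ?case .
  qed
  have Dlim: "D \<longlonglongrightarrow> 0"
  proof -
    have "norm \<theta> < 1" using theta by simp
    then have "(\<lambda>n. \<theta> ^ n * (Cw / c) + of_nat n * \<theta> ^ n * (l powr \<alpha> * C)) \<longlonglongrightarrow> 0 * (Cw / c) + 0 * (l powr \<alpha> * C)"
      by (intro tendsto_intros LIMSEQ_power_zero powser_times_n_limit_0)
    then show ?thesis unfolding D_def[abs_def] by (simp add: distrib_left mult_ac)
  qed
  have uH: "u x \<le> H l N0 x + Z x" if x: "x > 0" for x
  proof (rule ennreal_le_epsilon)
    fix e :: real assume e: "e > 0"
    have "(\<lambda>n. D n * x powr \<beta>) \<longlonglongrightarrow> 0 * x powr \<beta>" by (intro tendsto_mult Dlim tendsto_const)
    then have "\<forall>\<^sub>F n in sequentially. D n * x powr \<beta> < e" using e by (intro order_tendstoD(2)) auto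
    then obtain n where n: "D n * x powr \<beta> < e" using eventually_happens'[OF sequentially_bot] by blast
    have mono: "mono (\<lambda>z. ennreal (ramp l (z / x)))" using l x by (intro monoI ennreal_leI ramp_mono divide_right_mono) auto
    have "H l (Nn n) x \<le> H l N0 x"
      unfolding H_def using st_leD[OF dom mono, of n] by (intro mult_left_mono) (auto simp: Nn_0)
    then have "H l (Nn n) x + Z x + ennreal (D n * x powr \<beta>) \<le> H l N0 x + Z x + ennreal e"
      using n by (intro add_mono ennreal_leI) auto
    with main[OF x, of n] show "u x \<le> H l N0 x + Z x + ennreal e" by (rule order.trans)
  qed
  define C' where "C' = a1 * c1 + a2 * c2 + (1 / c) * (c * \<delta> + Cw * (1 / (1 - \<theta>) * x2 powr \<beta>))"
  have C'0: "C' \<ge> 0" using a1 P1(3) a2 P2(3) c \<delta> Cw(1) theta by (simp add: C'_def)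
  have Zb: "Z x \<le> ennreal (\<epsilon> * w x + C')" if x: "x > 0" for x
  proof -
    have P4b: "P4 x \<le> ennreal (1 / (1 - \<theta>) * x2 powr \<beta>)"
      unfolding P4_def using theta x x2 beta
      by (subst ennreal_mult[symmetric]) (auto intro!: ennreal_leI divide_right_mono powr_mono2)
    have "Z x \<le> (ennreal a1 * ennreal c1 + ennreal a2 * ennreal (\<delta> * w x + c2)) + ennreal (1 / c) * (ennreal (c * \<delta> * (w x + 1)) + ennreal Cw * ennreal (1 / (1 - \<theta>) * x2 powr \<beta>))"
      unfolding Z_def by (intro add_mono mult_left_mono P1 P2 P3 P4b x) auto
    also have "\<dots> = ennreal ((a1 * c1 + a2 * (\<delta> * w x + c2)) + 1 / c * (c * \<delta> * (w x + 1) + Cw * (1 / (1 - \<theta>) * x2 powr \<beta>)))"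
      using a1 P1(3) a2 P2(3) c \<delta> Cw(1) theta w_nonneg[of x]
      by (simp add: ennreal_mult[symmetric] ennreal_plus[symmetric] del: ennreal_plus)
    also have "(a1 * c1 + a2 * (\<delta> * w x + c2)) + 1 / c * (c * \<delta> * (w x + 1) + Cw * (1 / (1 - \<theta>) * x2 powr \<beta>)) = \<delta> * (a2 + 1) * w x + C'"
      using c by (simp add: C'_def field_simps)
    also have "\<delta> * (a2 + 1) = \<epsilon>" using a2 by (simp add: \<delta>_def)
    finally show ?thesis .
  qed
  have "ennreal (w x / c) \<le> H l N0 x + ennreal (\<epsilon> * w x + C')" if x: "x > 0" for x
  proof -
    have "ennreal (w x / c) = u x" using c w_nonneg[of x] by (simp add: u_def ennreal_mult[symmetric])
    also have "\<dots> \<le> H l N0 x + Z x" by (rule uH[OF x])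
    also have "\<dots> \<le> H l N0 x + ennreal (\<epsilon> * w x + C')" by (intro add_left_mono Zb x)
    finally show ?thesis .
  qed
  with C'0 show ?thesis unfolding c_def by blast
qed

end

section \<open>Moments of the stationary law\<close>

context tilted_multiplier
begin

text \<open>The analogue of \<open>T\<close> at an exponent \<open>s < \<alpha>\<close>; constants
  are now contracted by the factor \<open>\<phi> s\<close>.\<close>

definition S :: "real \<Rightarrow> (real \<Rightarrow> ennreal) \<Rightarrow> real \<Rightarrow> ennreal" where
  "S s u x = (\<integral>\<^sup>+\<omega>. ennreal (A \<omega> powr s) * u (x / A \<omega>) \<partial>M)"

text \<open>Under iteration the constant part settles at a fixed point, and x^\<gamma> is
  contracted. The power x^s is not, since \<open>S s\<close> only maps it to at most itself; hence
  the condition \<open>a * e = e\<close>. It covers two uses: \<open>a = 1\<close> with a small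
  positive \<open>e\<close>, and \<open>a > 1\<close> with \<open>e = 0\<close>.\<close>

lemma S_iterate:
  assumes [measurable]: "u \<in> borel_measurable borel" and s: "0 < \<gamma>" "\<gamma> < s" "s < \<alpha>"
    and a: "a \<ge> 0" "a * e = e" "e \<ge> 0" and c: "c \<ge> 0" "C \<ge> 0"
    and step: "\<And>x. x > 0 \<Longrightarrow> u x \<le> ennreal a * S s u x + ennreal c"
    and base: "\<And>x. x > 0 \<Longrightarrow> u x \<le> ennreal (e * x powr s) + ennreal (C * x powr \<gamma>)"
    and contr: "a * \<phi> s < 1" "a * \<phi> (s - \<gamma>) < 1" and x: "x > 0"
  shows "u x \<le> ennreal (c / (1 - a * \<phi> s)) + ennreal (e * x powr s)"
proof -
  define t where "t = a * \<phi> (s - \<gamma>)"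
  have t: "0 \<le> t" "t < 1" using a contr phi_nonneg by (auto simp: t_def)
  define c' where "c' = c / (1 - a * \<phi> s)"
  have c': "c' \<ge> 0" "a * (c' * \<phi> s) + c = c'"
  proof -
    show "c' \<ge> 0" using contr c by (simp add: c'_def)
    have "c = c' * (1 - a * \<phi> s)" using contr by (simp add: c'_def)
    then show "a * (c' * \<phi> s) + c = c'" by (simp add: algebra_simps)
  qed
  have it: "u x \<le> ennreal c' + ennreal (e * x powr s) + ennreal (C * t ^ n * x powr \<gamma>)" if "x > 0" for n x
    using that
  proof (induction n arbitrary: x)
    case 0
    then show ?case using base[of x] by (simp add: add.assoc add_increasing)
  next
    case (Suc n)
    note x = Suc.prems
    have "S s u x \<le> (\<integral>\<^sup>+\<omega>. ennreal c' * ennreal (A \<omega> powr s) + ennreal (e * x powr s) + ennreal (C * t ^ n * x powr \<gamma>) * ennreal (A \<omega> powr (s - \<gamma>)) \<partial>M)"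
      unfolding S_def
    proof (rule nn_integral_mono)
      fix \<omega>
      show "ennreal (A \<omega> powr s) * u (x / A \<omega>) \<le> ennreal c' * ennreal (A \<omega> powr s) + ennreal (e * x powr s) + ennreal (C * t ^ n * x powr \<gamma>) * ennreal (A \<omega> powr (s - \<gamma>))"
      proof (cases "A \<omega> = 0")
        case False
        then have A0: "A \<omega> > 0" using A_nonneg[of \<omega>] by simp
        have "ennreal (A \<omega> powr s) * u (x / A \<omega>) \<le> ennreal (A \<omega> powr s) * (ennreal c' + ennreal (e * (x / A \<omega>) powr s) + ennreal (C * t ^ n * (x / A \<omega>) powr \<gamma>))"
          using A0 x by (intro mult_left_mono Suc.IH) auto
        also have "\<dots> = ennreal (A \<omega> powr s * c' + A \<omega> powr s * (e * (x / A \<omega>) powr s) + A \<omega> powr s * (C * t ^ n * (x / A \<omega>) powr \<gamma>))"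
          using c' a c t by (simp add: distrib_left ennreal_mult[symmetric])
        also have "A \<omega> powr s * (e * (x / A \<omega>) powr s) = e * x powr s" using A0 x by (simp add: powr_divide)
        also have "A \<omega> powr s * (C * t ^ n * (x / A \<omega>) powr \<gamma>) = C * t ^ n * x powr \<gamma> * A \<omega> powr (s - \<gamma>)"
          using A0 x by (simp add: powr_divide powr_diff)
        also have "ennreal (A \<omega> powr s * c' + e * x powr s + C * t ^ n * x powr \<gamma> * A \<omega> powr (s - \<gamma>)) =
           ennreal c' * ennreal (A \<omega> powr s) + ennreal (e * x powr s) + ennreal (C * t ^ n * x powr \<gamma>) * ennreal (A \<omega> powr (s - \<gamma>))"
          using c' a c t by (simp add: ennreal_mult[symmetric] mult_ac)
        finally show ?thesis .
      qed simp
    qed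
    also have "\<dots> = ennreal c' * ennreal (\<phi> s) + ennreal (e * x powr s) + ennreal (C * t ^ n * x powr \<gamma>) * ennreal (\<phi> (s - \<gamma>))"
      using s by (simp add: nn_integral_add nn_integral_cmult nn_A_powr emeasure_space_1)
    also have "\<dots> = ennreal (c' * \<phi> s + e * x powr s + C * t ^ n * x powr \<gamma> * \<phi> (s - \<gamma>))"
      using c' a c t phi_nonneg by (simp add: ennreal_mult[symmetric])
    finally have "u x \<le> ennreal a * ennreal (c' * \<phi> s + e * x powr s + C * t ^ n * x powr \<gamma> * \<phi> (s - \<gamma>)) + ennreal c"
      using step[OF x] by (meson add_right_mono mult_left_mono order.trans zero_le)
    also have "\<dots> = ennreal (a * (c' * \<phi> s + e * x powr s + C * t ^ n * x powr \<gamma> * \<phi> (s - \<gamma>)) + c)"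
      using c' a c t phi_nonneg by (simp add: ennreal_mult[symmetric] ennreal_plus[symmetric] del: ennreal_plus)
    also have "a * (c' * \<phi> s + e * x powr s + C * t ^ n * x powr \<gamma> * \<phi> (s - \<gamma>)) + c
       = (a * (c' * \<phi> s) + c) + (a * e) * x powr s + C * t ^ n * (a * \<phi> (s - \<gamma>)) * x powr \<gamma>"
      by (simp add: algebra_simps)
    also have "\<dots> = c' + e * x powr s + C * t ^ Suc n * x powr \<gamma>" unfolding c'(2) a(2) t_def[symmetric] by simp
    finally show ?case using c' a c t by (simp add: ennreal_plus[symmetric] del: ennreal_plus)
  qed
  show ?thesis
  proof (rule ennreal_le_epsilon)
    fix d :: real assume d: "d > 0"
    have "(\<lambda>n. C * t ^ n * x powr \<gamma>) \<longlonglongrightarrow> C * 0 * x powr \<gamma>"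
      using t by (intro tendsto_intros LIMSEQ_power_zero) auto
    then have "\<forall>\<^sub>F n in sequentially. C * t ^ n * x powr \<gamma> < d" using d by (intro order_tendstoD(2)) auto
    then obtain n where n: "C * t ^ n * x powr \<gamma> < d" using eventually_happens'[OF sequentially_bot] by blast
    have "ennreal c' + ennreal (e * x powr s) + ennreal (C * t ^ n * x powr \<gamma>) \<le> ennreal c' + ennreal (e * x powr s) + ennreal d"
      using n by (intro add_left_mono ennreal_leI) auto
    with it[OF x, of n] show "u x \<le> ennreal (c / (1 - a * \<phi> s)) + ennreal (e * x powr s) + ennreal d"
      unfolding c'_def by (rule order.trans)
  qed
qed

text \<open>Truncation keeps every quantity finite before any moment is known. It is compatible with
  the recursion through \<open>min (A * \<bar>z\<bar>) x = A * min \<bar>z\<bar> (x / A)\<close>,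
  which moves the truncation level and thereby produces \<open>S s\<close>.\<close>

lemma truncated_step:
  assumes N: "prob_space N" and sets [measurable_cong]: "sets N = sets borel"
    and [measurable]: "Z \<in> borel_measurable M" and Z0: "\<And>\<omega>. Z \<omega> \<ge> 0"
    and dom: "\<And>h::real \<Rightarrow> ennreal. mono h \<Longrightarrow> h \<in> borel_measurable borel \<Longrightarrow>
      (\<integral>\<^sup>+z. h \<bar>z\<bar> \<partial>N) \<le> (\<integral>\<^sup>+z. \<integral>\<^sup>+\<omega>. h (A \<omega> * \<bar>z\<bar> + Z \<omega>) \<partial>M \<partial>N)"
    and s: "0 < s" and a: "a \<ge> 0" "K \<ge> 0"
    and sub: "\<And>p r. p \<ge> 0 \<Longrightarrow> r \<ge> 0 \<Longrightarrow> (p + r) powr s \<le> a * p powr s + K * r powr s"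
    and x: "x > 0"
  shows "(\<integral>\<^sup>+z. ennreal (min \<bar>z\<bar> x powr s) \<partial>N)
    \<le> ennreal a * S s (\<lambda>x. \<integral>\<^sup>+z. ennreal (min \<bar>z\<bar> x powr s) \<partial>N) x + ennreal K * (\<integral>\<^sup>+\<omega>. ennreal (Z \<omega> powr s) \<partial>M)"
proof -
  interpret N: prob_space N by fact
  interpret pair_sigma_finite N M ..
  define h where "h t = ennreal (min (max 0 t) x powr s)" for t
  have [measurable]: "h \<in> borel_measurable borel" unfolding h_def by measurable
  have h: "mono h" unfolding h_def using s x by (intro monoI ennreal_leI powr_mono2 min.mono max.mono) auto
  have "(\<integral>\<^sup>+z. ennreal (min \<bar>z\<bar> x powr s) \<partial>N) = (\<integral>\<^sup>+z. h \<bar>z\<bar> \<partial>N)" by (simp add: h_def)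
  also have "\<dots> \<le> (\<integral>\<^sup>+z. \<integral>\<^sup>+\<omega>. h (A \<omega> * \<bar>z\<bar> + Z \<omega>) \<partial>M \<partial>N)" by (rule dom[OF h]) measurable
  also have "\<dots> \<le> (\<integral>\<^sup>+z. \<integral>\<^sup>+\<omega>. ennreal a * (ennreal (A \<omega> powr s) * ennreal (min \<bar>z\<bar> (x / A \<omega>) powr s)) + ennreal K * ennreal (Z \<omega> powr s) \<partial>M \<partial>N)"
  proof (intro nn_integral_mono)
    fix z \<omega>
    have "min (max 0 (A \<omega> * \<bar>z\<bar> + Z \<omega>)) x powr s \<le> (min (A \<omega> * \<bar>z\<bar>) x + Z \<omega>) powr s"
      using s x A_nonneg[of \<omega>] Z0[of \<omega>] by (intro powr_mono2) (auto simp: min_def)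
    also have "\<dots> \<le> a * min (A \<omega> * \<bar>z\<bar>) x powr s + K * Z \<omega> powr s"
      using x A_nonneg[of \<omega>] Z0[of \<omega>] by (intro sub) auto
    also have "min (A \<omega> * \<bar>z\<bar>) x powr s = A \<omega> powr s * min \<bar>z\<bar> (x / A \<omega>) powr s"
    proof (cases "A \<omega> = 0")
      case False
      then have A0: "A \<omega> > 0" using A_nonneg[of \<omega>] by simp
      have "min (A \<omega> * \<bar>z\<bar>) x = A \<omega> * min \<bar>z\<bar> (x / A \<omega>)" using A0 by (auto simp: min_def field_simps)
      then show ?thesis using A0 x by (simp add: powr_mult)
    qed (use x in auto)
    finally have "h (A \<omega> * \<bar>z\<bar> + Z \<omega>) \<le> ennreal (a * (A \<omega> powr s * min \<bar>z\<bar> (x / A \<omega>) powr s) + K * Z \<omega> powr s)"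
      unfolding h_def by (rule ennreal_leI)
    also have "\<dots> = ennreal a * (ennreal (A \<omega> powr s) * ennreal (min \<bar>z\<bar> (x / A \<omega>) powr s)) + ennreal K * ennreal (Z \<omega> powr s)"
      using a by (simp add: ennreal_mult)
    finally show "h (A \<omega> * \<bar>z\<bar> + Z \<omega>) \<le> ennreal a * (ennreal (A \<omega> powr s) * ennreal (min \<bar>z\<bar> (x / A \<omega>) powr s)) + ennreal K * ennreal (Z \<omega> powr s)" .
  qed
  also have "\<dots> = ennreal a * (\<integral>\<^sup>+z. \<integral>\<^sup>+\<omega>. ennreal (A \<omega> powr s) * ennreal (min \<bar>z\<bar> (x / A \<omega>) powr s) \<partial>M \<partial>N) + ennreal K * (\<integral>\<^sup>+\<omega>. ennreal (Z \<omega> powr s) \<partial>M)"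
    by (simp add: nn_integral_add nn_integral_cmult N.emeasure_space_1)
  also have "(\<integral>\<^sup>+z. \<integral>\<^sup>+\<omega>. ennreal (A \<omega> powr s) * ennreal (min \<bar>z\<bar> (x / A \<omega>) powr s) \<partial>M \<partial>N)
     = (\<integral>\<^sup>+\<omega>. \<integral>\<^sup>+z. ennreal (A \<omega> powr s) * ennreal (min \<bar>z\<bar> (x / A \<omega>) powr s) \<partial>N \<partial>M)"
    by (rule Fubini'[symmetric]) measurable
  also have "\<dots> = S s (\<lambda>x. \<integral>\<^sup>+z. ennreal (min \<bar>z\<bar> x powr s) \<partial>N) x"
    unfolding S_def by (intro nn_integral_cong nn_integral_cmult) measurable
  finally show ?thesis .
qed

text \<open>Exponents up to 1 come first, with subadditivity and tightness of the law as the only a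
  priori information. Larger exponents are then bootstrapped from the moment of order 1/2.\<close>

lemma stationary_moment:
  assumes N: "prob_space N" and sets [measurable_cong]: "sets N = sets borel"
    and Zm [measurable]: "Z \<in> borel_measurable M" and Z0: "\<And>\<omega>. Z \<omega> \<ge> 0"
    and Zmom: "\<And>s. 0 < s \<Longrightarrow> s < \<alpha> \<Longrightarrow> (\<integral>\<^sup>+\<omega>. ennreal (Z \<omega> powr s) \<partial>M) < \<infinity>"
    and dom: "\<And>h::real \<Rightarrow> ennreal. mono h \<Longrightarrow> h \<in> borel_measurable borel \<Longrightarrow>
      (\<integral>\<^sup>+z. h \<bar>z\<bar> \<partial>N) \<le> (\<integral>\<^sup>+z. \<integral>\<^sup>+\<omega>. h (A \<omega> * \<bar>z\<bar> + Z \<omega>) \<partial>M \<partial>N)"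
    and s: "0 < s" "s < \<alpha>"
  shows "(\<integral>\<^sup>+z. ennreal (\<bar>z\<bar> powr s) \<partial>N) < \<infinity>"
proof -
  interpret N: prob_space N by fact
  define u where "u s x = (\<integral>\<^sup>+z. ennreal (min \<bar>z\<bar> x powr s) \<partial>N)" for s x
  have u_eq: "u s = (\<lambda>x. \<integral>\<^sup>+z. ennreal (min \<bar>z\<bar> x powr s) \<partial>N)" for s by (rule ext) (rule u_def)
  have um [measurable]: "u s \<in> borel_measurable borel" for s unfolding u_eq by measurable
  have small: "(\<integral>\<^sup>+z. ennreal (\<bar>z\<bar> powr r) \<partial>N) < \<infinity>" if r: "0 < r" "r \<le> 1" "r < \<alpha>" for r
  proof -
    obtain c where c: "(\<integral>\<^sup>+\<omega>. ennreal (Z \<omega> powr r) \<partial>M) = ennreal c" "c \<ge> 0"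
      using Zmom[of r] r by (cases "(\<integral>\<^sup>+\<omega>. ennreal (Z \<omega> powr r) \<partial>M)") auto
    have step: "u r x \<le> ennreal 1 * S r (u r) x + ennreal c" if "x > 0" for x
    proof -
      have sub: "(p + t) powr r \<le> 1 * p powr r + 1 * t powr r" if "p \<ge> 0" "t \<ge> 0" for p t :: real
        using powr_subadd[OF that r(1,2)] by simp
      have "u r x \<le> ennreal 1 * S r (u r) x + ennreal 1 * (\<integral>\<^sup>+\<omega>. ennreal (Z \<omega> powr r) \<partial>M)"
        unfolding u_eq by (rule truncated_step[OF N sets Zm Z0 dom r(1) _ _ sub that]) simp_all
      then show ?thesis unfolding c(1) by (simp only: ennreal_1 mult_1)
    qed
    have lim: "(\<lambda>n. measure N {z. \<bar>z\<bar> > real n}) \<longlonglongrightarrow> 0"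
    proof -
      have "(\<lambda>n. measure N {z. \<bar>z\<bar> > real n}) \<longlonglongrightarrow> measure N (\<Inter>n. {z. \<bar>z\<bar> > real n})"
        by (rule N.finite_Lim_measure_decseq) (auto simp: decseq_def)
      moreover have "(\<Inter>n. {z::real. \<bar>z\<bar> > real n}) = {}"
      proof -
        have "\<exists>n. \<not> \<bar>z\<bar> > real n" for z :: real using reals_Archimedean2[of "\<bar>z\<bar>"] less_asym by blast
        then show ?thesis by blast
      qed
      ultimately show ?thesis by simp
    qed
    define c' where "c' = c / (1 - 1 * \<phi> r)"
    have ub: "u r x \<le> ennreal c'" if x: "x > 0" for x
    proof (rule ennreal_le_epsilon)
      fix d :: real assume d: "d > 0"
      \<comment> \<open>The coefficient of x^r is not contracted, so it is fitted to the given
        \<open>x\<close>: the term \<open>e * x powr r\<close> equals the tolerated error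
        \<open>d\<close>.\<close>
      define e where "e = d / x powr r"
      have e: "e > 0" using d x by (simp add: e_def)
      obtain n where n: "measure N {z. \<bar>z\<bar> > real n} < e"
        using eventually_happens'[OF sequentially_bot order_tendstoD(2)[OF lim e]] by blast
      \<comment> \<open>Values beyond \<open>n\<close> have mass below \<open>e\<close>; for the
        others half of the exponent is traded for a power of \<open>n\<close>, which leaves growth
        of order r/2 only.\<close>
      have base: "u r y \<le> ennreal (e * y powr r) + ennreal (real n powr (r / 2) * y powr (r / 2))" if y: "y > 0" for y
      proof -
        have "u r y \<le> (\<integral>\<^sup>+z. ennreal (y powr r) * indicator {z. \<bar>z\<bar> > real n} z + ennreal (real n powr (r / 2) * y powr (r / 2)) \<partial>N)"
          unfolding u_def
        proof (rule nn_integral_mono)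
          fix z :: real
          show "ennreal (min \<bar>z\<bar> y powr r) \<le> ennreal (y powr r) * indicator {z. \<bar>z\<bar> > real n} z + ennreal (real n powr (r / 2) * y powr (r / 2))"
          proof (cases "\<bar>z\<bar> > real n")
            case True
            have "min \<bar>z\<bar> y powr r \<le> y powr r" using y r by (intro powr_mono2) auto
            then show ?thesis using True by (simp add: add_increasing2 ennreal_leI)
          next
            case False
            have "min \<bar>z\<bar> y powr r = min \<bar>z\<bar> y powr (r / 2) * min \<bar>z\<bar> y powr (r / 2)" by (simp add: powr_add[symmetric])
            also have "\<dots> \<le> real n powr (r / 2) * y powr (r / 2)" using False y r by (intro mult_mono powr_mono2) auto
            finally show ?thesis using False by (simp add: ennreal_leI)
          qed
        qed
        also have "\<dots> = ennreal (y powr r) * emeasure N {z. \<bar>z\<bar> > real n} + ennreal (real n powr (r / 2) * y powr (r / 2))"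
          by (subst nn_integral_add) (auto simp: nn_integral_cmult N.emeasure_space_1)
        also have "ennreal (y powr r) * emeasure N {z. \<bar>z\<bar> > real n} \<le> ennreal (e * y powr r)"
        proof -
          have "y powr r * measure N {z. \<bar>z\<bar> > real n} \<le> y powr r * e" using n by (intro mult_left_mono) auto
          then show ?thesis
            by (simp add: N.emeasure_eq_measure ennreal_mult[symmetric] mult.commute[of e] ennreal_leI)
        qed
        finally show ?thesis by (simp add: add_right_mono)
      qed
      have "u r x \<le> ennreal (c / (1 - 1 * \<phi> r)) + ennreal (e * x powr r)"
        by (rule S_iterate[OF _ _ _ r(3) _ _ _ c(2) _ step base _ _ x])
           (use r e phi_less_1[of r] phi_less_1[of "r / 2"] in auto)
      then show "u r x \<le> ennreal c' + ennreal d" using x by (simp add: c'_def e_def)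
    qed
    have "(\<integral>\<^sup>+z. ennreal (\<bar>z\<bar> powr r) \<partial>N) \<le> ennreal c'"
      using truncated_moment_sup[OF sets r(1)] ub unfolding u_def by blast
    then show ?thesis by (rule le_less_trans) simp
  qed
  show ?thesis
  proof (cases "s \<le> 1")
    case True
    then show ?thesis using small s by blast
  next
    case False
    \<comment> \<open>Here \<open>s > 1\<close>, so 1/2 is below both \<open>s\<close> and \<alpha>
      and is covered by the first stage.\<close>
    define r where "r = (1 / 2 :: real)"
    have r: "0 < r" "r \<le> 1" "r < \<alpha>" "r < s" using False s by (auto simp: r_def)
    obtain m where m: "(\<integral>\<^sup>+z. ennreal (\<bar>z\<bar> powr r) \<partial>N) = ennreal m" "m \<ge> 0"
      using small[of r] r by (cases "(\<integral>\<^sup>+z. ennreal (\<bar>z\<bar> powr r) \<partial>N)") auto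
    define q where "q = max (\<phi> s) (\<phi> r)"
    have q: "q < 1" "q \<ge> 0" "\<phi> s \<le> q" "\<phi> r \<le> q" using phi_less_1 phi_nonneg[of s] r s by (auto simp: q_def)
    \<comment> \<open>As \<open>q < 1\<close>, this value exceeds 1, as \<open>powr_add_le\<close>
      requires, while \<open>a * q\<close> remains below 1.\<close>
    define a where "a = 2 / (1 + q)"
    have a: "a > 1" "a * q < 1" using q by (auto simp: a_def field_simps)
    obtain K where K: "K \<ge> 0" "\<And>p t. p \<ge> 0 \<Longrightarrow> t \<ge> 0 \<Longrightarrow> (p + t) powr s \<le> (1 + (a - 1)) * p powr s + K * t powr s"
      using powr_add_le[of s "a - 1"] s a by auto
    obtain c where c: "ennreal K * (\<integral>\<^sup>+\<omega>. ennreal (Z \<omega> powr s) \<partial>M) = ennreal c" "c \<ge> 0"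
    proof -
      have "ennreal K * (\<integral>\<^sup>+\<omega>. ennreal (Z \<omega> powr s) \<partial>M) < \<infinity>" using Zmom[OF s] by (simp add: ennreal_mult_less_top)
      then show ?thesis using that by (cases "ennreal K * (\<integral>\<^sup>+\<omega>. ennreal (Z \<omega> powr s) \<partial>M)") auto
    qed
    have step: "u s x \<le> ennreal a * S s (u s) x + ennreal c" if "x > 0" for x
    proof -
      have sub: "(p + t) powr s \<le> a * p powr s + K * t powr s" if "p \<ge> 0" "t \<ge> 0" for p t
        using K(2)[OF that] by simp
      have "u s x \<le> ennreal a * S s (u s) x + ennreal K * (\<integral>\<^sup>+\<omega>. ennreal (Z \<omega> powr s) \<partial>M)"
        unfolding u_eq using a(1) by (intro truncated_step[OF N sets Zm Z0 dom s(1) _ K(1) sub that]) simp_all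
      then show ?thesis unfolding c(1) .
    qed
    have base: "u s x \<le> ennreal (0 * x powr s) + ennreal (m * x powr (s - r))" if x: "x > 0" for x
    proof -
      have "u s x \<le> (\<integral>\<^sup>+z. ennreal (x powr (s - r)) * ennreal (\<bar>z\<bar> powr r) \<partial>N)"
        unfolding u_def
      proof (rule nn_integral_mono)
        fix z :: real
        have "min \<bar>z\<bar> x powr s = min \<bar>z\<bar> x powr (s - r) * min \<bar>z\<bar> x powr r" by (simp add: powr_add[symmetric])
        also have "\<dots> \<le> x powr (s - r) * \<bar>z\<bar> powr r" using x r by (intro mult_mono powr_mono2) auto
        finally show "ennreal (min \<bar>z\<bar> x powr s) \<le> ennreal (x powr (s - r)) * ennreal (\<bar>z\<bar> powr r)"
          by (simp add: ennreal_mult[symmetric] ennreal_leI)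
      qed
      also have "\<dots> = ennreal (x powr (s - r)) * ennreal m" by (simp add: nn_integral_cmult m(1))
      finally show ?thesis using m by (simp add: ennreal_mult mult.commute)
    qed
    have contr: "a * \<phi> s < 1" "a * \<phi> (s - (s - r)) < 1"
    proof -
      have "a * \<phi> s \<le> a * q" by (intro mult_left_mono q) (use a in simp)
      with a(2) show "a * \<phi> s < 1" by linarith
      have "a * \<phi> r \<le> a * q" by (intro mult_left_mono q) (use a in simp)
      with a(2) show "a * \<phi> (s - (s - r)) < 1" by simp
    qed
    have "u s x \<le> ennreal (c / (1 - a * \<phi> s)) + ennreal (0 * x powr s)" if "x > 0" for x
      by (rule S_iterate[OF _ _ _ _ _ _ _ c(2) m(2) step base contr that]) (use r s a in auto)
    then have "(\<integral>\<^sup>+z. ennreal (\<bar>z\<bar> powr s) \<partial>N) \<le> ennreal (c / (1 - a * \<phi> s))"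
      using truncated_moment_sup[OF sets s(1), of "ennreal (c / (1 - a * \<phi> s))"] unfolding u_def by simp
    then show ?thesis by (rule le_less_trans) simp
  qed
qed

end

section \<open>Asymptotic tail bounds for sub- and superstationary laws\<close>

context perpetuity_tail
begin

text \<open>The constant sequence fits \<open>upper_bound\<close>, and the power term vanishes as
  \<open>n\<close> grows. The sharp tail at \<open>x\<close> is at most the smoothed one at
  \<open>x / l\<close>, and the bounded remainder is negligible since \<open>w\<close> is
  unbounded.\<close>

lemma right_upper:
  assumes N: "prob_space N" and sets: "sets N = sets borel" and le: "st_le N (aff N)"
    and mom: "\<And>s. 0 < s \<Longrightarrow> s < \<alpha> \<Longrightarrow> (\<integral>\<^sup>+z. ennreal (\<bar>z\<bar> powr s) \<partial>N) < \<infinity>"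
    and \<epsilon>: "\<epsilon> > 0"
  shows "\<forall>\<^sub>F x in at_top. x powr \<alpha> * measure N {x<..} \<le> (1 + \<epsilon>) / \<rho> * w x"
proof -
  interpret N: prob_space N by fact
  \<comment> \<open>Both losses, \<open>l powr \<alpha>\<close> from smoothing and
    \<open>1 / (1 - \<delta>)\<close> from the supersolution, are set to the square root of
    \<open>k\<close>, so their product is \<open>1 + \<epsilon> / 2\<close>. The other half of
    \<epsilon> absorbs the additive constant.\<close>
  define k where "k = 1 + \<epsilon> / 2"
  have k: "k > 1" using \<epsilon> by (simp add: k_def)
  define l where "l = k powr (1 / (2 * \<alpha>))"
  have l: "l > 1" "l powr \<alpha> = k powr (1 / 2)" using k alpha_pos by (auto simp: l_def powr_powr)
  define \<delta> where "\<delta> = 1 - k powr (- (1 / 2))"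
  have kk: "k powr (- (1 / 2)) < 1" using k powr_less_mono[of "- (1/2)" 0 k] by simp
  have \<delta>: "\<delta> > 0" "\<delta> < 1" using k kk by (auto simp: \<delta>_def)
  have kd: "k powr (1 / 2) / (1 - \<delta>) = k"
  proof -
    have "k powr (1 / 2) / (1 - \<delta>) = k powr (1 / 2) / k powr (- (1 / 2))" by (simp only: \<delta>_def) simp
    also have "\<dots> = k powr (1 / 2 - (- (1 / 2)))" by (rule powr_diff[symmetric])
    also have "\<dots> = k" using k by simp
    finally show ?thesis .
  qed
  obtain C where C: "C \<ge> 0" and Cb: "\<And>n x. x > 0 \<Longrightarrow> H l N x \<le> ennreal (w x / ((1 - \<delta>) * \<rho>)) + ennreal C + ennreal (C * \<theta> ^ n * x powr \<beta>)"
    using upper_bound[of "\<lambda>_. N" l \<delta>] N sets le st_le_refl mom l(1) \<delta> by auto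
  have Hb: "H l N x \<le> ennreal (w x / ((1 - \<delta>) * \<rho>) + C)" if x: "x > 0" for x
  proof (rule ennreal_le_epsilon)
    fix d :: real assume d: "d > 0"
    have "(\<lambda>n. C * \<theta> ^ n * x powr \<beta>) \<longlonglongrightarrow> C * 0 * x powr \<beta>"
      using theta by (intro tendsto_intros LIMSEQ_power_zero) auto
    then have "\<forall>\<^sub>F n in sequentially. C * \<theta> ^ n * x powr \<beta> < d" using d by (intro order_tendstoD(2)) auto
    then obtain n where n: "C * \<theta> ^ n * x powr \<beta> < d" using eventually_happens'[OF sequentially_bot] by blast
    have "ennreal (w x / ((1 - \<delta>) * \<rho>)) + ennreal C + ennreal (C * \<theta> ^ n * x powr \<beta>) \<le> ennreal (w x / ((1 - \<delta>) * \<rho>)) + ennreal C + ennreal d"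
      using n by (intro add_left_mono ennreal_leI) auto
    also have "\<dots> = ennreal (w x / ((1 - \<delta>) * \<rho>) + C) + ennreal d"
      using C \<delta> rho_pos w_nonneg by simp
    finally show "H l N x \<le> ennreal (w x / ((1 - \<delta>) * \<rho>) + C) + ennreal d" using Cb[OF x, of n] by (rule order.trans[rotated])
  qed
  have le: "x powr \<alpha> * measure N {x<..} \<le> k / \<rho> * w x + l powr \<alpha> * C" if x: "x > 0" for x
  proof -
    define y where "y = x / l"
    have y: "y > 0" "y \<le> x" "x = l * y" using x l by (auto simp: y_def field_simps)
    have "emeasure N {x<..} = (\<integral>\<^sup>+z. indicator {x<..} z \<partial>N)" by (simp add: sets)
    also have "\<dots> \<le> (\<integral>\<^sup>+z. ennreal (ramp l (z / y)) \<partial>N)"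
    proof (rule nn_integral_mono)
      fix z
      have "ramp l (z / y) = 1" if "z > x" using that y by (intro ramp_1 l) (simp add: field_simps)
      then show "indicator {x<..} z \<le> ennreal (ramp l (z / y))" by (auto simp: indicator_def)
    qed
    finally have "ennreal (y powr \<alpha>) * emeasure N {x<..} \<le> H l N y" unfolding H_def by (rule mult_left_mono) simp
    also have "\<dots> \<le> ennreal (w y / ((1 - \<delta>) * \<rho>) + C)" by (rule Hb[OF y(1)])
    finally have "ennreal (y powr \<alpha> * measure N {x<..}) \<le> ennreal (w y / ((1 - \<delta>) * \<rho>) + C)"
      by (simp add: N.emeasure_eq_measure ennreal_mult del: ennreal_plus)
    then have "y powr \<alpha> * measure N {x<..} \<le> w y / ((1 - \<delta>) * \<rho>) + C"
      using C \<delta> rho_pos w_nonneg[of y] by (subst (asm) ennreal_le_iff) auto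
    also have "\<dots> \<le> w x / ((1 - \<delta>) * \<rho>) + C"
      using w_mono[OF y(2)] \<delta> rho_pos by (intro add_right_mono divide_right_mono) auto
    finally have "l powr \<alpha> * (y powr \<alpha> * measure N {x<..}) \<le> l powr \<alpha> * (w x / ((1 - \<delta>) * \<rho>) + C)"
      by (rule mult_left_mono) simp
    also have "\<dots> = (k powr (1 / 2) / (1 - \<delta>)) / \<rho> * w x + l powr \<alpha> * C" by (simp add: l(2) distrib_left)
    finally show ?thesis unfolding kd y(3) using l y by (simp add: powr_mult)
  qed
  have "\<forall>\<^sub>F x in at_top. l powr \<alpha> * C * (2 * \<rho> / \<epsilon>) \<le> w x"
    using w_at_top by (simp add: filterlim_at_top)
  then show ?thesis using eventually_gt_at_top[of 0]
  proof eventually_elim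
    case (elim x)
    have "l powr \<alpha> * C \<le> \<epsilon> / 2 / \<rho> * w x" using elim(1) \<epsilon> rho_pos by (simp add: field_simps)
    moreover have "(1 + \<epsilon>) / \<rho> * w x = k / \<rho> * w x + \<epsilon> / 2 / \<rho> * w x" by (simp add: k_def add_divide_distrib distrib_right)
    ultimately show ?case using le[OF elim(2)] by linarith
  qed
qed

text \<open>The ramp lies below the indicator, so the smoothed tail already bounds the sharp one
  from below at the same point, and no shift of \<open>x\<close> is needed.\<close>

lemma right_lower:
  assumes N: "prob_space N" and sets: "sets N = sets borel" and le: "st_le (aff N) N"
    and mom: "\<And>s. 0 < s \<Longrightarrow> s < \<alpha> \<Longrightarrow> (\<integral>\<^sup>+z. ennreal (\<bar>z\<bar> powr s) \<partial>N) < \<infinity>"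
    and \<epsilon>: "\<epsilon> > 0"
  shows "\<forall>\<^sub>F x in at_top. (1 - \<epsilon>) / \<rho> * w x \<le> x powr \<alpha> * measure N {x<..}"
proof -
  interpret N: prob_space N by fact
  \<comment> \<open>With \<open>l powr \<alpha> = 1 + e\<close>, \<open>lower_bound\<close> yields
    this coefficient of \<open>w\<close>; it tends to \<open>1 / \<rho>\<close> as \<open>e\<close>
    tends to 0, which decides how small \<open>e\<close> has to be.\<close>
  have "((\<lambda>e. 1 / ((1 + e)\<^sup>2 * \<rho> * (1 + e)) - e) \<longlongrightarrow> 1 / ((1 + 0)\<^sup>2 * \<rho> * (1 + 0)) - 0) (at_right 0)"
    using rho_pos by (intro tendsto_intros) auto
  moreover have "1 / ((1 + 0)\<^sup>2 * \<rho> * (1 + 0)) - 0 > (1 - \<epsilon>) / \<rho>" using rho_pos \<epsilon> by (simp add: divide_strict_right_mono)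
  ultimately have "\<forall>\<^sub>F e in at_right 0. 1 / ((1 + e)\<^sup>2 * \<rho> * (1 + e)) - e > (1 - \<epsilon>) / \<rho> \<and> e > 0"
    by (intro eventually_conj order_tendstoD(1) eventually_at_right_less) auto
  then obtain e where e: "1 / ((1 + e)\<^sup>2 * \<rho> * (1 + e)) - e > (1 - \<epsilon>) / \<rho>" "e > 0"
    using eventually_happens'[OF trivial_limit_at_right_real] by blast
  define l where "l = (1 + e) powr (1 / \<alpha>)"
  have l: "l > 1" "l powr \<alpha> = 1 + e" using e alpha_pos by (auto simp: l_def powr_powr)
  define c where "c = 1 / ((1 + e)\<^sup>2 * \<rho> * (1 + e))"
  have c: "c > 0" "c - e > (1 - \<epsilon>) / \<rho>" using e rho_pos by (auto simp: c_def)
  obtain C where C: "C \<ge> 0" "\<And>x. x > 0 \<Longrightarrow> ennreal (w x / ((1 + e)\<^sup>2 * \<rho> * l powr \<alpha>)) \<le> H l N x + ennreal (e * w x + C)"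
    using lower_bound[OF N sets le mom l(1) e(2)] by auto
  have le: "c * w x \<le> x powr \<alpha> * measure N {x<..} + (e * w x + C)" if x: "x > 0" for x
  proof -
    have "(\<integral>\<^sup>+z. ennreal (ramp l (z / x)) \<partial>N) \<le> (\<integral>\<^sup>+z. indicator {x<..} z \<partial>N)"
    proof (rule nn_integral_mono)
      fix z
      show "ennreal (ramp l (z / x)) \<le> indicator {x<..} z"
        using ramp_0[OF l(1), of "z / x"] ramp_bounds[of l "z / x"] x by (auto simp: indicator_def ennreal_le_1)
    qed
    then have "H l N x \<le> ennreal (x powr \<alpha>) * ennreal (measure N {x<..})"
      unfolding H_def by (intro mult_left_mono) (auto simp: sets N.emeasure_eq_measure)
    then have "ennreal (c * w x) \<le> ennreal (x powr \<alpha>) * ennreal (measure N {x<..}) + ennreal (e * w x + C)"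
      using order.trans[OF C(2)[OF x] add_right_mono] unfolding l(2) c_def by simp
    also have "\<dots> = ennreal (x powr \<alpha> * measure N {x<..} + (e * w x + C))"
      using e(2) C(1) w_nonneg[of x] by (simp add: ennreal_mult[symmetric] ennreal_plus[symmetric] del: ennreal_plus)
    finally show ?thesis using e(2) C(1) w_nonneg[of x] by (subst (asm) ennreal_le_iff) auto
  qed
  define g where "g = c - e - (1 - \<epsilon>) / \<rho>"
  have g: "g > 0" using c by (simp add: g_def)
  have "\<forall>\<^sub>F x in at_top. C / g \<le> w x" using w_at_top by (simp add: filterlim_at_top)
  then show ?thesis using eventually_gt_at_top[of 0]
  proof eventually_elim
    case (elim x)
    have "C \<le> g * w x" using elim(1) g by (simp add: field_simps)
    then have "C \<le> c * w x - e * w x - (1 - \<epsilon>) / \<rho> * w x" by (simp add: g_def left_diff_distrib)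
    then show ?case using le[OF elim(2)] by linarith
  qed
qed

end

section \<open>From the stationary random map to the affine recursion\<close>

text \<open>Conditioning on the value of \<open>X\<close>. After this the order relations for
  \<open>\<Psi>\<close> are needed only at fixed points \<open>z\<close>, where they hold almost
  surely. The second claim supplies the measurability needed to reflect the formula for the left
  tail.\<close>

lemma stationary_nn_integral:
  assumes M: "prob_space M" and lip: "random_lipschitz M \<Psi>" and st: "stationary M \<Psi> X"
    and [measurable]: "h \<in> borel_measurable borel"
  shows "(\<integral>\<^sup>+z. h z \<partial>distr M borel X) = (\<integral>\<^sup>+z. \<integral>\<^sup>+\<omega>. h (\<Psi> \<omega> z) \<partial>M \<partial>distr M borel X)"
    and "(\<lambda>z. \<integral>\<^sup>+\<omega>. h (\<Psi> \<omega> z) \<partial>M) \<in> borel_measurable borel"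
proof -
  interpret prob_space M by fact
  have Xm [measurable]: "X \<in> borel_measurable M" using st by (simp add: stationary_def)
  have Pm [measurable]: "\<Psi> \<in> measurable M path_algebra" using lip by (simp add: random_lipschitz_def)
  define N where "N = distr M borel X"
  define DP where "DP = distr M path_algebra \<Psi>"
  interpret N: prob_space N unfolding N_def by (rule prob_space_distr) measurable
  interpret DP: prob_space DP unfolding DP_def by (rule prob_space_distr) measurable
  interpret PN: pair_sigma_finite DP N ..
  interpret MN: pair_sigma_finite N M ..
  have [measurable_cong]: "sets N = sets borel" "sets DP = sets path_algebra" by (simp_all add: N_def DP_def)
  \<comment> \<open>The evaluation map is not measurable on the product sigma-algebra, but agrees on continuous
    functions with a limit of evaluations at discretised points, which is.\<close>
  define ek :: "nat \<Rightarrow> (real \<Rightarrow> real) \<times> real \<Rightarrow> real"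
    where "ek k p = fst p (real_of_int \<lfloor>real (Suc k) * snd p\<rfloor> / real (Suc k))" for k p
  define ev where "ev p = lim (\<lambda>k. ek k p)" for p
  have ek_meas: "ek k \<in> borel_measurable (path_algebra \<Otimes>\<^sub>M borel)" for k
  proof -
    have "(\<lambda>p. fst p (real_of_int \<lfloor>real (Suc k) * snd p\<rfloor> / real (Suc k))) \<in> borel_measurable (path_algebra \<Otimes>\<^sub>M borel)"
    proof (rule measurable_compose_countable[where f = "\<lambda>i p. fst p (real_of_int i / real (Suc k))" and g = "\<lambda>p. \<lfloor>real (Suc k) * snd p\<rfloor>"])
      fix i :: int
      have "(\<lambda>f. f (real_of_int i / real (Suc k))) \<in> borel_measurable path_algebra"
        unfolding path_algebra_def by (rule measurable_component_singleton) simp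
      then show "(\<lambda>p. fst p (real_of_int i / real (Suc k))) \<in> borel_measurable (path_algebra \<Otimes>\<^sub>M borel)"
        by (rule measurable_compose[OF measurable_fst])
    qed measurable
    then show ?thesis unfolding ek_def .
  qed
  have ev_meas [measurable]: "ev \<in> borel_measurable (path_algebra \<Otimes>\<^sub>M borel)"
    unfolding ev_def using ek_meas by (rule borel_measurable_lim_metric)
  have ev_eq: "ev (\<Psi> \<omega>, z) = \<Psi> \<omega> z" if "\<omega> \<in> space M" for \<omega> z
  proof -
    obtain C where "C-lipschitz_on UNIV (\<Psi> \<omega>)" using lip \<open>\<omega> \<in> space M\<close> by (auto simp: random_lipschitz_def)
    then have "continuous_on UNIV (\<Psi> \<omega>)" by (rule lipschitz_on_continuous_on)
    then have cont: "isCont (\<Psi> \<omega>) z" by (simp add: continuous_on_eq_continuous_at)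
    have "(\<lambda>k. real_of_int \<lfloor>real (Suc k) * z\<rfloor> / real (Suc k)) \<longlonglongrightarrow> z"
    proof (rule LIM_zero_cancel, rule LIMSEQ_norm_0)
      fix k
      define c where "c = real (Suc k)"
      have c: "c > 0" by (simp add: c_def)
      have "\<bar>real_of_int \<lfloor>c * z\<rfloor> - c * z\<bar> < 1" by linarith
      then have "\<bar>real_of_int \<lfloor>c * z\<rfloor> - c * z\<bar> / c < 1 / c" using c by (intro divide_strict_right_mono) auto
      moreover have "real_of_int \<lfloor>c * z\<rfloor> / c - z = (real_of_int \<lfloor>c * z\<rfloor> - c * z) / c" using c by (simp add: field_simps)
      ultimately show "norm (real_of_int \<lfloor>real (Suc k) * z\<rfloor> / real (Suc k) - z) < 1 / real (Suc k)"
        using c unfolding c_def[symmetric] by simp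
    qed
    from isCont_tendsto_compose[OF cont this] have "(\<lambda>k. ek k (\<Psi> \<omega>, z)) \<longlonglongrightarrow> \<Psi> \<omega> z" by (simp add: ek_def)
    then show ?thesis unfolding ev_def by (rule limI)
  qed
  \<comment> \<open>Independence of the generated sigma-algebras says that the joint law and the
    product of the marginals agree on rectangles.\<close>
  have J: "DP \<Otimes>\<^sub>M N = distr M (path_algebra \<Otimes>\<^sub>M borel) (\<lambda>\<omega>. (\<Psi> \<omega>, X \<omega>))"
  proof (rule pair_measure_eqI)
    show "sigma_finite_measure DP" "sigma_finite_measure N" ..
    show "sets (DP \<Otimes>\<^sub>M N) = sets (distr M (path_algebra \<Otimes>\<^sub>M borel) (\<lambda>\<omega>. (\<Psi> \<omega>, X \<omega>)))"
      by (simp add: N_def DP_def cong: sets_pair_measure_cong)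
    fix a b assume ab: "a \<in> sets DP" "b \<in> sets N"
    then have [measurable]: "a \<in> sets path_algebra" "b \<in> sets borel" by (auto simp: N_def DP_def)
    have ind: "indep_set (sets (vimage_algebra (space M) \<Psi> path_algebra)) (sets (vimage_algebra (space M) X borel))"
      using st by (simp add: stationary_def)
    have "prob ((\<Psi> -` a \<inter> space M) \<inter> (X -` b \<inter> space M)) = prob (\<Psi> -` a \<inter> space M) * prob (X -` b \<inter> space M)"
      by (rule indep_setD[OF ind]) (auto intro: in_vimage_algebra)
    moreover have "(\<lambda>\<omega>. (\<Psi> \<omega>, X \<omega>)) -` (a \<times> b) \<inter> space M = (\<Psi> -` a \<inter> space M) \<inter> (X -` b \<inter> space M)" by auto
    ultimately show "emeasure DP a * emeasure N b = emeasure (distr M (path_algebra \<Otimes>\<^sub>M borel) (\<lambda>\<omega>. (\<Psi> \<omega>, X \<omega>))) (a \<times> b)"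
      by (simp add: DP_def N_def emeasure_distr emeasure_eq_measure ennreal_mult)
  qed
  have "(\<integral>\<^sup>+z. h z \<partial>N) = (\<integral>\<^sup>+z. h z \<partial>distr M borel (\<lambda>\<omega>. \<Psi> \<omega> (X \<omega>)))"
    unfolding N_def using st by (simp add: stationary_def)
  also have "\<dots> = (\<integral>\<^sup>+z. h z \<partial>distr M borel (\<lambda>\<omega>. ev (\<Psi> \<omega>, X \<omega>)))"
    by (simp add: ev_eq cong: distr_cong)
  also have "\<dots> = (\<integral>\<^sup>+\<omega>. h (ev (\<Psi> \<omega>, X \<omega>)) \<partial>M)" by (rule nn_integral_distr) measurable
  also have "\<dots> = (\<integral>\<^sup>+p. h (ev p) \<partial>(DP \<Otimes>\<^sub>M N))" unfolding J by (rule nn_integral_distr[symmetric]) measurable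
  also have "\<dots> = (\<integral>\<^sup>+z. \<integral>\<^sup>+f. h (ev (f, z)) \<partial>DP \<partial>N)"
    by (subst PN.nn_integral_snd[symmetric]) auto
  also have "\<dots> = (\<integral>\<^sup>+z. \<integral>\<^sup>+\<omega>. h (ev (\<Psi> \<omega>, z)) \<partial>M \<partial>N)"
    unfolding DP_def by (intro nn_integral_cong nn_integral_distr) measurable
  also have "\<dots> = (\<integral>\<^sup>+z. \<integral>\<^sup>+\<omega>. h (\<Psi> \<omega> z) \<partial>M \<partial>N)"
    by (intro nn_integral_cong) (simp add: ev_eq)
  finally show "(\<integral>\<^sup>+z. h z \<partial>distr M borel X) = (\<integral>\<^sup>+z. \<integral>\<^sup>+\<omega>. h (\<Psi> \<omega> z) \<partial>M \<partial>distr M borel X)"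
    unfolding N_def .
  have "(\<lambda>z. \<integral>\<^sup>+\<omega>. h (\<Psi> \<omega> z) \<partial>M) = (\<lambda>z. \<integral>\<^sup>+\<omega>. h (ev (\<Psi> \<omega>, z)) \<partial>M)"
    by (intro ext nn_integral_cong) (simp add: ev_eq)
  also have "\<dots> \<in> borel_measurable borel" by measurable
  finally show "(\<lambda>z. \<integral>\<^sup>+\<omega>. h (\<Psi> \<omega> z) \<partial>M) \<in> borel_measurable borel" .
qed

lemma (in tilted_multiplier) perpetuity_tailI:
  assumes A': "AE \<omega> in M. A \<omega> = A' \<omega>" and Y: "Y \<in> borel_measurable M" "A' \<in> borel_measurable M" and rt: "right_tail_conditions M \<alpha> A' Y"
  shows "perpetuity_tail M A Y \<alpha>"
proof -
  have [measurable]: "Y \<in> borel_measurable M" "A' \<in> borel_measurable M" by fact+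
  have sv: "slowly_varying_tail M Y \<alpha>"
    by unfold_locales (use rt Y alpha_pos in \<open>auto simp: right_tail_conditions_def\<close>)
  show ?thesis
  proof (intro perpetuity_tail.intro sv perpetuity_tail_axioms.intro)
    show "tilted_multiplier M A \<alpha>" ..
    fix s assume s: "0 < s" "s < \<alpha>"
    have "\<forall>\<epsilon>\<in>{0<..<\<alpha>}. integrable M (\<lambda>\<omega>. max (- Y \<omega>) 0 powr (\<alpha> - \<epsilon>))" using rt unfolding right_tail_conditions_def by blast
    moreover have "\<alpha> - s \<in> {0<..<\<alpha>}" using s by auto
    ultimately have "integrable M (\<lambda>\<omega>. max (- Y \<omega>) 0 powr (\<alpha> - (\<alpha> - s)))" by blast
    then show "integrable M (\<lambda>\<omega>. max (- Y \<omega>) 0 powr s)" by simp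
  next
    obtain \<eta> where \<eta>: "\<eta> \<in> {0<..<\<alpha>} \<inter> {0<..1}" "integrable M (\<lambda>\<omega>. A' \<omega> powr \<eta> * max (Y \<omega>) 0 powr (\<alpha> - \<eta>))"
      using rt unfolding right_tail_conditions_def by blast
    have "integrable M (\<lambda>\<omega>. A \<omega> powr \<eta> * max (Y \<omega>) 0 powr (\<alpha> - \<eta>))"
      by (subst integrable_cong_AE[where g = "\<lambda>\<omega>. A' \<omega> powr \<eta> * max (Y \<omega>) 0 powr (\<alpha> - \<eta>)"]) (use A' \<eta> in auto)
    with \<eta>(1) show "\<exists>\<eta>\<in>{0<..<\<alpha>} \<inter> {0<..1}. integrable M (\<lambda>\<omega>. A \<omega> powr \<eta> * max (Y \<omega>) 0 powr (\<alpha> - \<eta>))" by blast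
  qed
qed

text \<open>The affine bounds make the stationary law substationary for the recursion driven by
  \<open>B\<close> and superstationary for the one driven by \<open>B1\<close>. The upper bound
  applies to the first recursion and the lower bound to the second.\<close>

lemma (in tilted_multiplier) right_tail_asymptotics:
  fixes \<Psi> :: "'a \<Rightarrow> real \<Rightarrow> real"
  assumes B: "perpetuity_tail M A B \<alpha>" and B1: "perpetuity_tail M A B1 \<alpha>"
    and N: "prob_space N" and sets: "sets N = sets borel"
    and stat: "\<And>h. h \<in> borel_measurable borel \<Longrightarrow> (\<integral>\<^sup>+z. h z \<partial>N) = (\<integral>\<^sup>+z. \<integral>\<^sup>+\<omega>. h (\<Psi> \<omega> z) \<partial>M \<partial>N)"
    and bounds: "\<And>z. AE \<omega> in M. A \<omega> * z + B1 \<omega> \<le> \<Psi> \<omega> z \<and> \<Psi> \<omega> z \<le> A \<omega> * z + B \<omega>"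
  shows "(\<forall>\<epsilon>>0. \<forall>\<^sub>F x in at_top.
          (1 - \<epsilon>) / \<rho> * log_integral (right_tail M \<alpha> B1) x \<le> x powr \<alpha> * measure N {x<..} \<and>
          x powr \<alpha> * measure N {x<..} \<le> (1 + \<epsilon>) / \<rho> * log_integral (right_tail M \<alpha> B) x) \<and>
       (log_integral (right_tail M \<alpha> B) \<sim>[at_top] log_integral (right_tail M \<alpha> B1) \<longrightarrow>
          (\<lambda>x. x powr \<alpha> * measure N {x<..}) \<sim>[at_top] (\<lambda>x. 1 / \<rho> * log_integral (right_tail M \<alpha> B) x))"
proof -
  interpret B: perpetuity_tail M A B \<alpha> by fact
  interpret B1: perpetuity_tail M A B1 \<alpha> by fact
  \<comment> \<open>Then |\<open>\<Psi>\<close> z| \<le> A |z| + Z almost surely for each z, a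
    single affine domination from which all moments below \<alpha> follow.\<close>
  define Z where "Z \<omega> = \<bar>B \<omega>\<bar> + \<bar>B1 \<omega>\<bar>" for \<omega>
  have Zm [measurable]: "Z \<in> borel_measurable M" unfolding Z_def by measurable
  have Z0: "Z \<omega> \<ge> 0" for \<omega> by (simp add: Z_def)
  have Zmom: "(\<integral>\<^sup>+\<omega>. ennreal (Z \<omega> powr s) \<partial>M) < \<infinity>" if s: "0 < s" "s < \<alpha>" for s
  proof -
    obtain C where C: "C \<ge> 0" "\<And>a b::real. a \<ge> 0 \<Longrightarrow> b \<ge> 0 \<Longrightarrow> (a + b) powr s \<le> (1 + 1) * a powr s + C * b powr s"
      using powr_add_le[OF s(1), of 1] by auto
    have "(\<integral>\<^sup>+\<omega>. ennreal (Z \<omega> powr s) \<partial>M) \<le> (\<integral>\<^sup>+\<omega>. ennreal 2 * ennreal (\<bar>B \<omega>\<bar> powr s) + ennreal C * ennreal (\<bar>B1 \<omega>\<bar> powr s) \<partial>M)"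
    proof (rule nn_integral_mono)
      fix \<omega>
      have "Z \<omega> powr s \<le> 2 * \<bar>B \<omega>\<bar> powr s + C * \<bar>B1 \<omega>\<bar> powr s"
        using C(2)[of "\<bar>B \<omega>\<bar>" "\<bar>B1 \<omega>\<bar>"] by (simp add: Z_def)
      then have "ennreal (Z \<omega> powr s) \<le> ennreal (2 * \<bar>B \<omega>\<bar> powr s + C * \<bar>B1 \<omega>\<bar> powr s)" by (rule ennreal_leI)
      also have "\<dots> = ennreal (2 * \<bar>B \<omega>\<bar> powr s) + ennreal (C * \<bar>B1 \<omega>\<bar> powr s)"
        using C(1) by (intro ennreal_plus) auto
      also have "\<dots> = ennreal 2 * ennreal (\<bar>B \<omega>\<bar> powr s) + ennreal C * ennreal (\<bar>B1 \<omega>\<bar> powr s)"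
        using C(1) by (simp only: ennreal_mult[of 2] ennreal_mult[of C] powr_ge_zero)
      finally show "ennreal (Z \<omega> powr s) \<le> ennreal 2 * ennreal (\<bar>B \<omega>\<bar> powr s) + ennreal C * ennreal (\<bar>B1 \<omega>\<bar> powr s)" .
    qed
    also have "\<dots> = ennreal 2 * (\<integral>\<^sup>+\<omega>. ennreal (\<bar>B \<omega>\<bar> powr s) \<partial>M) + ennreal C * (\<integral>\<^sup>+\<omega>. ennreal (\<bar>B1 \<omega>\<bar> powr s) \<partial>M)"
      by (subst nn_integral_add) (auto simp: nn_integral_cmult)
    also have "\<dots> < \<infinity>" using B.Y_moment[OF s] B1.Y_moment[OF s] by (simp add: ennreal_mult_less_top)
    finally show ?thesis .
  qed
  have dom: "(\<integral>\<^sup>+z. h \<bar>z\<bar> \<partial>N) \<le> (\<integral>\<^sup>+z. \<integral>\<^sup>+\<omega>. h (A \<omega> * \<bar>z\<bar> + Z \<omega>) \<partial>M \<partial>N)"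
    if h: "mono h" and [measurable]: "h \<in> borel_measurable borel" for h :: "real \<Rightarrow> ennreal"
  proof -
    have "(\<integral>\<^sup>+z. h \<bar>z\<bar> \<partial>N) = (\<integral>\<^sup>+z. \<integral>\<^sup>+\<omega>. h \<bar>\<Psi> \<omega> z\<bar> \<partial>M \<partial>N)" by (rule stat) measurable
    also have "\<dots> \<le> (\<integral>\<^sup>+z. \<integral>\<^sup>+\<omega>. h (A \<omega> * \<bar>z\<bar> + Z \<omega>) \<partial>M \<partial>N)"
    proof (rule nn_integral_mono, rule nn_integral_mono_AE, use bounds in eventually_elim)
      fix z \<omega> assume b: "A \<omega> * z + B1 \<omega> \<le> \<Psi> \<omega> z \<and> \<Psi> \<omega> z \<le> A \<omega> * z + B \<omega>"
      have "\<bar>A \<omega> * z\<bar> = A \<omega> * \<bar>z\<bar>" using A_nonneg[of \<omega>] by (simp add: abs_mult)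
      then have "\<bar>\<Psi> \<omega> z\<bar> \<le> A \<omega> * \<bar>z\<bar> + Z \<omega>"
        using b abs_ge_self[of "A \<omega> * z"] abs_ge_minus_self[of "A \<omega> * z"] abs_ge_self[of "B \<omega>"] abs_ge_minus_self[of "B1 \<omega>"]
          abs_ge_zero[of "B \<omega>"] abs_ge_zero[of "B1 \<omega>"]
        unfolding Z_def abs_le_iff by linarith
      then show "h \<bar>\<Psi> \<omega> z\<bar> \<le> h (A \<omega> * \<bar>z\<bar> + Z \<omega>)" by (rule monoD[OF h])
    qed
    finally show ?thesis .
  qed
  have mom: "(\<integral>\<^sup>+z. ennreal (\<bar>z\<bar> powr s) \<partial>N) < \<infinity>" if "0 < s" "s < \<alpha>" for s
    using stationary_moment[OF N sets Zm Z0 Zmom dom that] .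
  \<comment> \<open>The exceptional null set in \<open>bounds\<close> may depend on
    \<open>z\<close>. This is harmless because \<open>z\<close> is fixed in the inner integral over
    \<omega>.\<close>
  have leB: "st_le N (B.aff N)"
    unfolding st_le_def
  proof safe
    fix h :: "real \<Rightarrow> ennreal" assume h: "mono h" and hm: "h \<in> borel_measurable borel"
    show "(\<integral>\<^sup>+z. h z \<partial>N) \<le> (\<integral>\<^sup>+z. h z \<partial>B.aff N)"
      unfolding B.nn_aff[OF sets hm] stat[OF hm]
      by (rule nn_integral_mono, rule nn_integral_mono_AE, use bounds in eventually_elim) (auto intro: monoD[OF h])
  qed
  have leB1: "st_le (B1.aff N) N"
    unfolding st_le_def
  proof safe
    fix h :: "real \<Rightarrow> ennreal" assume h: "mono h" and hm: "h \<in> borel_measurable borel"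
    show "(\<integral>\<^sup>+z. h z \<partial>B1.aff N) \<le> (\<integral>\<^sup>+z. h z \<partial>N)"
      unfolding B1.nn_aff[OF sets hm] stat[OF hm]
      by (rule nn_integral_mono, rule nn_integral_mono_AE, use bounds in eventually_elim) (auto intro: monoD[OF h])
  qed
  have up: "\<forall>\<^sub>F x in at_top. x powr \<alpha> * measure N {x<..} \<le> (1 + \<epsilon>) / \<rho> * B.w x" if "\<epsilon> > 0" for \<epsilon>
    by (rule B.right_upper[OF N sets leB mom that])
  have lo: "\<forall>\<^sub>F x in at_top. (1 - \<epsilon>) / \<rho> * B1.w x \<le> x powr \<alpha> * measure N {x<..}" if "\<epsilon> > 0" for \<epsilon>
    by (rule B1.right_lower[OF N sets leB1 mom that])
  have "(\<lambda>x. x powr \<alpha> * measure N {x<..}) \<sim>[at_top] (\<lambda>x. 1 / \<rho> * B.w x)"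
    if eq: "B.w \<sim>[at_top] B1.w"
  proof (rule asymp_equivI')
    have "\<forall>\<^sub>F x in at_top. B1.w x \<noteq> 0 \<or> B.w x \<noteq> 0"
      using eventually_gt_at_top[of 0] by eventually_elim (use B.w_pos in force)
    then have lim: "((\<lambda>x. B1.w x / B.w x) \<longlongrightarrow> 1) at_top"
      using asymp_equiv_symI[OF eq] by (rule asymp_equivD_strong[rotated])
    show "((\<lambda>x. x powr \<alpha> * measure N {x<..} / (1 / \<rho> * B.w x)) \<longlongrightarrow> 1) at_top"
    proof (rule order_tendstoI)
      fix y :: real assume y: "y < 1"
      define e where "e = (1 - y) / 2"
      have e: "e > 0" "1 - e > y" using y by (auto simp: e_def field_simps)
      have "((\<lambda>x. (1 - e) * (B1.w x / B.w x)) \<longlongrightarrow> (1 - e) * 1) at_top" by (intro tendsto_intros lim)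
      then have "\<forall>\<^sub>F x in at_top. (1 - e) * (B1.w x / B.w x) > y" using e by (intro order_tendstoD(1)) auto
      then show "\<forall>\<^sub>F x in at_top. y < x powr \<alpha> * measure N {x<..} / (1 / \<rho> * B.w x)"
        using lo[OF e(1)] eventually_gt_at_top[of 0]
      proof eventually_elim
        case (elim x)
        have "B.w x > 0" using elim by (intro B.w_pos) auto
        then have "(1 - e) / \<rho> * B1.w x / (1 / \<rho> * B.w x) \<le> x powr \<alpha> * measure N {x<..} / (1 / \<rho> * B.w x)"
          using elim(2) rho_pos by (intro divide_right_mono) auto
        moreover have "(1 - e) / \<rho> * B1.w x / (1 / \<rho> * B.w x) = (1 - e) * (B1.w x / B.w x)" using rho_pos by simp
        ultimately have "(1 - e) * (B1.w x / B.w x) \<le> x powr \<alpha> * measure N {x<..} / (1 / \<rho> * B.w x)" by (simp only:)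
        with elim(1) show ?case by linarith
      qed
    next
      fix y :: real assume y: "y > 1"
      define e where "e = (y - 1) / 2"
      have e: "e > 0" "1 + e < y" using y by (auto simp: e_def field_simps)
      show "\<forall>\<^sub>F x in at_top. y > x powr \<alpha> * measure N {x<..} / (1 / \<rho> * B.w x)"
        using up[OF e(1)] eventually_gt_at_top[of 0]
      proof eventually_elim
        case (elim x)
        have "B.w x > 0" using elim by (intro B.w_pos) auto
        then have "x powr \<alpha> * measure N {x<..} / (1 / \<rho> * B.w x) \<le> 1 + e"
          using elim(1) rho_pos by (simp add: field_simps)
        with e(2) show ?case by linarith
      qed
    qed
  qed
  then show ?thesis by (intro conjI allI impI eventually_conj lo up)
qed

section \<open>Reflection and assembly of both tails\<close>

lemma left_tail_eq: "left_tail M \<alpha> Y = right_tail M \<alpha> (\<lambda>\<omega>. - Y \<omega>)"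
  by (simp add: left_tail_def right_tail_def fun_eq_iff less_minus_iff)

lemma left_tail_conditions_eq: "left_tail_conditions M \<alpha> A Y = right_tail_conditions M \<alpha> A (\<lambda>\<omega>. - Y \<omega>)"
  by (simp add: left_tail_conditions_def right_tail_conditions_def left_tail_eq)

theorem theorem1p4:
  fixes M :: "'a measure" and \<alpha> \<rho> :: real
    and A B B1 X :: "'a \<Rightarrow> real"
    and \<Psi> :: "'a \<Rightarrow> real \<Rightarrow> real" and \<Psi>s :: "nat \<Rightarrow> 'a \<Rightarrow> real \<Rightarrow> real"
  assumes "prob_space M"
    and "\<alpha> > 0"
    and "A \<in> borel_measurable M" "B \<in> borel_measurable M" "B1 \<in> borel_measurable M"
    and "random_lipschitz M \<Psi>"
    and "iid_copies M \<Psi> \<Psi>s"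
    and "integrable M (\<lambda>\<omega>. log_plus (lip_const (\<Psi> \<omega>)))"
    and "integrable M (\<lambda>\<omega>. log_plus \<bar>\<Psi> \<omega> 0\<bar>)"
    and "AE \<omega> in M. \<exists>l<0. (\<lambda>n. ereal (1 / real n) * elog (lip_const (fwd_comp (\<lambda>k. \<Psi>s k \<omega>) n))) \<longlonglongrightarrow> l"
    and "\<And>x. AE \<omega> in M. A \<omega> * x + B1 \<omega> \<le> \<Psi> \<omega> x \<and> \<Psi> \<omega> x \<le> A \<omega> * x + B \<omega>"
    and "AE \<omega> in M. A \<omega> \<ge> 0"
    and "\<not> arithmetic_law (distr (uniform_measure M {\<omega> \<in> space M. A \<omega> > 0}) borel (\<lambda>\<omega>. ln (A \<omega>)))"
    and "integrable M (\<lambda>\<omega>. A \<omega> powr \<alpha>)" "(\<integral>\<omega>. A \<omega> powr \<alpha> \<partial>M) = 1"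
    and "integrable M (\<lambda>\<omega>. A \<omega> powr \<alpha> * ln (A \<omega>))"
    and "\<rho> = (\<integral>\<omega>. A \<omega> powr \<alpha> * ln (A \<omega>) \<partial>M)"
    and "stationary M \<Psi> X"
  shows
    "(right_tail_conditions M \<alpha> A B \<and> right_tail_conditions M \<alpha> A B1 \<longrightarrow>
       (\<forall>\<epsilon>>0. \<forall>\<^sub>F x in at_top.
          (1 - \<epsilon>) / \<rho> * log_integral (right_tail M \<alpha> B1) x \<le> x powr \<alpha> * \<P>(\<omega> in M. X \<omega> > x) \<and>
          x powr \<alpha> * \<P>(\<omega> in M. X \<omega> > x) \<le> (1 + \<epsilon>) / \<rho> * log_integral (right_tail M \<alpha> B) x) \<and>
       (log_integral (right_tail M \<alpha> B) \<sim>[at_top] log_integral (right_tail M \<alpha> B1) \<longrightarrow>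
          (\<lambda>x. x powr \<alpha> * \<P>(\<omega> in M. X \<omega> > x)) \<sim>[at_top]
            (\<lambda>x. 1 / \<rho> * log_integral (right_tail M \<alpha> B) x))) \<and>
     (left_tail_conditions M \<alpha> A B \<and> left_tail_conditions M \<alpha> A B1 \<longrightarrow>
       (\<forall>\<epsilon>>0. \<forall>\<^sub>F x in at_top.
          (1 - \<epsilon>) / \<rho> * log_integral (left_tail M \<alpha> B) x \<le> x powr \<alpha> * \<P>(\<omega> in M. X \<omega> < - x) \<and>
          x powr \<alpha> * \<P>(\<omega> in M. X \<omega> < - x) \<le> (1 + \<epsilon>) / \<rho> * log_integral (left_tail M \<alpha> B1) x) \<and>
       (log_integral (left_tail M \<alpha> B) \<sim>[at_top] log_integral (left_tail M \<alpha> B1) \<longrightarrow>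
          (\<lambda>x. x powr \<alpha> * \<P>(\<omega> in M. X \<omega> < - x)) \<sim>[at_top]
            (\<lambda>x. 1 / \<rho> * log_integral (left_tail M \<alpha> B) x)))"
proof -
  interpret prob_space M by fact
  have [measurable]: "A \<in> borel_measurable M" "B \<in> borel_measurable M" "B1 \<in> borel_measurable M" by fact+
  have Xm [measurable]: "X \<in> borel_measurable M" using \<open>stationary M \<Psi> X\<close> by (simp add: stationary_def)
  \<comment> \<open>A version of \<open>A\<close> that is non-negative everywhere, as the locale
    requires; integrals and almost sure statements do not notice the change.\<close>
  define A' where "A' \<omega> = max 0 (A \<omega>)" for \<omega>
  have A'm [measurable]: "A' \<in> borel_measurable M" unfolding A'_def by measurable
  have AA: "AE \<omega> in M. A' \<omega> = A \<omega>" using \<open>AE \<omega> in M. A \<omega> \<ge> 0\<close> by eventually_elim (simp add: A'_def)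
  \<comment> \<open>If \<open>A = 1\<close> almost surely, the conditional law of
    \<open>ln A\<close> is concentrated at 0 and hence arithmetic.\<close>
  have nontriv: "\<not> (AE \<omega> in M. A' \<omega> = 1)"
  proof
    assume *: "AE \<omega> in M. A' \<omega> = 1"
    have "AE \<omega> in uniform_measure M {\<omega> \<in> space M. A \<omega> > 0}. ln (A \<omega>) = 0"
      by (rule AE_uniform_measureI) (use AA * in \<open>auto elim!: eventually_mono[OF eventually_conj]\<close>)
    then have "arithmetic_law (distr (uniform_measure M {\<omega> \<in> space M. A \<omega> > 0}) borel (\<lambda>\<omega>. ln (A \<omega>)))"
      unfolding arithmetic_law_def by (intro exI[of _ 1]) (auto simp: AE_distr_iff elim!: eventually_mono intro: exI[of _ 0])
    then show False using assms by simp
  qed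
  have tilted: "tilted_multiplier M A' \<alpha>"
  proof unfold_locales
    show "integrable M (\<lambda>\<omega>. A' \<omega> powr \<alpha>)"
      by (subst integrable_cong_AE[where g = "\<lambda>\<omega>. A \<omega> powr \<alpha>"]) (use AA assms in auto)
    have "(\<integral>\<omega>. A' \<omega> powr \<alpha> \<partial>M) = (\<integral>\<omega>. A \<omega> powr \<alpha> \<partial>M)"
      by (rule integral_cong_AE) (use AA in auto)
    then show "(\<integral>\<omega>. A' \<omega> powr \<alpha> \<partial>M) = 1" using assms by simp
    show "integrable M (\<lambda>\<omega>. A' \<omega> powr \<alpha> * ln (A' \<omega>))"
      by (subst integrable_cong_AE[where g = "\<lambda>\<omega>. A \<omega> powr \<alpha> * ln (A \<omega>)"]) (use AA assms in auto)
  qed (use assms nontriv in \<open>auto simp: A'_def\<close>)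
  interpret tilted_multiplier M A' \<alpha> by fact
  have rho: "tilted_multiplier.\<rho> M A' \<alpha> = \<rho>"
    unfolding \<rho>_def assms(17) by (rule integral_cong_AE) (use AA in auto)
  define N where "N = distr M borel X"
  have N: "prob_space N" "sets N = sets borel" unfolding N_def by (auto intro: prob_space_distr)
  have stat: "(\<integral>\<^sup>+z. h z \<partial>N) = (\<integral>\<^sup>+z. \<integral>\<^sup>+\<omega>. h (\<Psi> \<omega> z) \<partial>M \<partial>N)" if "h \<in> borel_measurable borel" for h
    unfolding N_def using stationary_nn_integral(1)[OF assms(1,6,18) that] .
  have bounds: "AE \<omega> in M. A' \<omega> * z + B1 \<omega> \<le> \<Psi> \<omega> z \<and> \<Psi> \<omega> z \<le> A' \<omega> * z + B \<omega>" for z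
    using assms(11)[of z] AA by eventually_elim simp
  have mN: "measure N {x<..} = \<P>(\<omega> in M. X \<omega> > x)" for x
    unfolding N_def by (subst measure_distr) (auto intro!: arg_cong[where f = prob])
  \<comment> \<open>The left tail is the right tail of \<open>- X\<close>, which is stationary for
    the map sending \<open>z\<close> to \<open>- \<Psi> (- z)\<close>. Its affine bounds keep the
    slope, but the roles are exchanged: \<open>- B1\<close> is now the upper intercept and
    \<open>- B\<close> the lower one.\<close>
  define N' where "N' = distr M borel (\<lambda>\<omega>. - X \<omega>)"
  have N': "prob_space N'" "sets N' = sets borel" unfolding N'_def by (auto intro: prob_space_distr)
  have N'_eq: "(\<integral>\<^sup>+z. h z \<partial>N') = (\<integral>\<^sup>+z. h (- z) \<partial>N)" if [measurable]: "h \<in> borel_measurable borel" for h :: "real \<Rightarrow> ennreal"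
    unfolding N_def N'_def by (subst (1 2) nn_integral_distr) auto
  have stat': "(\<integral>\<^sup>+z. h z \<partial>N') = (\<integral>\<^sup>+z. \<integral>\<^sup>+\<omega>. h (- \<Psi> \<omega> (- z)) \<partial>M \<partial>N')" if hm [measurable]: "h \<in> borel_measurable borel" for h
  proof -
    have m: "(\<lambda>z. h (- z)) \<in> borel_measurable borel" by measurable
    have [measurable]: "(\<lambda>z. \<integral>\<^sup>+\<omega>. h (- \<Psi> \<omega> z) \<partial>M) \<in> borel_measurable borel"
      using stationary_nn_integral(2)[OF assms(1,6,18) m] .
    have "(\<integral>\<^sup>+z. h z \<partial>N') = (\<integral>\<^sup>+z. h (- z) \<partial>N)" by (rule N'_eq[OF hm])
    also have "\<dots> = (\<integral>\<^sup>+z. \<integral>\<^sup>+\<omega>. h (- \<Psi> \<omega> z) \<partial>M \<partial>N)" by (rule stat[OF m])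
    also have "\<dots> = (\<integral>\<^sup>+z. \<integral>\<^sup>+\<omega>. h (- \<Psi> \<omega> (- z)) \<partial>M \<partial>N')"
      by (subst N'_eq) simp_all
    finally show ?thesis .
  qed
  have bounds': "AE \<omega> in M. A' \<omega> * z + (- B \<omega>) \<le> - \<Psi> \<omega> (- z) \<and> - \<Psi> \<omega> (- z) \<le> A' \<omega> * z + (- B1 \<omega>)" for z
    using bounds[of "- z"] by eventually_elim auto
  have mN': "measure N' {x<..} = \<P>(\<omega> in M. X \<omega> < - x)" for x
    unfolding N'_def by (subst measure_distr) (auto intro!: arg_cong[where f = prob])
  show ?thesis
  proof (intro conjI[of "_ \<longrightarrow> _" "_ \<longrightarrow> _"] impI)
    assume "right_tail_conditions M \<alpha> A B \<and> right_tail_conditions M \<alpha> A B1"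
    then have "perpetuity_tail M A' B \<alpha>" "perpetuity_tail M A' B1 \<alpha>"
      using AA by (auto intro!: perpetuity_tailI[where A' = A])
    from right_tail_asymptotics[OF this N stat bounds]
    show "(\<forall>\<epsilon>>0. \<forall>\<^sub>F x in at_top.
          (1 - \<epsilon>) / \<rho> * log_integral (right_tail M \<alpha> B1) x \<le> x powr \<alpha> * \<P>(\<omega> in M. X \<omega> > x) \<and>
          x powr \<alpha> * \<P>(\<omega> in M. X \<omega> > x) \<le> (1 + \<epsilon>) / \<rho> * log_integral (right_tail M \<alpha> B) x) \<and>
       (log_integral (right_tail M \<alpha> B) \<sim>[at_top] log_integral (right_tail M \<alpha> B1) \<longrightarrow>
          (\<lambda>x. x powr \<alpha> * \<P>(\<omega> in M. X \<omega> > x)) \<sim>[at_top]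
            (\<lambda>x. 1 / \<rho> * log_integral (right_tail M \<alpha> B) x))"
      unfolding rho mN .
  next
    assume "left_tail_conditions M \<alpha> A B \<and> left_tail_conditions M \<alpha> A B1"
    then have pt: "perpetuity_tail M A' (\<lambda>\<omega>. - B \<omega>) \<alpha>" "perpetuity_tail M A' (\<lambda>\<omega>. - B1 \<omega>) \<alpha>"
      using AA unfolding left_tail_conditions_eq by (auto intro!: perpetuity_tailI[where A' = A])
    note concl = right_tail_asymptotics[OF pt(2,1) N' stat' bounds', unfolded rho mN']
    show "(\<forall>\<epsilon>>0. \<forall>\<^sub>F x in at_top.
          (1 - \<epsilon>) / \<rho> * log_integral (left_tail M \<alpha> B) x \<le> x powr \<alpha> * \<P>(\<omega> in M. X \<omega> < - x) \<and>
          x powr \<alpha> * \<P>(\<omega> in M. X \<omega> < - x) \<le> (1 + \<epsilon>) / \<rho> * log_integral (left_tail M \<alpha> B1) x) \<and>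
       (log_integral (left_tail M \<alpha> B) \<sim>[at_top] log_integral (left_tail M \<alpha> B1) \<longrightarrow>
          (\<lambda>x. x powr \<alpha> * \<P>(\<omega> in M. X \<omega> < - x)) \<sim>[at_top]
            (\<lambda>x. 1 / \<rho> * log_integral (left_tail M \<alpha> B) x))"
      unfolding left_tail_eq
    proof (intro conjI impI)
      show "\<forall>\<epsilon>>0. \<forall>\<^sub>F x in at_top.
          (1 - \<epsilon>) / \<rho> * log_integral (right_tail M \<alpha> (\<lambda>\<omega>. - B \<omega>)) x \<le> x powr \<alpha> * \<P>(\<omega> in M. X \<omega> < - x) \<and>
          x powr \<alpha> * \<P>(\<omega> in M. X \<omega> < - x) \<le> (1 + \<epsilon>) / \<rho> * log_integral (right_tail M \<alpha> (\<lambda>\<omega>. - B1 \<omega>)) x"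
        using concl by blast
      assume eq: "log_integral (right_tail M \<alpha> (\<lambda>\<omega>. - B \<omega>)) \<sim>[at_top] log_integral (right_tail M \<alpha> (\<lambda>\<omega>. - B1 \<omega>))"
      \<comment> \<open>The reflected result is normalised by the upper intercept
        \<open>- B1\<close>, whereas the claim is normalised by \<open>B\<close>; the assumed
        equivalence of the two integrals allows the exchange.\<close>
      have "(\<lambda>x. x powr \<alpha> * \<P>(\<omega> in M. X \<omega> < - x)) \<sim>[at_top] (\<lambda>x. 1 / \<rho> * log_integral (right_tail M \<alpha> (\<lambda>\<omega>. - B1 \<omega>)) x)"
        using concl asymp_equiv_symI[OF eq] by blast
      also have "\<dots> \<sim>[at_top] (\<lambda>x. 1 / \<rho> * log_integral (right_tail M \<alpha> (\<lambda>\<omega>. - B \<omega>)) x)"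
        by (intro asymp_equiv_mult asymp_equiv_refl asymp_equiv_symI[OF eq])
      finally show "(\<lambda>x. x powr \<alpha> * \<P>(\<omega> in M. X \<omega> < - x)) \<sim>[at_top] (\<lambda>x. 1 / \<rho> * log_integral (right_tail M \<alpha> (\<lambda>\<omega>. - B \<omega>)) x)" .
    qed
  qed
qed

end
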